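(* The commutator subgroup $T_\tau'$ of the golden ratio Thompson group $T_\tau$ is uniformly simple.
   Context: Let $\tau = \frac{\sqrt{5}-1}{2}$. The golden ratio Thompson group $T_\tau$ is the group of orientation preserving piecewise linear homeomorphisms $g$ of $\mathbf{R}/\mathbf{Z}$ such that: (1) $g$ has finitely many breakpoints, all of which lie in $\mathbf{Z}[\tau]/\mathbf{Z}$; (2) the slope of $g$, whenever it is defined, is an integer power of $\tau$; (3) $g$ preserves $\mathbf{Z}[\tau]/\mathbf{Z}$. A group $G$ is $n$-uniformly simple, for $n \in \mathbf{N}$, if for each pair $f, g \in G \setminus \{id\}$, $f$ can be expressed as a product of at most $n$ conjugates (in $G$) of the elements $g, g^{-1}$. $G$ is uniformly simple if it is $n$-uniformly simple for some $n \in \mathbf{N}$. *)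

theory Defs
  imports
    "HOL-Analysis.Analysis"
    "HOL-Algebra.Generated_Groups"
    "HOL-Computational_Algebra.Polynomial"
begin

section \<open>The circle $\mathbf{R}/\mathbf{Z}$\<close>

quotient_type circle = real / "\<lambda>x y :: real. x - y \<in> \<int>"
  morphisms rep_circle to_circle
proof (rule equivpI)
  show "reflp (\<lambda>x y :: real. x - y \<in> \<int>)"
    by (simp add: reflp_def)
  show "symp (\<lambda>x y :: real. x - y \<in> \<int>)"
    by (metis (no_types, lifting) Ints_minus minus_diff_eq sympI)
  show "transp (\<lambda>x y :: real. x - y \<in> \<int>)"
    by (rule transpI) (metis Ints_add diff_add_cancel add_diff_eq)
qed

lemma to_circle_eq_iff: "to_circle x = to_circle y \<longleftrightarrow> x - y \<in> \<int>"
  by (rule circle.abs_eq_iff)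

text \<open>The circle carries the quotient topology.\<close>

instantiation circle :: topological_space
begin

definition open_circle :: "circle set \<Rightarrow> bool"
  where "open_circle U \<longleftrightarrow> open (to_circle -` U)"

instance
  by standard (auto simp: open_circle_def vimage_Union)

end


section \<open>Piecewise linear homeomorphisms of the circle\<close>

definition homeo :: "(circle \<Rightarrow> circle) \<Rightarrow> bool"
  where "homeo g \<longleftrightarrow> (\<exists>h. homeomorphism UNIV UNIV g h)"

definition lift_of :: "(real \<Rightarrow> real) \<Rightarrow> (circle \<Rightarrow> circle) \<Rightarrow> bool"
  where "lift_of f g \<longleftrightarrow>
    continuous_on UNIV f \<and> (\<forall>x. to_circle (f x) = g (to_circle x))"

definition orientation_preserving :: "(circle \<Rightarrow> circle) \<Rightarrow> bool"
  where "orientation_preserving g \<longleftrightarrow> (\<exists>f. lift_of f g \<and> strict_mono f)"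

text \<open>In the coordinate \<open>t\<close> around \<open>p = to_circle x\<close>, the map \<open>g\<close> is given near \<open>p\<close> by
  \<open>x + t \<mapsto> y + s * t\<close>.  The slope \<open>s\<close> does not depend on the choice of \<open>x\<close> and \<open>y\<close>,
  which are determined modulo the integers.\<close>

definition has_slope :: "(circle \<Rightarrow> circle) \<Rightarrow> real \<Rightarrow> circle \<Rightarrow> bool"
  where "has_slope g s p \<longleftrightarrow>
    (\<exists>x y. p = to_circle x \<and>
       (\<exists>\<epsilon>>0. \<forall>t. \<bar>t\<bar> < \<epsilon> \<longrightarrow> g (to_circle (x + t)) = to_circle (y + s * t)))"

definition breakpoints :: "(circle \<Rightarrow> circle) \<Rightarrow> circle set"
  where "breakpoints g = {p. \<nexists>s. has_slope g s p}"

text \<open>As the circle is compact, a homeomorphism is piecewise linear iff it is affine near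
  all but finitely many points.\<close>

definition piecewise_linear :: "(circle \<Rightarrow> circle) \<Rightarrow> bool"
  where "piecewise_linear g \<longleftrightarrow> finite (breakpoints g)"


section \<open>The golden ratio Thompson group\<close>

definition tau :: real
  where "tau = (sqrt 5 - 1) / 2"

definition Z_tau :: "real set"
  where "Z_tau = range (\<lambda>p :: int poly. poly (map_poly of_int p) tau)"

definition Z_tau_mod_Z :: "circle set"
  where "Z_tau_mod_Z = to_circle ` Z_tau"

definition T_tau :: "(circle \<Rightarrow> circle) monoid"
  where "T_tau =
    \<lparr>carrier = {g. homeo g \<and> orientation_preserving g \<and> piecewise_linear g \<and>
        breakpoints g \<subseteq> Z_tau_mod_Z \<and>
        (\<forall>p s. has_slope g s p \<longrightarrow> (\<exists>k :: int. s = tau powi k)) \<and>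
        g ` Z_tau_mod_Z = Z_tau_mod_Z},
     mult = (\<circ>),
     one = id\<rparr>"

definition commutator_subgroup :: "('a, 'b) monoid_scheme \<Rightarrow> ('a, 'b) monoid_scheme"
  where "commutator_subgroup G = G\<lparr>carrier := derived G (carrier G)\<rparr>"


section \<open>Uniform simplicity\<close>

definition conjugates :: "('a, 'b) monoid_scheme \<Rightarrow> 'a \<Rightarrow> 'a set"
  where "conjugates G g = {h \<otimes>\<^bsub>G\<^esub> g \<otimes>\<^bsub>G\<^esub> inv\<^bsub>G\<^esub> h | h. h \<in> carrier G}"

definition n_uniformly_simple :: "nat \<Rightarrow> ('a, 'b) monoid_scheme \<Rightarrow> bool"
  where "n_uniformly_simple n G \<longleftrightarrow> group G \<and>
    (\<forall>f \<in> carrier G - {\<one>\<^bsub>G\<^esub>}. \<forall>g \<in> carrier G - {\<one>\<^bsub>G\<^esub>}.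
      \<exists>cs. length cs \<le> n \<and>
        set cs \<subseteq> conjugates G g \<union> conjugates G (inv\<^bsub>G\<^esub> g) \<and>
        f = foldr (\<otimes>\<^bsub>G\<^esub>) cs \<one>\<^bsub>G\<^esub>)"

definition uniformly_simple :: "('a, 'b) monoid_scheme \<Rightarrow> bool"
  where "uniformly_simple G \<longleftrightarrow> (\<exists>n. n_uniformly_simple n G)"

end

theory Submission
  imports Defs
begin

text \<open>Write \<open>T\<close> for the golden ratio Thompson group and \<open>T'\<close> for its commutator subgroup, and call
\<open>[f, g]\<close> a local commutator if \<open>f, g \<in> T\<close> fix a common arc pointwise.  Uniform simplicity follows
from two bounds.

For \<open>g \<noteq> id\<close>, every local commutator is a product of four conjugates of \<open>g\<close> and \<open>g\<^sup>-\<^sup>1\<close> by elements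
of \<open>T'\<close> (\<open>local_commutator_four_conjugates\<close>).  Indeed \<open>T'\<close> can squeeze the complement of any arc
into an arc \<open>U\<close> that \<open>g\<close> displaces.  If \<open>a\<close> and \<open>b\<close> are supported in \<open>U\<close>, then \<open>g a\<^sup>-\<^sup>1 g\<^sup>-\<^sup>1\<close> is
supported away from \<open>U\<close> and commutes with \<open>b\<close>, so \<open>[a, b] = [[a, g], b]\<close>, and the right hand side is
a product of four conjugates of \<open>g\<close> and \<open>g\<^sup>-\<^sup>1\<close>.

Every element of \<open>T'\<close> is a product of boundedly many local commutators
(\<open>bounded_local_commutator_width\<close>).  One local commutator takes care of the behaviour near \<open>0\<close>; what
is left is the identity near \<open>0\<close> and is therefore given by a homeomorphism \<open>k\<close> of the line that is
supported in the open unit interval.  Let \<open>F\<close> be the group of compactly supported homeomorphisms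
of the line of the kind considered here and \<open>D = [F, F]\<close>.  If \<open>k \<in> D\<close>, then \<open>k\<close> is a product of two
commutators: a support can be displaced infinitely often, which allows to trade many commutators
for two (\<open>derived_of_displaced\<close>).  Moreover \<open>D\<close> has index at most two in \<open>F\<close>
(\<open>compact_PL_index_le_two\<close>), so that besides \<open>D\<close> only one coset remains, and one fixed
element of it, if it meets \<open>T'\<close> at all, carries a fixed number of local commutators.

The index is found inside the group \<open>B\<close> of homeomorphisms that are the identity near \<open>-\<infinity>\<close> and affine
near \<open>+\<infinity>\<close>.  Let \<open>M \<subseteq> B\<close> consist of those that are translations near \<open>+\<infinity>\<close>, and let \<open>t \<in> B\<close> have slope
\<open>\<tau>\<close> on the positive half line.  As \<open>\<tau>\<^sup>2 + \<tau> - 1 = 0\<close>, the element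
\<open>E m = (t\<^sup>2 m t\<^sup>-\<^sup>2) (t m t\<^sup>-\<^sup>1) m\<^sup>-\<^sup>1\<close> is in \<open>F\<close> for \<open>m \<in> M\<close>.  Modulo \<open>[M, M]\<close> the map \<open>E\<close> is a homomorphism
that is invariant under conjugation by \<open>t\<close> and is the identity on \<open>F\<close>.  Since \<open>B\<close> is generated by the
conjugates of \<open>t\<close> under \<open>M\<close>, \<open>E\<close> is trivial, whence \<open>F \<subseteq> [M, M]\<close>.  Modulo \<open>D\<close>, the commutator of two
elements of \<open>M\<close> is an alternating bilinear form \<open>\<omega>\<close> of their translation lengths in \<open>\<int>[\<tau>] = \<int> + \<int>\<tau>\<close>, and it
is invariant under multiplication by \<open>\<tau>\<close>.  So
\<open>\<omega>(1, \<tau>) = \<omega>(\<tau>, \<tau>\<^sup>2) = \<omega>(\<tau>, 1 - \<tau>) = - \<omega>(1, \<tau>)\<close>, and \<open>[M, M]\<close> has at most two elements modulo \<open>D\<close>.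

All constructions rest on one flexibility statement, \<open>PL_interpolate\<close>: any two intervals with end
points in \<open>\<int>[\<tau>]\<close> correspond under a homeomorphism of this kind.  Positive elements of \<open>\<int>[\<tau>]\<close> are sums of
powers of \<open>\<tau>\<close>, and \<open>1 = \<tau> + \<tau>\<^sup>2\<close> allows to adjust the number of summands.\<close>

section \<open>Commutators in abstract groups\<close>

abbreviation comm :: "('a, 'b) monoid_scheme \<Rightarrow> 'a \<Rightarrow> 'a \<Rightarrow> 'a"
  where "comm G x y \<equiv> x \<otimes>\<^bsub>G\<^esub> y \<otimes>\<^bsub>G\<^esub> inv\<^bsub>G\<^esub> x \<otimes>\<^bsub>G\<^esub> inv\<^bsub>G\<^esub> y"

context group
begin

lemma cancel_inv_left: "x \<in> carrier G \<Longrightarrow> y \<in> carrier G \<Longrightarrow> inv x \<otimes> (x \<otimes> y) = y"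
  by (simp add: m_assoc[symmetric])

lemma cancel_left_inv: "x \<in> carrier G \<Longrightarrow> y \<in> carrier G \<Longrightarrow> x \<otimes> (inv x \<otimes> y) = y"
  by (simp add: m_assoc[symmetric])

text \<open>Rewriting with these equations decides the word problem in free groups.\<close>

lemmas word_simps = m_assoc inv_mult_group cancel_inv_left cancel_left_inv

lemma commute_inv:
  assumes "x \<in> carrier G" "y \<in> carrier G" "x \<otimes> y = y \<otimes> x"
  shows "inv x \<otimes> y = y \<otimes> inv x"
proof -
  have "inv x \<otimes> y = inv x \<otimes> (y \<otimes> x) \<otimes> inv x" using assms(1,2) by (simp add: word_simps)
  also have "\<dots> = y \<otimes> inv x" using assms(1,2) by (simp add: word_simps flip: assms(3))
  finally show ?thesis .
qed

lemma commute_left: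
  assumes "x \<in> carrier G" "y \<in> carrier G" "z \<in> carrier G" "x \<otimes> y = y \<otimes> x"
  shows "x \<otimes> (y \<otimes> z) = y \<otimes> (x \<otimes> z)"
  using assms by (metis m_assoc)

lemma comm_mult_commuting:
  assumes car: "a \<in> carrier G" "b \<in> carrier G" "u \<in> carrier G" "v \<in> carrier G"
    and c: "u \<otimes> a = a \<otimes> u" "u \<otimes> b = b \<otimes> u" "v \<otimes> a = a \<otimes> v" "v \<otimes> b = b \<otimes> v"
  shows "comm G (a \<otimes> u) (b \<otimes> v) = comm G a b \<otimes> comm G u v"
proof -
  have c2: "u \<otimes> inv a = inv a \<otimes> u" "u \<otimes> inv b = inv b \<otimes> u"
    "v \<otimes> inv a = inv a \<otimes> v" "v \<otimes> inv b = inv b \<otimes> v"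
    using c car commute_inv by metis+
  have c3: "inv u \<otimes> b = b \<otimes> inv u" "inv u \<otimes> inv a = inv a \<otimes> inv u"
    "inv u \<otimes> inv b = inv b \<otimes> inv u" "inv v \<otimes> inv b = inv b \<otimes> inv v"
    "inv v \<otimes> inv a = inv a \<otimes> inv v"
    by (rule commute_inv; use c c2 car in simp)+
  show ?thesis
    using car by (simp add: word_simps c c2 c3 commute_left[OF _ _ _ c(1)] commute_left[OF _ _ _ c(2)]
        commute_left[OF _ _ _ c(3)] commute_left[OF _ _ _ c(4)]
        commute_left[OF _ _ _ c2(1)] commute_left[OF _ _ _ c2(2)]
        commute_left[OF _ _ _ c2(3)] commute_left[OF _ _ _ c2(4)]
        commute_left[OF _ _ _ c3(1)] commute_left[OF _ _ _ c3(2)] commute_left[OF _ _ _ c3(3)]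
        commute_left[OF _ _ _ c3(4)] commute_left[OF _ _ _ c3(5)])
qed

text \<open>The inverse of a commutator is a commutator, so the derived subgroup consists of products of
commutators and admits induction on the number of factors.\<close>

lemma derived_induct [consumes 1, case_names subset one mult]:
  assumes "x \<in> derived G H" and H: "H \<subseteq> carrier G"
    and one: "P \<one>"
    and mult: "\<And>a b y. a \<in> H \<Longrightarrow> b \<in> H \<Longrightarrow> y \<in> derived G H \<Longrightarrow> P y \<Longrightarrow> P (comm G a b \<otimes> y)"
  shows "P x"
proof -
  have D: "subgroup (derived G H) G" using derived_is_subgroup[OF H] .
  have car: "z \<in> carrier G" if "z \<in> derived G H" for z
    using D that subgroup.mem_carrier by metis
  have "\<forall>y \<in> derived G H. P y \<longrightarrow> P (x \<otimes> y)"
    using assms(1) unfolding derived_def[of G H]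
  proof (induction x rule: generate.induct)
    case one
    then show ?case using car unfolding derived_def by auto
  next
    case (incl h)
    then show ?case using mult unfolding derived_def by auto
  next
    case (inv h)
    then obtain a b where ab: "a \<in> H" "b \<in> H" "h = comm G a b" by auto
    then have "inv h = comm G b a" using H by (auto simp: word_simps subset_iff)
    then show ?case using mult ab unfolding derived_def by auto
  next
    case (eng h1 h2)
    show ?case
    proof (intro ballI impI)
      fix y assume y: "y \<in> generate G (derived_set G H)" "P y"
      have "h2 \<otimes> y \<in> generate G (derived_set G H)" using eng y by (auto intro: generate.eng)
      then have "P (h1 \<otimes> (h2 \<otimes> y))" using eng y by blast
      then show "P (h1 \<otimes> h2 \<otimes> y)"
        using eng y car unfolding derived_def by (simp add: m_assoc)
    qed
  qed
  moreover have "\<one> \<in> derived G H" using D by (simp add: subgroup.one_closed)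
  ultimately have "P (x \<otimes> \<one>)" using one by blast
  then show ?thesis using car[OF assms(1)] by simp
qed

text \<open>Let \<open>x = c\<^sub>1 \<cdots> c\<^sub>k\<close> with \<open>c\<^sub>i = [a\<^sub>i, b\<^sub>i]\<close> and let \<open>s\<close> be conjugation by \<open>h\<close>.  The elements \<open>s\<^sup>i z\<close> with
\<open>z \<in> H\<close> behave like coordinates that commute with each other.  With \<open>f = \<Prod> s\<^sup>i (c\<^sub>i\<^sub>+\<^sub>1 \<cdots> c\<^sub>k)\<close> the
commutator \<open>[f, h] = f (s f)\<^sup>-\<^sup>1\<close> telescopes to \<open>x\<close> in coordinate \<open>0\<close> and to the single commutators
\<open>c\<^sub>i\<^sup>-\<^sup>1\<close> in the others, and the latter are cancelled all at once by one commutator of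
\<open>\<Prod> s\<^sup>i a\<^sub>i\<close> and \<open>\<Prod> s\<^sup>i b\<^sub>i\<close>.  The induction below builds these products from the right.\<close>

lemma derived_of_displaced:
  assumes N: "subgroup N G" "H \<subseteq> N" "h \<in> N"
    and disp: "\<And>n a b. a \<in> H \<Longrightarrow> b \<in> H \<Longrightarrow>
       a \<otimes> ((\<lambda>z. h \<otimes> z \<otimes> inv h) ^^ Suc n) b = ((\<lambda>z. h \<otimes> z \<otimes> inv h) ^^ Suc n) b \<otimes> a"
    and x: "x \<in> derived G H"
  obtains f a b where "f \<in> N" "a \<in> N" "b \<in> N" "x = comm G f h \<otimes> comm G a b"
proof -
  define s where "s = (\<lambda>z. h \<otimes> z \<otimes> inv h)"
  \<comment> \<open>elements without coordinate \<open>0\<close>: they and their images under powers of \<open>s\<close> commute with \<open>H\<close>\<close>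
  define Z where "Z = {z \<in> N. \<forall>n. \<forall>a\<in>H. a \<otimes> (s ^^ n) z = (s ^^ n) z \<otimes> a}"
  note mem = subgroup.mem_carrier[OF N(1)]
  have HN: "z \<in> N" if "z \<in> H" for z using N(2) that by blast
  have clo: "x \<otimes> y \<in> N" "inv x \<in> N" if "x \<in> N" "y \<in> N" for x y
    using that subgroup.m_closed[OF N(1)] subgroup.m_inv_closed[OF N(1)] by auto
  have sN: "s z \<in> N" if "z \<in> N" for z unfolding s_def using that N(3) clo by simp
  have snN: "(s ^^ n) z \<in> N" if "z \<in> N" for z n using that by (induction n) (auto intro: sN)
  have smult: "s (x \<otimes> y) = s x \<otimes> s y" if "x \<in> N" "y \<in> N" for x y
    using that mem N(3) by (simp add: s_def word_simps)
  have snmult: "(s ^^ n) (x \<otimes> y) = (s ^^ n) x \<otimes> (s ^^ n) y" if "x \<in> N" "y \<in> N" for x y n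
    using that by (induction n) (auto simp: smult snN)
  have Zmult: "x \<otimes> y \<in> Z" if "x \<in> Z" "y \<in> Z" for x y
  proof -
    have "a \<otimes> (s ^^ n) (x \<otimes> y) = (s ^^ n) (x \<otimes> y) \<otimes> a" if "a \<in> H" for a n
    proof -
      have m: "a \<in> carrier G" "(s ^^ n) x \<in> carrier G" "(s ^^ n) y \<in> carrier G"
        using mem HN that \<open>x \<in> Z\<close> \<open>y \<in> Z\<close> snN unfolding Z_def by auto
      have c: "a \<otimes> (s ^^ n) x = (s ^^ n) x \<otimes> a" "a \<otimes> (s ^^ n) y = (s ^^ n) y \<otimes> a"
        using that \<open>x \<in> Z\<close> \<open>y \<in> Z\<close> unfolding Z_def by auto
      have "a \<otimes> ((s ^^ n) x \<otimes> (s ^^ n) y) = (s ^^ n) x \<otimes> (s ^^ n) y \<otimes> a"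
        using m c by (metis m_assoc)
      then show ?thesis using snmult that \<open>x \<in> Z\<close> \<open>y \<in> Z\<close> unfolding Z_def by simp
    qed
    then show ?thesis using that clo unfolding Z_def by auto
  qed
  have Zs: "s x \<in> Z" if "x \<in> Z" for x
  proof -
    have "a \<otimes> (s ^^ Suc n) x = (s ^^ Suc n) x \<otimes> a" if "a \<in> H" for a n
      using \<open>x \<in> Z\<close> that unfolding Z_def by blast
    then show ?thesis using \<open>x \<in> Z\<close> sN unfolding Z_def funpow_Suc_right by auto
  qed
  have sHZ: "s x \<in> Z" if "x \<in> H" for x
    using disp[OF _ that, folded s_def] that HN sN unfolding Z_def funpow_Suc_right by auto
  have "\<exists>f\<in>N. \<exists>a\<in>Z. \<exists>b\<in>Z. x = comm G f h \<otimes> comm G a b"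
    using x
  proof (induction x rule: derived_induct)
    case subset
    then show ?case using HN mem by auto
  next
    case one
    have "(s ^^ n) \<one> = \<one>" for n by (induction n) (use N mem in \<open>auto simp: s_def\<close>)
    then have "\<one> \<in> Z" using HN mem N(1) by (auto simp: Z_def subgroup.one_closed)
    moreover have "\<one> \<in> N" using N(1) by (simp add: subgroup.one_closed)
    ultimately show ?case using N(3) mem by (intro bexI[of _ \<one>]) auto
  next
    case (mult a b y)
    then obtain f u v where fuv: "f \<in> N" "u \<in> Z" "v \<in> Z" "y = comm G f h \<otimes> comm G u v" by blast
    have uvN: "u \<in> N" "v \<in> N" using fuv Z_def by auto
    have ab: "a \<in> N" "b \<in> N" using mult HN by auto
    have yN: "y \<in> N" using fuv uvN N(3) clo by simp
    have comZ: "z \<otimes> a = a \<otimes> z" if "z \<in> Z" "a \<in> H" for z a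
      using that unfolding Z_def by (metis (mono_tags, lifting) funpow_0 mem_Collect_eq)
    have ycom: "z \<otimes> y = y \<otimes> z" if z: "z \<in> Z" for z
      using \<open>y \<in> derived G H\<close>
    proof (induction y rule: derived_induct)
      case subset
      then show ?case using HN mem by auto
    next
      case one then show ?case using z mem unfolding Z_def by auto
    next
      case (mult a b w)
      have car: "a \<in> carrier G" "b \<in> carrier G" "z \<in> carrier G" "w \<in> carrier G"
        using mult z mem HN Z_def derived_in_carrier[of H] by auto
      have c: "z \<otimes> a = a \<otimes> z" "z \<otimes> b = b \<otimes> z" using comZ mult z by auto
      have ci: "z \<otimes> inv a = inv a \<otimes> z" "z \<otimes> inv b = inv b \<otimes> z"
        using c car commute_inv by metis+
      show ?case
        using car by (simp add: word_simps c ci mult.IH commute_left[OF _ _ _ c(1)]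
            commute_left[OF _ _ _ c(2)] commute_left[OF _ _ _ ci(1)] commute_left[OF _ _ _ ci(2)])
    qed
    define x where "x = comm G a b \<otimes> y"
    define C where "C = comm G u v"
    define c where "c = comm G a b"
    have CN: "C \<in> N" "c \<in> N" "x \<in> N" using uvN ab clo yN unfolding C_def c_def x_def by auto
    have car: "C \<in> carrier G" "c \<in> carrier G" "x \<in> carrier G" "y \<in> carrier G" "h \<in> carrier G"
       "f \<in> carrier G" "a \<in> carrier G" "b \<in> carrier G" "u \<in> carrier G" "v \<in> carrier G"
      using CN yN N(3) ab uvN fuv mem by auto
    have Cy: "C \<otimes> y = y \<otimes> C"
    proof -
      have q: "u \<otimes> y = y \<otimes> u" "v \<otimes> y = y \<otimes> v" using ycom fuv by auto
      have qi: "inv u \<otimes> y = y \<otimes> inv u" "inv v \<otimes> y = y \<otimes> inv v"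
        using q car commute_inv by metis+
      show ?thesis unfolding C_def using car
        by (simp add: word_simps q qi commute_left[OF _ _ _ q(1)] commute_left[OF _ _ _ q(2)]
            commute_left[OF _ _ _ qi(1)] commute_left[OF _ _ _ qi(2)])
    qed
    have fh: "comm G f h = y \<otimes> inv C"
      using fuv(4) car unfolding C_def by (simp add: word_simps)
    have "comm G (x \<otimes> s f) h = x \<otimes> h \<otimes> comm G f h \<otimes> inv x \<otimes> inv h"
      unfolding s_def using car by (simp add: word_simps)
    also have "\<dots> = x \<otimes> h \<otimes> (y \<otimes> inv C \<otimes> inv y) \<otimes> inv c \<otimes> inv h"
      unfolding fh using car by (simp add: x_def c_def word_simps)
    also have "y \<otimes> inv C \<otimes> inv y = inv C"
      using commute_inv[OF car(1) car(4) Cy] car by (metis inv_closed inv_solve_right m_closed)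
    finally have 1: "comm G (x \<otimes> s f) h = x \<otimes> h \<otimes> inv C \<otimes> inv c \<otimes> inv h" .
    have "comm G (s (a \<otimes> u)) (s (b \<otimes> v)) = h \<otimes> comm G (a \<otimes> u) (b \<otimes> v) \<otimes> inv h"
      unfolding s_def using car by (simp add: word_simps)
    also have "comm G (a \<otimes> u) (b \<otimes> v) = c \<otimes> C"
      unfolding c_def C_def
      by (rule comm_mult_commuting) (use car comZ mult fuv in auto)
    finally have 2: "comm G (s (a \<otimes> u)) (s (b \<otimes> v)) = h \<otimes> (c \<otimes> C) \<otimes> inv h" .
    have "x = comm G (x \<otimes> s f) h \<otimes> comm G (s (a \<otimes> u)) (s (b \<otimes> v))"
      unfolding 1 2 using car by (simp add: word_simps)
    moreover have "s (a \<otimes> u) \<in> Z" "s (b \<otimes> v) \<in> Z"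
      using Zmult sHZ Zs mult(1,2) fuv(2,3) smult ab uvN by auto
    moreover have "x \<otimes> s f \<in> N" using CN fuv sN clo by auto
    ultimately show ?case unfolding x_def by blast
  qed
  then show thesis using that unfolding Z_def by blast
qed

end

section \<open>A subgroup with at most two classes modulo commutators\<close>

context group begin

lemma quotient_map_eq_iff:
  assumes "N \<lhd> G" "x \<in> carrier G" "y \<in> carrier G"
  shows "N #> x = N #> y \<longleftrightarrow> x \<otimes> inv y \<in> N"
proof -
  interpret normal N G by fact
  have "N #> x = N #> y \<longleftrightarrow> x \<in> N #> y"
    using assms repr_independence[OF _ _ is_subgroup] rcos_self[OF _ is_subgroup] by metis
  also have "\<dots> \<longleftrightarrow> x \<otimes> inv y \<in> N"
    using rcos_module[OF is_group assms(3,2)] .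
  finally show ?thesis .
qed

text \<open>The codomain is kept abstract: calculations then use the homomorphism laws only and never
meet products of cosets.\<close>

lemma quotient_hom:
  assumes "N \<lhd> G"
  obtains Q :: "'a set monoid" and \<kappa> where "group_hom G Q \<kappa>" "\<kappa> ` carrier G = carrier Q"
    "\<And>x y. x \<in> carrier G \<Longrightarrow> y \<in> carrier G \<Longrightarrow> \<kappa> x = \<kappa> y \<longleftrightarrow> x \<otimes> inv y \<in> N"
proof
  show "group_hom G (G Mod N) (\<lambda>x. N #> x)"
    unfolding group_hom_def group_hom_axioms_def
    using assms normal.factorgroup_is_group normal.r_coset_hom_Mod is_group by blast
  show "(\<lambda>x. N #> x) ` carrier G = carrier (G Mod N)"
    unfolding FactGroup_def RCOSETS_def by auto
qed (rule quotient_map_eq_iff[OF assms])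

text \<open>For \<open>m \<in> M\<close> put \<open>S m = t m t\<^sup>-\<^sup>1\<close> and \<open>e m = S (S m) (S m) m\<^sup>-\<^sup>1\<close>.  As \<open>M\<close> is abelian, \<open>e\<close> is a homomorphism into
the central subgroup \<open>F\<close>; so \<open>e (S m) = S (e m) = e m\<close>, and \<open>e f = f\<close> for \<open>f \<in> F\<close>.  The elements
\<open>m t\<^sup>k\<close> with \<open>e m = 1\<close> therefore form a subgroup.  It contains \<open>c t c\<^sup>-\<^sup>1 = (c (S c)\<^sup>-\<^sup>1) t\<close>, hence everything,
and so \<open>f = e f = 1\<close>.\<close>

lemma central_trivial:
  assumes F: "F \<subseteq> M" and M: "M \<lhd> G" and t: "t \<in> carrier G"
    and cen: "\<And>f b. f \<in> F \<Longrightarrow> b \<in> carrier G \<Longrightarrow> b \<otimes> f = f \<otimes> b"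
    and ab: "\<And>m n. m \<in> M \<Longrightarrow> n \<in> M \<Longrightarrow> m \<otimes> n = n \<otimes> m"
    and E: "\<And>m. m \<in> M \<Longrightarrow> t \<otimes> (t \<otimes> m \<otimes> inv t) \<otimes> inv t \<otimes> (t \<otimes> m \<otimes> inv t) \<otimes> inv m \<in> F"
    and gen: "carrier G \<subseteq> generate G ((\<lambda>c. c \<otimes> t \<otimes> inv c) ` M)"
    and tk: "\<And>k::int. t [^] k \<in> M \<Longrightarrow> k = 0"
    and f: "f \<in> F"
  shows "f = \<one>"
proof -
  interpret M: normal M G by fact
  have Mc: "m \<in> carrier G" if "m \<in> M" for m using that M.subset by blast
  define S where "S m = t \<otimes> m \<otimes> inv t" for m
  define e where "e m = S (S m) \<otimes> S m \<otimes> inv m" for m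
  have SM: "S m \<in> M" if "m \<in> M" for m using that t M.inv_op_closed2 unfolding S_def by blast
  have eF: "e m \<in> F" if "m \<in> M" for m using E[OF that] unfolding e_def S_def .
  have Smult: "S (m \<otimes> n) = S m \<otimes> S n" if "m \<in> M" "n \<in> M" for m n
    using that Mc t unfolding S_def by (simp add: word_simps)
  have lc: "x \<otimes> (y \<otimes> z) = y \<otimes> (x \<otimes> z)" if "x \<in> M" "y \<in> M" "z \<in> M" for x y z
    using that ab Mc by (metis m_assoc)
  have emult: "e (m \<otimes> n) = e m \<otimes> e n" if mn: "m \<in> M" "n \<in> M" for m n
  proof -
    have "e (m \<otimes> n) = S (S m) \<otimes> S (S n) \<otimes> (S m \<otimes> S n) \<otimes> (inv n \<otimes> inv m)"
      unfolding e_def using mn SM Mc by (simp add: Smult inv_mult_group)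
    also have "\<dots> = e m \<otimes> e n"
      unfolding e_def using mn SM Mc by (simp add: m_assoc ab lc)
    finally show ?thesis .
  qed
  have eS: "e (S m) = e m" if "m \<in> M" for m
  proof -
    have "e (S m) = t \<otimes> e m \<otimes> inv t"
      unfolding e_def S_def using that Mc t by (simp add: word_simps)
    also have "\<dots> = e m \<otimes> t \<otimes> inv t" using cen[OF eF[OF that] t] by simp
    also have "\<dots> = e m" using that t Mc SM unfolding e_def by (simp add: m_assoc)
    finally show ?thesis .
  qed
  have einv: "e (inv m) = inv (e m)" if "m \<in> M" for m
  proof -
    have "e (inv m) \<otimes> e m = e \<one>" using emult[of "inv m" m] that Mc by simp
    also have "e \<one> = \<one>" using t by (simp add: e_def S_def)
    finally show ?thesis using that Mc SM F eF by (metis M.m_inv_closed inv_equality subsetD)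
  qed
  define conj where "conj x m = x \<otimes> m \<otimes> inv x" for x m
  have conjM: "conj x m \<in> M" if "x \<in> carrier G" "m \<in> M" for x m
    using that M.inv_op_closed2 unfolding conj_def by blast
  have econj: "e (conj (t [^] (k::int)) m) = e m" if "m \<in> M" for k m
  proof (cases k rule: int_cases2)
    have nat: "e (conj (t [^] (n::nat)) m) = e m" if "m \<in> M" for n m
      using that
    proof (induction n arbitrary: m)
      case (Suc n)
      have "conj (t [^] Suc n) m = conj (t [^] n) (S m)"
        unfolding conj_def S_def using Suc Mc t by (simp add: word_simps)
      then show ?case using Suc.IH[of "S m"] Suc.prems SM eS by simp
    qed (use Mc in \<open>simp add: conj_def\<close>)
    {
      case (nonneg n)
      then show ?thesis using nat[OF that, of n] by (simp add: int_pow_int)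
    next
      case (nonpos n)
      define m' where "m' = conj (t [^] k) m"
      have "conj (t [^] n) m' = m"
        unfolding m'_def conj_def nonpos using Mc that t by (simp add: int_pow_neg int_pow_int word_simps)
      then show ?thesis using nat[of m' n] conjM[of "t [^] k" m] that t unfolding m'_def by simp
    }
  qed
  define P where "P = {b \<in> carrier G. \<exists>(k::int). \<exists>m\<in>M. b = m \<otimes> t [^] k \<and> e m = \<one>}"
  have "subgroup P G"
  proof (rule subgroupI)
    show "P \<subseteq> carrier G" unfolding P_def by blast
    have "\<one> \<in> P" unfolding P_def using t M.one_closed
      by (auto intro!: exI[of _ "0::int"] bexI[of _ \<one>] simp: e_def S_def)
    then show "P \<noteq> {}" by blast
  next
    fix a assume "a \<in> P"
    then obtain k :: int and m where m: "m \<in> M" "a = m \<otimes> t [^] k" "e m = \<one>" unfolding P_def by blast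
    define n where "n = conj (t [^] (-k)) (inv m)"
    have "inv a = n \<otimes> t [^] (-k)"
      unfolding n_def conj_def m using m Mc t by (simp add: word_simps int_pow_neg)
    moreover have "n \<in> M" unfolding n_def using m conjM t M.m_inv_closed by simp
    moreover have "e n = \<one>" unfolding n_def using econj[of "inv m"] m einv M.m_inv_closed by simp
    ultimately show "inv a \<in> P" unfolding P_def using Mc t by auto
  next
    fix a b assume "a \<in> P" "b \<in> P"
    then obtain k l :: int and m n where m: "m \<in> M" "a = m \<otimes> t [^] k" "e m = \<one>"
      and n: "n \<in> M" "b = n \<otimes> t [^] l" "e n = \<one>" unfolding P_def by blast
    have "a \<otimes> b = (m \<otimes> conj (t [^] k) n) \<otimes> t [^] (k + l)"
      unfolding conj_def m(2) n(2) using m n Mc t by (simp add: word_simps int_pow_mult)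
    moreover have "m \<otimes> conj (t [^] k) n \<in> M" using m n conjM t by simp
    moreover have "e (m \<otimes> conj (t [^] k) n) = \<one>"
      using emult[of m "conj (t [^] k) n"] m n conjM t econj by simp
    ultimately show "a \<otimes> b \<in> P" unfolding P_def using Mc t by auto
  qed
  moreover have "(\<lambda>c. c \<otimes> t \<otimes> inv c) ` M \<subseteq> P"
  proof clarify
    fix c assume c: "c \<in> M"
    have "c \<otimes> t \<otimes> inv c = (c \<otimes> S (inv c)) \<otimes> t [^] (1::int)"
      unfolding S_def using c Mc t by (simp add: word_simps)
    moreover have "e (c \<otimes> S (inv c)) = \<one>"
      using c Mc SM emult[of c "S (inv c)"] einv[of c] eS[of "inv c"] F eF[of c] by (metis M.m_inv_closed r_inv subsetD)
    moreover have "c \<otimes> S (inv c) \<in> M" using c SM by simp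
    moreover have "c \<otimes> t \<otimes> inv c \<in> carrier G" using c Mc t by simp
    ultimately show "c \<otimes> t \<otimes> inv c \<in> P" unfolding P_def by blast
  qed
  ultimately have "carrier G \<subseteq> P" using gen generate_subgroup_incl by blast
  moreover have fM: "f \<in> M" using f F by blast
  ultimately obtain k :: int and m where m: "m \<in> M" "f = m \<otimes> t [^] k" "e m = \<one>"
    using Mc unfolding P_def by blast
  have "t [^] k = inv m \<otimes> f" using m Mc t by (simp add: word_simps)
  then have "t [^] k \<in> M" using m(1) fM M.m_closed M.m_inv_closed by metis
  then have "k = 0" using tk by blast
  then have "f = m" using m Mc by simp
  then have "e f = \<one>" using m by simp
  moreover have Sf: "S f = f" unfolding S_def using cen[OF f t] t Mc fM by (simp add: m_assoc)
  ultimately show "f = \<one>" unfolding e_def Sf using Mc[OF fM] by (simp add: m_assoc)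
qed

text \<open>Centrality of \<open>F\<close> makes the commutator \<open>w = [p, q]\<close> insensitive to factors from \<open>F\<close>.  Conjugation by \<open>t\<close>
fixes \<open>w\<close> and carries it to \<open>[q, p q\<^sup>-\<^sup>1] = w\<^sup>-\<^sup>1\<close>, hence \<open>w\<^sup>2 = 1\<close>.  For fixed \<open>y\<close> the elements \<open>x\<close> with
\<open>[x, y] \<in> {1, w}\<close> form a subgroup, so it is enough to look at the generators of \<open>M\<close>.\<close>

lemma commutators_order_two:
  assumes F: "F \<subseteq> carrier G" and pq: "p \<in> carrier G" "q \<in> carrier G" and t: "t \<in> carrier G"
    and cen: "\<And>f b. f \<in> F \<Longrightarrow> b \<in> carrier G \<Longrightarrow> b \<otimes> f = f \<otimes> b"
    and w: "comm G p q \<in> F"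
    and gen: "M \<subseteq> generate G (F \<union> {p, q})"
    and tp: "f1 \<in> F" "t \<otimes> p \<otimes> inv t = q \<otimes> f1"
    and tq: "f2 \<in> F" "t \<otimes> q \<otimes> inv t = p \<otimes> inv q \<otimes> f2"
  shows "comm G p q \<otimes> comm G p q = \<one>"
    and "m \<in> M \<Longrightarrow> n \<in> M \<Longrightarrow> comm G m n \<in> {\<one>, comm G p q}"
proof -
  define w where "w = comm G p q"
  have wc: "w \<in> carrier G" unfolding w_def using pq by simp
  have wcen: "b \<otimes> w = w \<otimes> b" if "b \<in> carrier G" for b using cen w that unfolding w_def by blast
  have f12: "f1 \<in> carrier G" "f2 \<in> carrier G" using tp tq F by auto
  have "w = t \<otimes> w \<otimes> inv t" using wcen[OF t] t wc by (simp add: m_assoc)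
  also have "\<dots> = comm G (t \<otimes> p \<otimes> inv t) (t \<otimes> q \<otimes> inv t)"
    unfolding w_def using pq t by (simp add: word_simps)
  also have "\<dots> = comm G (q \<otimes> f1) (p \<otimes> inv q \<otimes> f2)" unfolding tp tq ..
  also have "\<dots> = comm G q (p \<otimes> inv q) \<otimes> comm G f1 f2"
    by (rule comm_mult_commuting) (use pq f12 cen tp tq in auto)
  also have "comm G f1 f2 = \<one>" using f12
    by (simp add: cen[OF tp(1) f12(2), symmetric] word_simps)
  also have "comm G q (p \<otimes> inv q) \<otimes> \<one> = inv w"
    unfolding w_def using pq by (simp add: word_simps)
  finally have "w \<otimes> w = inv w \<otimes> w" by simp
  then show ww: "comm G p q \<otimes> comm G p q = \<one>" using wc unfolding w_def[symmetric] by simp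
  have winv: "inv w = w" using ww wc unfolding w_def[symmetric] by (metis inv_equality)
  define C where "C = {\<one>, w}"
  have Cmult: "x \<otimes> y \<in> C" if "x \<in> C" "y \<in> C" for x y
    using that ww wc unfolding C_def w_def[symmetric] by auto
  have Cinv: "inv x \<in> C" if "x \<in> C" for x using that winv unfolding C_def by auto
  have Cc: "x \<in> carrier G" if "x \<in> C" for x using that wc unfolding C_def by auto
  have Ccen: "b \<otimes> x = x \<otimes> b" if "x \<in> C" "b \<in> carrier G" for x b
    using that wcen unfolding C_def by auto
  have swap: "comm G y x \<in> C" if "comm G x y \<in> C" "x \<in> carrier G" "y \<in> carrier G" for x y
  proof -
    have "comm G y x = inv (comm G x y)" using that by (simp add: word_simps)
    then show ?thesis using Cinv that by simp
  qed
  have sub: "subgroup {x \<in> carrier G. comm G x y \<in> C} G" if y: "y \<in> carrier G" for y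
  proof (rule subgroupI)
    show "{x \<in> carrier G. comm G x y \<in> C} \<noteq> {}"
      using y by (auto simp: C_def intro!: exI[of _ \<one>])
  next
    fix a assume a: "a \<in> {x \<in> carrier G. comm G x y \<in> C}"
    have "comm G (inv a) y = inv a \<otimes> inv (comm G a y) \<otimes> a" using a y by (simp add: word_simps)
    also have "\<dots> = inv (comm G a y) \<otimes> inv a \<otimes> a"
      using Ccen[of "inv (comm G a y)" "inv a"] Cinv a by auto
    also have "\<dots> = inv (comm G a y)" using a y by (simp add: word_simps)
    finally show "inv a \<in> {x \<in> carrier G. comm G x y \<in> C}" using a Cinv by auto
  next
    fix a b assume a: "a \<in> {x \<in> carrier G. comm G x y \<in> C}" and b: "b \<in> {x \<in> carrier G. comm G x y \<in> C}"
    have "comm G (a \<otimes> b) y = a \<otimes> comm G b y \<otimes> inv a \<otimes> comm G a y"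
      using a b y by (simp add: word_simps)
    also have "\<dots> = comm G b y \<otimes> a \<otimes> inv a \<otimes> comm G a y"
      using Ccen[of "comm G b y" a] a b by auto
    also have "\<dots> = comm G b y \<otimes> comm G a y" using a b y by (simp add: word_simps)
    finally show "a \<otimes> b \<in> {x \<in> carrier G. comm G x y \<in> C}" using a b Cmult by auto
  qed auto
  have FC: "comm G f y \<in> C" if "f \<in> F" "y \<in> carrier G" for f y
    using cen[OF that] F that by (auto simp: C_def m_assoc subsetD simp flip: cen[OF that])
  have self: "comm G y y \<in> C" if "y \<in> carrier G" for y using that by (simp add: C_def word_simps)
  have gens: "M \<subseteq> {x \<in> carrier G. comm G x y \<in> C}"
    if "y \<in> carrier G" "comm G p y \<in> C" "comm G q y \<in> C" for y
  proof -
    have "F \<union> {p, q} \<subseteq> {x \<in> carrier G. comm G x y \<in> C}"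
      using that pq F FC by auto
    then show ?thesis using gen generate_subgroup_incl[OF _ sub[OF that(1)]] by blast
  qed
  have wC: "comm G p q \<in> C" by (simp add: C_def w_def)
  have "comm G m p \<in> C \<and> comm G m q \<in> C \<and> m \<in> carrier G" if "m \<in> M" for m
    using gens[of p] gens[of q] self swap wC pq that by blast
  then have "comm G m n \<in> C" if "m \<in> M" "n \<in> M" for m n
    using gens[of n] swap that pq by blast
  then show "m \<in> M \<Longrightarrow> n \<in> M \<Longrightarrow> comm G m n \<in> {\<one>, comm G p q}"
    unfolding C_def w_def by blast
qed

text \<open>The first of the two preceding lemmas, applied modulo \<open>[M, M]\<close>, gives \<open>F \<subseteq> [M, M]\<close>; the second one, applied
modulo \<open>[F, F]\<close>, shows that \<open>[M, M]\<close> has at most two elements modulo \<open>[F, F]\<close>.\<close>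

lemma derived_index_le_two:
  assumes F: "F \<lhd> G" and M: "M \<lhd> G" and FM: "F \<subseteq> M" and t: "t \<in> carrier G"
    and cen: "\<And>f b. f \<in> F \<Longrightarrow> b \<in> carrier G \<Longrightarrow> comm G b f \<in> derived G F"
    and ab: "\<And>m n. m \<in> M \<Longrightarrow> n \<in> M \<Longrightarrow> comm G m n \<in> F"
    and E: "\<And>m. m \<in> M \<Longrightarrow> t \<otimes> (t \<otimes> m \<otimes> inv t) \<otimes> inv t \<otimes> (t \<otimes> m \<otimes> inv t) \<otimes> inv m \<in> F"
    and gen: "carrier G \<subseteq> generate G ((\<lambda>c. c \<otimes> t \<otimes> inv c) ` M)"
    and tk: "\<And>k::int. t [^] k \<in> M \<Longrightarrow> k = 0"
    and pq: "p \<in> M" "q \<in> M" "M \<subseteq> generate G (F \<union> {p, q})"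
    and tp: "inv q \<otimes> (t \<otimes> p \<otimes> inv t) \<in> F"
    and tq: "inv (p \<otimes> inv q) \<otimes> (t \<otimes> q \<otimes> inv t) \<in> F"
    and x: "x \<in> F" "x \<notin> derived G F" and y: "y \<in> F" "y \<notin> derived G F"
  shows "x \<otimes> inv y \<in> derived G F"
proof -
  interpret F: normal F G by fact
  interpret M: normal M G by fact
  have Fc: "z \<in> carrier G" if "z \<in> F" for z using that F.subset by blast
  have Mc: "z \<in> carrier G" if "z \<in> M" for z using that M.subset by blast
  have DM: "derived G F \<subseteq> derived G M" using mono_derived[OF FM] .
  have swap: "b \<otimes> f \<otimes> inv (f \<otimes> b) = comm G b f" if "b \<in> carrier G" "f \<in> carrier G" for b f
    using that by (simp add: word_simps)

  have FM': "F \<subseteq> derived G M"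
  proof
    fix f assume f: "f \<in> F"
    define N where "N = derived G M"
    have NG: "N \<lhd> G" unfolding N_def by (rule derived_is_normal[OF M])
    have NM: "N \<subseteq> M" unfolding N_def by (rule derived_incl[OF _ M.is_subgroup]) simp
    obtain Q :: "'a set monoid" and \<kappa> where h: "group_hom G Q \<kappa>"
      and onto: "\<kappa> ` carrier G = carrier Q"
      and eq: "\<And>x y. x \<in> carrier G \<Longrightarrow> y \<in> carrier G \<Longrightarrow> \<kappa> x = \<kappa> y \<longleftrightarrow> x \<otimes> inv y \<in> N"
      using quotient_hom[OF NG] by blast
    interpret h: group_hom G Q \<kappa> by fact
    have eqc: "\<kappa> (v \<otimes> u) = \<kappa> (u \<otimes> v)"
      if "comm G v u \<in> N" "u \<in> carrier G" "v \<in> carrier G" for u v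
      using that eq[of "v \<otimes> u" "u \<otimes> v"] swap[of v u] by simp
    have hom: "\<kappa> (u \<otimes> v) = (\<kappa> u) \<otimes>\<^bsub>Q\<^esub> (\<kappa> v)" if "u \<in> carrier G" "v \<in> carrier G" for u v
      using that by simp
    have "\<kappa> f = \<one>\<^bsub>Q\<^esub>"
    proof (rule group.central_trivial[OF h.H.is_group, where F = "\<kappa> ` F"
          and M = "\<kappa> ` M" and t = "\<kappa> t"])
      show "\<kappa> ` F \<subseteq> \<kappa> ` M" using FM by blast
      show "\<kappa> ` M \<lhd> Q"
      proof (rule group.normal_invI[OF h.H.is_group])
        show "subgroup (\<kappa> ` M) Q"
          using h.subgroup_img_is_subgroup[OF M.is_subgroup] .
        fix X Y assume "X \<in> carrier Q" "Y \<in> \<kappa> ` M"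
        then obtain u v where "u \<in> carrier G" "X = \<kappa> u" "v \<in> M" "Y = \<kappa> v"
          unfolding onto[symmetric] by blast
        then show "X \<otimes>\<^bsub>Q\<^esub> Y \<otimes>\<^bsub>Q\<^esub> inv\<^bsub>Q\<^esub> X \<in> \<kappa> ` M"
          using Mc M.inv_op_closed2 by (auto simp flip: h.hom_mult h.hom_inv)
      qed
      show "\<kappa> t \<in> carrier Q" using t by simp
    next
      fix X Y assume "X \<in> \<kappa> ` F" "Y \<in> carrier Q"
      then obtain u v where uv: "u \<in> F" "X = \<kappa> u" "v \<in> carrier G" "Y = \<kappa> v"
        unfolding onto[symmetric] by blast
      then have "\<kappa> (v \<otimes> u) = \<kappa> (u \<otimes> v)"
        using eqc[of v u] Fc cen[OF uv(1,3)] DM unfolding N_def by blast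
      then show "Y \<otimes>\<^bsub>Q\<^esub> X = X \<otimes>\<^bsub>Q\<^esub> Y" using uv Fc by (simp flip: h.hom_mult)
    next
      fix X Y assume "X \<in> \<kappa> ` M" "Y \<in> \<kappa> ` M"
      then obtain u v where uv: "u \<in> M" "X = \<kappa> u" "v \<in> M" "Y = \<kappa> v" by blast
      have "comm G u v \<in> N" unfolding N_def derived_def using uv by (intro generate.incl) blast
      then have "\<kappa> (u \<otimes> v) = \<kappa> (v \<otimes> u)" using eqc[of u v] uv Mc by blast
      then show "X \<otimes>\<^bsub>Q\<^esub> Y = Y \<otimes>\<^bsub>Q\<^esub> X" using uv Mc by (simp flip: h.hom_mult)
    next
      fix X assume "X \<in> \<kappa> ` M"
      then show "(\<kappa> t) \<otimes>\<^bsub>Q\<^esub> ((\<kappa> t) \<otimes>\<^bsub>Q\<^esub> X \<otimes>\<^bsub>Q\<^esub> inv\<^bsub>Q\<^esub> (\<kappa> t)) \<otimes>\<^bsub>Q\<^esub>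
         inv\<^bsub>Q\<^esub> (\<kappa> t) \<otimes>\<^bsub>Q\<^esub> ((\<kappa> t) \<otimes>\<^bsub>Q\<^esub> X \<otimes>\<^bsub>Q\<^esub> inv\<^bsub>Q\<^esub> (\<kappa> t))
         \<otimes>\<^bsub>Q\<^esub> inv\<^bsub>Q\<^esub> X \<in> \<kappa> ` F"
        using E t Mc by (auto simp flip: h.hom_mult h.hom_inv)
    next
      have "\<kappa> ` carrier G \<subseteq> \<kappa> ` generate G ((\<lambda>c. c \<otimes> t \<otimes> inv c) ` M)"
        using gen by blast
      also have "\<dots> = generate Q (\<kappa> ` (\<lambda>c. c \<otimes> t \<otimes> inv c) ` M)"
        by (rule h.generate_img[symmetric]) (use t Mc in auto)
      also have "\<kappa> ` (\<lambda>c. c \<otimes> t \<otimes> inv c) ` M =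
          (\<lambda>c. c \<otimes>\<^bsub>Q\<^esub> (\<kappa> t) \<otimes>\<^bsub>Q\<^esub> inv\<^bsub>Q\<^esub> c) ` \<kappa> ` M"
        unfolding image_image using Mc t by (intro image_cong) (auto simp flip: h.hom_mult h.hom_inv)
      finally show "carrier Q \<subseteq> generate Q ((\<lambda>c. c \<otimes>\<^bsub>Q\<^esub> \<kappa> t \<otimes>\<^bsub>Q\<^esub> inv\<^bsub>Q\<^esub> c) ` \<kappa> ` M)"
        unfolding onto .
    next
      fix k :: int
      assume "(\<kappa> t) [^]\<^bsub>Q\<^esub> k \<in> \<kappa> ` M"
      then obtain m where m: "m \<in> M" "\<kappa> (t [^] k) = \<kappa> m"
        using t h.hom_int_pow by (metis image_iff)
      then have "t [^] k \<otimes> inv m \<in> M" using eq t Mc NM by auto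
      then have "t [^] k \<otimes> inv m \<otimes> m \<in> M" using m(1) by (rule M.m_closed)
      then show "k = 0" using tk t m Mc by (simp add: m_assoc)
    qed (use f in auto)
    then have "\<kappa> f = \<kappa> \<one>" using h.hom_one by simp
    then show "f \<in> derived G M" using eq[of f \<one>] Fc[OF f] unfolding N_def by simp
  qed

  define D where "D = derived G F"
  have DG: "D \<lhd> G" unfolding D_def by (rule derived_is_normal[OF F])
  obtain Q :: "'a set monoid" and \<kappa> where h: "group_hom G Q \<kappa>"
    and onto: "\<kappa> ` carrier G = carrier Q"
    and eq: "\<And>x y. x \<in> carrier G \<Longrightarrow> y \<in> carrier G \<Longrightarrow> \<kappa> x = \<kappa> y \<longleftrightarrow> x \<otimes> inv y \<in> D"
    using quotient_hom[OF DG] by blast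
  interpret h: group_hom G Q \<kappa> by fact
  have eqc: "\<kappa> (v \<otimes> u) = \<kappa> (u \<otimes> v)"
    if "comm G v u \<in> D" "u \<in> carrier G" "v \<in> carrier G" for u v
    using that eq[of "v \<otimes> u" "u \<otimes> v"] swap[of v u] by simp
  define w where "w = comm G p q"
  have pqc: "p \<in> carrier G" "q \<in> carrier G" "w \<in> carrier G" using pq Mc unfolding w_def by auto
  have hw: "comm Q (\<kappa> p) (\<kappa> q) = \<kappa> w"
    unfolding w_def using pqc by simp
  define f1 where "f1 = inv q \<otimes> (t \<otimes> p \<otimes> inv t)"
  define f2 where "f2 = inv (p \<otimes> inv q) \<otimes> (t \<otimes> q \<otimes> inv t)"
  have f1: "t \<otimes> p \<otimes> inv t = q \<otimes> f1" "f1 \<in> F" unfolding f1_def using tp pqc t by (auto simp: word_simps)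
  have f2: "t \<otimes> q \<otimes> inv t = p \<otimes> inv q \<otimes> f2" "f2 \<in> F" unfolding f2_def using tq pqc t by (auto simp: word_simps)
  have two: "comm Q (\<kappa> p) (\<kappa> q) \<otimes>\<^bsub>Q\<^esub> comm Q (\<kappa> p) (\<kappa> q) = \<one>\<^bsub>Q\<^esub> \<and>
    (\<forall>X\<in>\<kappa> ` M. \<forall>Y\<in>\<kappa> ` M.
        comm Q X Y \<in> {\<one>\<^bsub>Q\<^esub>, comm Q (\<kappa> p) (\<kappa> q)})"
  proof -
    have F': "\<kappa> ` F \<subseteq> carrier Q" using Fc by auto
    have cen': "Y \<otimes>\<^bsub>Q\<^esub> X = X \<otimes>\<^bsub>Q\<^esub> Y"
      if XY: "X \<in> \<kappa> ` F" "Y \<in> carrier Q" for X Y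
    proof -
      obtain u v where uv: "u \<in> F" "X = \<kappa> u" "v \<in> carrier G" "Y = \<kappa> v"
        using XY unfolding onto[symmetric] by blast
      then have "\<kappa> (v \<otimes> u) = \<kappa> (u \<otimes> v)"
        using eqc[of v u] Fc cen[OF uv(1,3)] unfolding D_def by blast
      then show ?thesis using uv Fc by (simp flip: h.hom_mult)
    qed
    have w': "comm Q (\<kappa> p) (\<kappa> q) \<in> \<kappa> ` F"
      unfolding hw w_def using ab pq by blast
    have "\<kappa> ` M \<subseteq> \<kappa> ` generate G (F \<union> {p, q})" using pq(3) by blast
    also have "\<dots> = generate Q (\<kappa> ` (F \<union> {p, q}))"
      by (rule h.generate_img[symmetric]) (use Fc pqc in auto)
    also have "\<kappa> ` (F \<union> {p, q}) = \<kappa> ` F \<union> {\<kappa> p, \<kappa> q}" by blast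
    finally have gen': "\<kappa> ` M \<subseteq> generate Q (\<kappa> ` F \<union> {\<kappa> p, \<kappa> q})" .
    have t1: "(\<kappa> t) \<otimes>\<^bsub>Q\<^esub> (\<kappa> p) \<otimes>\<^bsub>Q\<^esub> inv\<^bsub>Q\<^esub> (\<kappa> t) = (\<kappa> q) \<otimes>\<^bsub>Q\<^esub> (\<kappa> f1)"
      using t pqc f1 Fc by (simp flip: h.hom_mult h.hom_inv)
    have t2: "(\<kappa> t) \<otimes>\<^bsub>Q\<^esub> (\<kappa> q) \<otimes>\<^bsub>Q\<^esub> inv\<^bsub>Q\<^esub> (\<kappa> t) =
        (\<kappa> p) \<otimes>\<^bsub>Q\<^esub> inv\<^bsub>Q\<^esub> (\<kappa> q) \<otimes>\<^bsub>Q\<^esub> (\<kappa> f2)"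
      using t pqc f2 Fc by (simp flip: h.hom_mult h.hom_inv)
    have c: "\<kappa> p \<in> carrier Q" "\<kappa> q \<in> carrier Q" "\<kappa> t \<in> carrier Q"
      using pqc t by auto
    note R = group.commutators_order_two[OF h.H.is_group F' c cen' w' gen' imageI[OF f1(2)] t1 imageI[OF f2(2)] t2]
    show ?thesis using R by blast
  qed
  have ww: "(\<kappa> w) \<otimes>\<^bsub>Q\<^esub> (\<kappa> w) = \<one>\<^bsub>Q\<^esub>" using two unfolding hw by blast
  have wQ: "\<kappa> w \<in> carrier Q" using pqc by simp
  have sub: "subgroup {\<one>\<^bsub>Q\<^esub>, \<kappa> w} Q"
  proof (rule h.H.subgroupI)
    fix a assume "a \<in> {\<one>\<^bsub>Q\<^esub>, \<kappa> w}"
    then show "inv\<^bsub>Q\<^esub> a \<in> {\<one>\<^bsub>Q\<^esub>, \<kappa> w}"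
      using h.H.inv_equality[OF ww] wQ by (elim insertE emptyE) simp_all
  next
    fix a b assume "a \<in> {\<one>\<^bsub>Q\<^esub>, \<kappa> w}" "b \<in> {\<one>\<^bsub>Q\<^esub>, \<kappa> w}"
    then show "a \<otimes>\<^bsub>Q\<^esub> b \<in> {\<one>\<^bsub>Q\<^esub>, \<kappa> w}"
      using ww wQ by (elim insertE emptyE) simp_all
  next
    show "{\<one>\<^bsub>Q\<^esub>, \<kappa> w} \<subseteq> carrier Q" using wQ by simp
  qed simp
  have small: "\<kappa> z \<in> {\<one>\<^bsub>Q\<^esub>, \<kappa> w}" if z: "z \<in> F" for z
  proof -
    have "z \<in> derived G M" using FM' z by (rule subsetD)
    then show ?thesis
    proof (induction z rule: derived_induct)
      case subset
      then show ?case using M.subset .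
    next
      case one
      then show ?case by simp
    next
      case (mult a b y)
      have 1: "comm Q (\<kappa> a) (\<kappa> b) \<in> {\<one>\<^bsub>Q\<^esub>, \<kappa> w}"
        using two mult(1,2) unfolding hw by blast
      have 2: "comm Q (\<kappa> a) (\<kappa> b) = \<kappa> (comm G a b)" using mult(1,2) Mc by simp
      have "y \<in> carrier G" using mult(3) derived_in_carrier[OF M.subset] by blast
      then have "\<kappa> (comm G a b \<otimes> y) = \<kappa> (comm G a b) \<otimes>\<^bsub>Q\<^esub> \<kappa> y"
        using mult(1,2) Mc by (intro h.hom_mult) simp_all
      moreover have "\<kappa> (comm G a b) \<in> {\<one>\<^bsub>Q\<^esub>, \<kappa> w}" using 1 unfolding 2 .
      ultimately show ?case using subgroup.m_closed[OF sub] mult.IH by metis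
    qed
  qed
  have "\<kappa> x = \<kappa> w" "\<kappa> y = \<kappa> w"
    using small x y eq[of x \<one>] eq[of y \<one>] Fc h.hom_one unfolding D_def by auto
  then show ?thesis using eq[of x y] x y Fc unfolding D_def by auto
qed

end

section \<open>The ring \<open>\<int>[\<tau>]\<close>\<close>

lemma tau_pos: "0 < tau" and tau_less_one: "tau < 1" and tau_sq: "tau * tau = 1 - tau"
proof -
  have s: "sqrt 5 * sqrt 5 = (5::real)" by simp
  have "1 < sqrt (5::real)" "sqrt (5::real) < 3"
    using real_less_rsqrt[of 1 5] real_less_lsqrt[of 3 5] by auto
  then show "0 < tau" "tau < 1" unfolding tau_def by auto
  show "tau * tau = 1 - tau" unfolding tau_def using s by (simp add: field_simps)
qed

lemma tau_nz [simp]: "tau \<noteq> 0" using tau_pos by simp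

lemma tau_powi_pos [simp]: "0 < tau powi k" using tau_pos by simp

lemma tau_powi_add: "tau powi (k + l) = tau powi k * tau powi l"
  by (simp add: power_int_add)

lemma tau_powi_uminus_mult [simp]: "tau powi (- k) * tau powi k = 1" "tau powi k * tau powi (- k) = 1"
  using tau_powi_pos[of k] by (simp_all add: power_int_minus)

lemma tau_powi_inj: "tau powi k = tau powi l \<Longrightarrow> k = l"
  using tau_pos tau_less_one power_int_strict_decreasing[of k l tau] power_int_strict_decreasing[of l k tau]
  by (metis less_irrefl linorder_neqE)

lemma Z_tau_iff: "x \<in> Z_tau \<longleftrightarrow> (\<exists>(a::int) (b::int). x = a + b * tau)"
proof
  have "\<exists>(a::int) (b::int). poly (map_poly of_int p) tau = a + b * tau" for p :: "int poly"
  proof (induction p)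
    case (pCons c p)
    then obtain a b :: int where ab: "poly (map_poly of_int p) tau = a + b * tau" by blast
    have "poly (map_poly of_int (pCons c p)) tau = c + tau * (a + b * tau)"
      using ab by (simp add: map_poly_pCons)
    also have "\<dots> = c + a * tau + b * (tau * tau)" by (simp add: algebra_simps)
    also have "\<dots> = of_int (c + b) + of_int (a - b) * tau" by (simp add: tau_sq algebra_simps)
    finally show ?case by blast
  qed (auto intro!: exI[of _ 0])
  then show "x \<in> Z_tau \<Longrightarrow> \<exists>(a::int) (b::int). x = a + b * tau" unfolding Z_tau_def by blast
next
  assume "\<exists>(a::int) (b::int). x = a + b * tau"
  then obtain a b :: int where "x = a + b * tau" by blast
  then have "x = poly (map_poly of_int [:a, b:]) tau" by (simp add: map_poly_pCons algebra_simps)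
  then show "x \<in> Z_tau" unfolding Z_tau_def by blast
qed

lemma Z_tau_add: "x \<in> Z_tau \<Longrightarrow> y \<in> Z_tau \<Longrightarrow> x + y \<in> Z_tau"
proof -
  assume "x \<in> Z_tau" "y \<in> Z_tau"
  then obtain a b c d :: int where "x = a + b * tau" "y = c + d * tau" unfolding Z_tau_iff by blast
  then have "x + y = of_int (a + c) + of_int (b + d) * tau" by (simp add: algebra_simps)
  then show ?thesis unfolding Z_tau_iff by blast
qed

lemma Z_tau_mult: "x \<in> Z_tau \<Longrightarrow> y \<in> Z_tau \<Longrightarrow> x * y \<in> Z_tau"
proof -
  assume "x \<in> Z_tau" "y \<in> Z_tau"
  then obtain a b c d :: int where "x = a + b * tau" "y = c + d * tau" unfolding Z_tau_iff by blast
  then have "x * y = a * c + (a * d + b * c) * tau + b * d * (tau * tau)" by (simp add: algebra_simps)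
  also have "\<dots> = of_int (a * c + b * d) + of_int (a * d + b * c - b * d) * tau"
    by (simp add: tau_sq algebra_simps)
  finally show ?thesis unfolding Z_tau_iff by blast
qed

lemma Z_tau_of_int [simp]: "of_int a \<in> Z_tau"
  unfolding Z_tau_iff by (rule exI[of _ a], rule exI[of _ 0]) simp

lemma Z_tau_0 [simp]: "0 \<in> Z_tau" and Z_tau_1 [simp]: "1 \<in> Z_tau" and Z_tau_tau [simp]: "tau \<in> Z_tau"
  and Z_tau_of_nat [simp]: "of_nat n \<in> Z_tau"
  using Z_tau_of_int[of 0] Z_tau_of_int[of 1] Z_tau_of_int[of "int n"]
  by (auto simp: Z_tau_iff intro: exI[of _ 0] exI[of _ 1])

lemma Z_tau_uminus [simp]: "- x \<in> Z_tau \<longleftrightarrow> x \<in> Z_tau"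
  using Z_tau_mult[of "-1" x] Z_tau_mult[of "-1" "-x"] Z_tau_of_int[of "-1"] by auto

lemma Z_tau_diff: "x \<in> Z_tau \<Longrightarrow> y \<in> Z_tau \<Longrightarrow> x - y \<in> Z_tau"
  using Z_tau_add[of x "-y"] by simp

lemma Z_tau_powi [simp]: "tau powi k \<in> Z_tau"
proof -
  have pow: "x ^ n \<in> Z_tau" if "x \<in> Z_tau" for x n
    using that by (induction n) (auto intro: Z_tau_mult)
  have "inverse tau = 1 + tau" using tau_sq by (simp add: field_simps)
  then have "inverse tau \<in> Z_tau" by (auto intro: Z_tau_add)
  then show ?thesis unfolding power_int_def using pow by auto
qed

lemma Z_tau_powi_mult [simp]: "tau powi k * x \<in> Z_tau \<longleftrightarrow> x \<in> Z_tau"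
proof
  assume "tau powi k * x \<in> Z_tau"
  then have "tau powi (- k) * (tau powi k * x) \<in> Z_tau" by (rule Z_tau_mult[OF Z_tau_powi])
  then show "x \<in> Z_tau" by (metis tau_powi_uminus_mult(1) mult.assoc mult_1)
qed (auto intro: Z_tau_mult)

lemma Z_tau_add_cancel [simp]: "a \<in> Z_tau \<Longrightarrow> x + a \<in> Z_tau \<longleftrightarrow> x \<in> Z_tau"
  "a \<in> Z_tau \<Longrightarrow> a + x \<in> Z_tau \<longleftrightarrow> x \<in> Z_tau"
  using Z_tau_add[of x a] Z_tau_diff[of "x + a" a] by (auto simp: add.commute)

lemma Z_tau_diff_cancel [simp]: "a \<in> Z_tau \<Longrightarrow> x - a \<in> Z_tau \<longleftrightarrow> x \<in> Z_tau"
  using Z_tau_add[of "x - a" a] Z_tau_diff[of x a] by auto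

lemma tau_power_small: "0 < e \<Longrightarrow> \<exists>n::nat. tau powi (int n) < e"
  using real_arch_pow_inv[of e tau] tau_less_one by auto

lemma Z_tau_dense:
  assumes "a < (b::real)"
  obtains x where "x \<in> Z_tau" "a < x" "x < b"
proof -
  obtain n :: nat where n: "tau powi (int n) < b - a" using tau_power_small[of "b - a"] assms by auto
  define d where "d = tau powi (int n)"
  define m where "m = \<lfloor>a / d\<rfloor> + 1"
  have d: "0 < d" unfolding d_def using tau_powi_pos .
  have "of_int m > a / d" "of_int m \<le> a / d + 1" unfolding m_def by linarith+
  then have "d * of_int m > a" "d * of_int m \<le> a + d" using d by (auto simp: field_simps)
  moreover have "d * of_int m \<in> Z_tau" unfolding d_def by (intro Z_tau_mult Z_tau_powi Z_tau_of_int)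
  ultimately show thesis using that n unfolding d_def by fastforce
qed

text \<open>In the basis \<open>\<tau>\<^sup>k, \<tau>\<^sup>k\<^sup>+\<^sup>1\<close> the conjugate of \<open>x\<close> under \<open>\<tau> \<mapsto> - 1 - \<tau>\<close> gives a bounded
  linear form in the coordinates while \<open>x\<close> itself gives one that grows with \<open>k\<close>, so
  both coordinates become positive.\<close>

lemma Z_tau_pos_decomposition:
  assumes "x \<in> Z_tau" "0 < x"
  obtains k a b :: nat where "0 < a" "0 < b" "x = a * tau powi (int k) + b * tau powi (int k + 1)"
proof -
  obtain a0 b0 :: int where ab0: "x = a0 + b0 * tau" using assms unfolding Z_tau_iff by blast
  define \<psi> where "\<psi> = - 1 - tau"
  define c where "c = \<bar>a0 + b0 * \<psi>\<bar>"
  have \<psi>sq: "\<psi> * \<psi> = 1 - \<psi>" unfolding \<psi>_def using tau_sq by (simp add: algebra_simps)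
  have ex: "\<exists>(a::int) (b::int). x = tau ^ k * (a + b * tau) \<and> \<bar>a + b * \<psi>\<bar> \<le> c" for k
  proof (induction k)
    case 0
    then show ?case using ab0 unfolding c_def by auto
  next
    case (Suc k)
    then obtain a b :: int where ab: "x = tau ^ k * (a + b * tau)" "\<bar>a + b * \<psi>\<bar> \<le> c" by blast
    have "a + b * tau = tau * (of_int (a + b) + of_int a * tau)"
      using arg_cong[OF tau_sq, of "\<lambda>z. of_int a * z"] by (simp add: algebra_simps)
    then have 1: "x = tau ^ Suc k * (of_int (a + b) + of_int a * tau)" using ab(1) by simp
    have "a + b * \<psi> = \<psi> * (of_int (a + b) + of_int a * \<psi>)"
      using arg_cong[OF \<psi>sq, of "\<lambda>z. of_int a * z"] by (simp add: algebra_simps)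
    then have 2: "\<bar>\<psi>\<bar> * \<bar>of_int (a + b) + of_int a * \<psi>\<bar> \<le> c" using ab(2) by (simp add: abs_mult)
    have "1 \<le> \<bar>\<psi>\<bar>" unfolding \<psi>_def using tau_pos by simp
    then have "1 * \<bar>of_int (a + b) + of_int a * \<psi>\<bar> \<le> \<bar>\<psi>\<bar> * \<bar>of_int (a + b) + of_int a * \<psi>\<bar>"
      by (rule mult_right_mono) simp
    then have "\<bar>of_int (a + b) + of_int a * \<psi>\<bar> \<le> c" using 2 unfolding mult_1 by (rule order_trans)
    then show ?case using 1 by blast
  qed
  have "0 \<le> c" unfolding c_def by simp
  obtain k :: nat where k: "tau powi (int k) < x / (c + 1)"
    using tau_power_small[of "x / (c + 1)"] assms(2) \<open>0 \<le> c\<close> by auto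
  obtain a b :: int where ab: "x = tau ^ k * (a + b * tau)" "\<bar>a + b * \<psi>\<bar> \<le> c" using ex by blast
  define X where "X = a + b * tau"
  define Y where "Y = a + b * \<psi>"
  have "tau ^ k * (c + 1) < tau ^ k * X" using k ab(1) \<open>0 \<le> c\<close> unfolding X_def by (simp add: field_simps)
  then have X: "c < X" using tau_pos by (smt (verit) mult_less_cancel_left_pos zero_less_power)
  have pos: "0 < tau - \<psi>" unfolding \<psi>_def using tau_pos by simp
  have "of_int b * (tau - \<psi>) = X - Y" unfolding X_def Y_def by (simp add: algebra_simps)
  then have "0 < of_int b * (tau - \<psi>)" using X ab(2) unfolding Y_def by linarith
  then have b: "0 < b" using pos by (simp add: zero_less_mult_iff)
  have "of_int a * (tau - \<psi>) = X + tau * (X + Y)" unfolding X_def Y_def \<psi>_def by (simp add: algebra_simps)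
  moreover have "0 \<le> tau * (X + Y)" using X ab(2) tau_pos unfolding Y_def by (intro mult_nonneg_nonneg) linarith+
  ultimately have "0 < of_int a * (tau - \<psi>)" using X \<open>0 \<le> c\<close> by linarith
  then have a: "0 < a" using pos by (simp add: zero_less_mult_iff)
  have "x = of_nat (nat a) * tau powi (int k) + of_nat (nat b) * tau powi (int k + 1)"
    using ab(1) a b by (simp add: tau_powi_add algebra_simps)
  then show thesis using that[of "nat a" "nat b" k] a b by simp
qed

section \<open>Piecewise linear homeomorphisms of the line\<close>

text \<open>The plain name of the inverse function is taken by the inverse in a group.\<close>

abbreviation finv :: "('a \<Rightarrow> 'b) \<Rightarrow> 'b \<Rightarrow> 'a"
  where "finv \<equiv> inv_into UNIV"

text \<open>The slopes \<open>\<tau>\<^sup>k\<close> to the right and \<open>\<tau>\<^sup>l\<close> to the left of \<open>x\<close> may differ at points of \<open>\<int>[\<tau>]\<close> only.  Stating that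
\<open>f\<close> preserves \<open>\<int>[\<tau>]\<close> as an equivalence makes the condition stable under inverses.  Near \<open>x\<close> no
other point is a breakpoint, so this local condition already makes the breakpoints locally
finite.\<close>

definition tau_linear_at :: "(real \<Rightarrow> real) \<Rightarrow> real \<Rightarrow> bool" where
  "tau_linear_at f x \<longleftrightarrow> (\<exists>(k::int) (l::int) e. 0 < e \<and>
     (\<forall>t. 0 \<le> t \<longrightarrow> t < e \<longrightarrow> f (x + t) = f x + tau powi k * t \<and> f (x - t) = f x - tau powi l * t) \<and>
     (k \<noteq> l \<longrightarrow> x \<in> Z_tau) \<and> (x \<in> Z_tau \<longleftrightarrow> f x \<in> Z_tau))"

definition PL :: "(real \<Rightarrow> real) set" where
  "PL = {f. strict_mono f \<and> surj f \<and> (\<forall>x. tau_linear_at f x)}"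

lemma tau_linear_atE:
  assumes "tau_linear_at f x"
  obtains k l :: int and e where "0 < e"
    "\<And>t. 0 \<le> t \<Longrightarrow> t < e \<Longrightarrow> f (x + t) = f x + tau powi k * t"
    "\<And>t. 0 \<le> t \<Longrightarrow> t < e \<Longrightarrow> f (x - t) = f x - tau powi l * t"
    "k \<noteq> l \<Longrightarrow> x \<in> Z_tau" "x \<in> Z_tau \<longleftrightarrow> f x \<in> Z_tau"
  using assms unfolding tau_linear_at_def by blast

lemma tau_linear_atI:
  assumes "0 < e"
    "\<And>t. 0 \<le> t \<Longrightarrow> t < e \<Longrightarrow> f (x + t) = f x + tau powi k * t"
    "\<And>t. 0 \<le> t \<Longrightarrow> t < e \<Longrightarrow> f (x - t) = f x - tau powi l * t"
    "k \<noteq> l \<Longrightarrow> x \<in> Z_tau" "x \<in> Z_tau \<longleftrightarrow> f x \<in> Z_tau"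
  shows "tau_linear_at f x"
  using assms unfolding tau_linear_at_def by blast

lemma tau_linear_at_cong:
  assumes g: "tau_linear_at g x" and d: "0 < d" and fg: "\<And>y. \<bar>y - x\<bar> < d \<Longrightarrow> f y = g y"
  shows "tau_linear_at f x"
proof -
  obtain k l :: int and e where e: "0 < e"
    "\<And>t. 0 \<le> t \<Longrightarrow> t < e \<Longrightarrow> g (x + t) = g x + tau powi k * t"
    "\<And>t. 0 \<le> t \<Longrightarrow> t < e \<Longrightarrow> g (x - t) = g x - tau powi l * t"
    "k \<noteq> l \<Longrightarrow> x \<in> Z_tau" "x \<in> Z_tau \<longleftrightarrow> g x \<in> Z_tau"
    using g by (rule tau_linear_atE) blast
  show ?thesis
    by (rule tau_linear_atI[of "min d e" _ _ k l]) (use e d fg in auto)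
qed

lemma tau_linear_at_glue:
  assumes x: "x \<in> Z_tau" and g: "tau_linear_at g x" and h: "tau_linear_at h x" and d: "0 < d"
    and fg: "\<And>y. x - d < y \<Longrightarrow> y \<le> x \<Longrightarrow> f y = g y"
    and fh: "\<And>y. x \<le> y \<Longrightarrow> y < x + d \<Longrightarrow> f y = h y"
  shows "tau_linear_at f x"
proof -
  obtain k l :: int and e where e: "0 < e"
    "\<And>t. 0 \<le> t \<Longrightarrow> t < e \<Longrightarrow> g (x + t) = g x + tau powi k * t"
    "\<And>t. 0 \<le> t \<Longrightarrow> t < e \<Longrightarrow> g (x - t) = g x - tau powi l * t"
    "k \<noteq> l \<Longrightarrow> x \<in> Z_tau" "x \<in> Z_tau \<longleftrightarrow> g x \<in> Z_tau"
    using g by (rule tau_linear_atE) blast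
  obtain k' l' :: int and e' where e': "0 < e'"
    "\<And>t. 0 \<le> t \<Longrightarrow> t < e' \<Longrightarrow> h (x + t) = h x + tau powi k' * t"
    "\<And>t. 0 \<le> t \<Longrightarrow> t < e' \<Longrightarrow> h (x - t) = h x - tau powi l' * t"
    "k' \<noteq> l' \<Longrightarrow> x \<in> Z_tau" "x \<in> Z_tau \<longleftrightarrow> h x \<in> Z_tau"
    using h by (rule tau_linear_atE) blast
  have "f x = g x" "f x = h x" using fg[of x] fh[of x] d by auto
  then show ?thesis
    by (intro tau_linear_atI[of "min d (min e e')" _ _ k' l]) (use e e' d fg fh x in auto)
qed

lemma PL_D:
  assumes "f \<in> PL"
  shows "strict_mono f" "surj f" "inj f" "bij f" "tau_linear_at f x" "x \<in> Z_tau \<longleftrightarrow> f x \<in> Z_tau"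
proof -
  show 1: "strict_mono f" "surj f" and 2: "tau_linear_at f x" for x
    using assms unfolding PL_def by blast+
  show "inj f" using 1(1) by (rule strict_mono_imp_inj_on)
  then show "bij f" using 1(2) by (simp add: bij_def)
  show "x \<in> Z_tau \<longleftrightarrow> f x \<in> Z_tau" using 2 unfolding tau_linear_at_def by blast
qed

lemma PL_less: "f \<in> PL \<Longrightarrow> f x < f y \<longleftrightarrow> x < y" and PL_le: "f \<in> PL \<Longrightarrow> f x \<le> f y \<longleftrightarrow> x \<le> y"
  using strict_mono_less[OF PL_D(1)] strict_mono_less_eq[OF PL_D(1)]
  by simp_all

lemma PL_inv_f [simp]: "f \<in> PL \<Longrightarrow> finv f (f x) = x" and PL_f_inv [simp]: "f \<in> PL \<Longrightarrow> f (finv f x) = x"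
  by (simp_all add: PL_D(2,3) surj_f_inv_f)

lemma PL_inv_comp [simp]: "f \<in> PL \<Longrightarrow> finv f \<circ> f = id" and PL_comp_inv [simp]: "f \<in> PL \<Longrightarrow> f \<circ> finv f = id"
  by (simp_all add: fun_eq_iff)

lemma PL_inv_eq_iff: "f \<in> PL \<Longrightarrow> finv f y = x \<longleftrightarrow> y = f x"
  using PL_inv_f[of f x] PL_f_inv[of f y] by auto

lemma PL_continuous: "f \<in> PL \<Longrightarrow> continuous_on UNIV f"
  by (rule continuous_onI_mono) (simp_all add: PL_D(2) PL_le)

lemma PL_comp:
  assumes f: "f \<in> PL" and g: "g \<in> PL"
  shows "f \<circ> g \<in> PL"
proof -
  have "tau_linear_at (f \<circ> g) x" for x
  proof -
    obtain k l :: int and e where e: "0 < e"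
      "\<And>t. 0 \<le> t \<Longrightarrow> t < e \<Longrightarrow> g (x + t) = g x + tau powi k * t"
      "\<And>t. 0 \<le> t \<Longrightarrow> t < e \<Longrightarrow> g (x - t) = g x - tau powi l * t"
      "k \<noteq> l \<Longrightarrow> x \<in> Z_tau" "x \<in> Z_tau \<longleftrightarrow> g x \<in> Z_tau"
      using PL_D(5)[OF g, of x] by (rule tau_linear_atE) blast
    obtain k' l' :: int and e' where e': "0 < e'"
      "\<And>t. 0 \<le> t \<Longrightarrow> t < e' \<Longrightarrow> f (g x + t) = f (g x) + tau powi k' * t"
      "\<And>t. 0 \<le> t \<Longrightarrow> t < e' \<Longrightarrow> f (g x - t) = f (g x) - tau powi l' * t"
      "k' \<noteq> l' \<Longrightarrow> g x \<in> Z_tau" "g x \<in> Z_tau \<longleftrightarrow> f (g x) \<in> Z_tau"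
      using PL_D(5)[OF f, of "g x"] by (rule tau_linear_atE) blast
    define d where "d = min e (min (e' / tau powi k) (e' / tau powi l))"
    have d: "0 < d" using e(1) e'(1) unfolding d_def by simp
    have small: "t < e" "tau powi k * t < e'" "tau powi l * t < e'" if "t < d" for t
      using that unfolding d_def by (auto simp: pos_less_divide_eq mult.commute)
    show ?thesis
    proof (rule tau_linear_atI[of d _ _ "k' + k" "l' + l"])
      fix t :: real assume t: "0 \<le> t" "t < d"
      have p: "0 \<le> tau powi i * t" for i
        by (intro mult_nonneg_nonneg less_imp_le[OF tau_powi_pos] t(1))
      show "(f \<circ> g) (x + t) = (f \<circ> g) x + tau powi (k' + k) * t"
        using t small[OF t(2)] p[of k] e'(2)[of "tau powi k * t"] e(2)[of t] by (simp add: tau_powi_add)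
      show "(f \<circ> g) (x - t) = (f \<circ> g) x - tau powi (l' + l) * t"
        using t small[OF t(2)] p[of l] e'(3)[of "tau powi l * t"] e(3)[of t] by (simp add: tau_powi_add)
    qed (use d e(4,5) e'(4,5) in auto)
  qed
  moreover have "strict_mono (f \<circ> g)" using f g by (simp add: strict_mono_def PL_less)
  moreover have "surj (f \<circ> g)" using comp_surj[OF PL_D(2)[OF g] PL_D(2)[OF f]] .
  ultimately show ?thesis unfolding PL_def by blast
qed

lemma PL_inv:
  assumes f: "f \<in> PL"
  shows "finv f \<in> PL"
proof -
  have "tau_linear_at (finv f) y" for y
  proof -
    define x where "x = finv f y"
    have y: "y = f x" unfolding x_def using f by simp
    obtain k l :: int and e where e: "0 < e"
      "\<And>t. 0 \<le> t \<Longrightarrow> t < e \<Longrightarrow> f (x + t) = f x + tau powi k * t"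
      "\<And>t. 0 \<le> t \<Longrightarrow> t < e \<Longrightarrow> f (x - t) = f x - tau powi l * t"
      "k \<noteq> l \<Longrightarrow> x \<in> Z_tau" "x \<in> Z_tau \<longleftrightarrow> f x \<in> Z_tau"
      using PL_D(5)[OF f, of x] by (rule tau_linear_atE) blast
    define d where "d = min (e * tau powi k) (e * tau powi l)"
    have d: "0 < d" using e(1) unfolding d_def by simp
    have canc: "tau powi i * (tau powi (-i) * t) = t" for i t
      by (metis tau_powi_uminus_mult(2) mult.assoc mult_1)
    have small: "tau powi (-k) * t < e" "tau powi (-l) * t < e" if "t < d" for t
    proof -
      have "tau powi k * (tau powi (-k) * t) < tau powi k * e" "tau powi l * (tau powi (-l) * t) < tau powi l * e"
        unfolding canc using that unfolding d_def by (auto simp: mult.commute)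
      then show "tau powi (-k) * t < e" "tau powi (-l) * t < e"
        using mult_less_cancel_left_pos[OF tau_powi_pos] by blast+
    qed
    show ?thesis
    proof (rule tau_linear_atI[of d _ _ "-k" "-l"])
      fix t :: real assume t: "0 \<le> t" "t < d"
      have p: "0 \<le> tau powi i * t" for i
        by (intro mult_nonneg_nonneg less_imp_le[OF tau_powi_pos] t(1))
      have "f (x + tau powi (-k) * t) = y + t"
        using e(2)[OF p small(1)[OF t(2)]] y canc by simp
      then show "finv f (y + t) = finv f y + tau powi (-k) * t"
        using f by (simp add: PL_inv_eq_iff x_def[symmetric])
      have "f (x - tau powi (-l) * t) = y - t"
        using e(3)[OF p small(2)[OF t(2)]] y canc by simp
      then show "finv f (y - t) = finv f y - tau powi (-l) * t"
        using f by (simp add: PL_inv_eq_iff x_def[symmetric])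
    next
      show "y \<in> Z_tau" if "- k \<noteq> - l" using e(4,5) that unfolding y by blast
      have "y \<in> Z_tau \<longleftrightarrow> x \<in> Z_tau" unfolding y using e(5) by blast
      then show "y \<in> Z_tau \<longleftrightarrow> finv f y \<in> Z_tau" unfolding x_def .
    qed (rule d)
  qed
  moreover have "strict_mono (finv f)"
    unfolding strict_mono_def using PL_less[OF f] PL_f_inv[OF f] by metis
  moreover have "surj (finv f)" by (rule surjI[of _ f]) (simp add: f)
  ultimately show ?thesis unfolding PL_def by blast
qed

lemma PL_affine:
  assumes "c \<in> Z_tau"
  shows "(\<lambda>x. tau powi k * x + c) \<in> PL"
proof -
  have "tau_linear_at (\<lambda>x. tau powi k * x + c) x" for x
    by (rule tau_linear_atI[of 1 _ _ k k]) (use assms in \<open>auto simp: distrib_left right_diff_distrib\<close>)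
  moreover have "strict_mono (\<lambda>x. tau powi k * x + c)" by (rule strict_monoI) simp
  moreover have "surj (\<lambda>x. tau powi k * x + c)"
  proof (rule surjI)
    fix y show "tau powi k * (tau powi (-k) * (y - c)) + c = y"
      by (metis tau_powi_uminus_mult(2) mult.assoc mult_1 diff_add_cancel)
  qed
  ultimately show ?thesis unfolding PL_def by blast
qed

lemma PL_id [simp]: "id \<in> PL" "(\<lambda>x. x) \<in> PL"
  using PL_affine[of 0 0] by (auto simp: id_def)

lemma PL_translation: "c \<in> Z_tau \<Longrightarrow> (\<lambda>x. x + c) \<in> PL"
  using PL_affine[of c 0] by simp

definition glue :: "real \<Rightarrow> (real \<Rightarrow> real) \<Rightarrow> (real \<Rightarrow> real) \<Rightarrow> real \<Rightarrow> real" where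
  "glue a f g = (\<lambda>x. if x \<le> a then f x else g x)"

text \<open>Breaking at a point of \<open>\<int>[\<tau>]\<close> is free, since the conditions on the two sides of such a point are independent.\<close>

lemma PL_glue:
  assumes f: "f \<in> PL" and g: "g \<in> PL" and a: "a \<in> Z_tau" and fg: "f a = g a"
  shows "glue a f g \<in> PL"
proof -
  have "tau_linear_at (glue a f g) x" for x
  proof (cases x a rule: linorder_cases)
    case less
    then show ?thesis
      by (intro tau_linear_at_cong[OF PL_D(5)[OF f], of "a - x"]) (auto simp: glue_def)
  next
    case equal
    have "tau_linear_at (glue a f g) a"
      by (rule tau_linear_at_glue[OF a PL_D(5)[OF f] PL_D(5)[OF g], of 1]) (use fg in \<open>auto simp: glue_def\<close>)
    then show ?thesis using equal by simp
  next
    case greater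
    then show ?thesis
      by (intro tau_linear_at_cong[OF PL_D(5)[OF g], of "x - a"]) (auto simp: glue_def)
  qed
  moreover have "strict_mono (glue a f g)"
  proof (rule strict_monoI)
    fix x y :: real assume "x < y"
    moreover have "f x < g y" if "x \<le> a" "a < y"
    proof -
      have "f x \<le> f a" "g a < g y" using that f g by (simp_all add: PL_le PL_less)
      then show ?thesis using fg by simp
    qed
    ultimately show "glue a f g x < glue a f g y"
      using f g by (auto simp: glue_def PL_less)
  qed
  moreover have "surj (glue a f g)"
  proof (rule surjI)
    fix y
    show "glue a f g (if y \<le> f a then finv f y else finv g y) = y"
      using PL_le[OF f, of "finv f y" a] PL_le[OF g, of "finv g y" a] f g fg by (simp add: glue_def)
  qed
  ultimately show ?thesis unfolding PL_def by blast
qed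

text \<open>The set of possible \<open>u\<close> contains the powers of \<open>\<tau>\<close>, and it is closed under addition: as
\<open>1 = \<tau> + \<tau>\<^sup>2\<close>, the unit interval splits into two intervals that are rescaled unit intervals.\<close>

lemma PL_stretch_unit:
  assumes "u \<in> Z_tau" "0 < u"
  shows "\<exists>f\<in>PL. f 0 = 0 \<and> f 1 = u"
proof -
  define C where "C u \<longleftrightarrow> u \<in> Z_tau \<and> 0 < u \<and> (\<exists>f\<in>PL. f 0 = 0 \<and> f 1 = u)" for u
  have pow: "C (tau powi k)" for k
    unfolding C_def using PL_affine[of 0 k] by (auto intro!: bexI[of _ "\<lambda>x. tau powi k * x"])
  have add: "C (u + v)" if C: "C u" "C v" for u v
  proof -
    obtain f g where f: "f \<in> PL" "f 0 = 0" "f 1 = u" and g: "g \<in> PL" "g 0 = 0" "g 1 = v"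
      using C unfolding C_def by blast
    have uv: "u \<in> Z_tau" "v \<in> Z_tau" "0 < u" "0 < v" using C unfolding C_def by auto
    \<comment> \<open>the unit interval is cut at \<open>\<tau>\<close> into pieces of lengths \<open>\<tau>\<close> and \<open>\<tau>\<^sup>2\<close>\<close>
    define F where "F = f \<circ> (\<lambda>x. tau powi (-1) * x + 0)"
    define H where "H = (\<lambda>x. x + u) \<circ> g \<circ> (\<lambda>x. tau powi (-2) * x + (- (tau powi (-1))))"
    have FP: "F \<in> PL" unfolding F_def by (intro PL_comp f PL_affine) auto
    have HP: "H \<in> PL" unfolding H_def by (intro PL_comp g PL_affine PL_translation uv) (simp only: Z_tau_uminus Z_tau_powi)
    have m1: "tau powi (-1) * tau = 1" by (simp add: power_int_minus)
    have m2: "tau powi (-2) * tau = tau powi (-1)"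
      using tau_powi_add[of "-2" 1] by simp
    have m3: "tau powi (-2) - tau powi (-1) = 1"
    proof -
      have "(tau * tau) * (tau powi (-2) - tau powi (-1)) = 1 - tau"
        by (simp add: power_int_minus power2_eq_square field_simps)
      then show ?thesis using tau_sq tau_less_one
        by (metis diff_gt_0_iff_gt less_irrefl mult_cancel_left mult.right_neutral)
    qed
    have "F tau = H tau" unfolding F_def H_def using m1 m2 f g by simp
    then have "glue tau F H \<in> PL" using PL_glue FP HP by simp
    moreover have "glue tau F H 0 = 0" using tau_pos f by (simp add: glue_def F_def)
    moreover have "glue tau F H 1 = u + v" using tau_less_one g m3 by (simp add: glue_def H_def)
    ultimately show ?thesis unfolding C_def using uv Z_tau_add by auto
  qed
  have nat: "C (of_nat (Suc n) * tau powi k)" for n k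
  proof (induction n)
    case (Suc n)
    then show ?case using add[OF Suc pow[of k]] by (simp add: algebra_simps)
  qed (use pow[of k] in simp)
  obtain k a b :: nat where ab: "0 < a" "0 < b" "u = a * tau powi (int k) + b * tau powi (int k + 1)"
    using Z_tau_pos_decomposition[OF assms] .
  have "C u"
    using add[OF nat[of "a - 1" "int k"] nat[of "b - 1" "int k + 1"]] ab by simp
  then show ?thesis unfolding C_def by blast
qed

lemma PL_interpolate:
  assumes "a \<in> Z_tau" "b \<in> Z_tau" "c \<in> Z_tau" "d \<in> Z_tau" "a < b" "c < d"
  obtains f where "f \<in> PL" "f a = c" "f b = d"
proof -
  obtain g where g: "g \<in> PL" "g 0 = 0" "g 1 = b - a"
    using PL_stretch_unit[of "b - a"] assms Z_tau_diff by auto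
  obtain h where h: "h \<in> PL" "h 0 = 0" "h 1 = d - c"
    using PL_stretch_unit[of "d - c"] assms Z_tau_diff by auto
  define f where "f = (\<lambda>x. x + c) \<circ> h \<circ> finv g \<circ> (\<lambda>x. x + (- a))"
  have "f \<in> PL" unfolding f_def using g h assms by (intro PL_comp PL_inv PL_translation) auto
  moreover have "finv g 0 = 0" "finv g (b - a) = 1" using g by (simp_all add: PL_inv_eq_iff)
  then have "f a = c" "f b = d" unfolding f_def using h by simp_all
  ultimately show thesis by (rule that)
qed

text \<open>Lets a homeomorphism be replaced by a compactly supported one that has the same effect on a given interval.\<close>

lemma PL_localize:
  assumes f: "f \<in> PL" and Z: "u \<in> Z_tau" "v \<in> Z_tau" "a \<in> Z_tau" "b \<in> Z_tau"
    and uv: "u \<le> v" and a: "a < u" "a < f u" and b: "v < b" "f v < b"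
  obtains g where "g \<in> PL" "\<And>x. u \<le> x \<Longrightarrow> x \<le> v \<Longrightarrow> g x = f x"
    "\<And>x. x \<le> a \<Longrightarrow> g x = x" "\<And>x. b \<le> x \<Longrightarrow> g x = x"
proof -
  have fZ: "f u \<in> Z_tau" "f v \<in> Z_tau" using Z(1,2) iffD1[OF PL_D(6)[OF f]] by blast+
  obtain l where l: "l \<in> PL" "l a = a" "l u = f u"
    using PL_interpolate[OF Z(3) Z(1) Z(3) fZ(1) a] .
  obtain r where r: "r \<in> PL" "r v = f v" "r b = b"
    using PL_interpolate[OF Z(2) Z(4) fZ(2) Z(4) b] .
  define g where "g = glue b (glue v (glue u (glue a id l) f) r) id"
  have 1: "glue a id l \<in> PL" by (rule PL_glue) (use l Z in \<open>auto\<close>)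
  have 2: "glue u (glue a id l) f \<in> PL" by (rule PL_glue) (use 1 f l a Z in \<open>auto simp: glue_def\<close>)
  have 3: "glue v (glue u (glue a id l) f) r \<in> PL" by (rule PL_glue) (use 2 r uv l a Z in \<open>auto simp: glue_def\<close>)
  have "g \<in> PL" unfolding g_def by (rule PL_glue) (use 3 r uv l a b Z in \<open>auto simp: glue_def\<close>)
  moreover have "g x = f x" if "u \<le> x" "x \<le> v" for x
    using that a b l by (cases "x = u") (auto simp: g_def glue_def)
  moreover have "g x = x" if "x \<le> a" for x
    using that a b uv by (simp add: g_def glue_def)
  moreover have "g x = x" if "b \<le> x" for x
    using that b r by (cases "x = b") (auto simp: g_def glue_def)
  ultimately show thesis by (rule that)
qed

section \<open>Germs at infinity\<close>

text \<open>The germ at \<open>+\<infinity>\<close> of such a map is the affine map \<open>x \<mapsto> \<tau>\<^sup>k x + c\<close>.  These germs take the place of the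
quotient of \<open>B\<close> by \<open>F\<close> in the introduction, where \<open>B\<close>, \<open>M\<close> and \<open>F\<close> are called \<open>end_group\<close>,
\<open>end_translations\<close> and \<open>compact_PL\<close> below.\<close>

definition affine_end :: "(real \<Rightarrow> real) \<Rightarrow> int \<Rightarrow> real \<Rightarrow> bool" where
  "affine_end f k c \<longleftrightarrow> f \<in> PL \<and> (\<forall>\<^sub>F x in at_bot. f x = x) \<and> (\<forall>\<^sub>F x in at_top. f x = tau powi k * x + c)"

lemma affine_end_PL: "affine_end f k c \<Longrightarrow> f \<in> PL"
  unfolding affine_end_def by blast

lemma PL_at_top: "f \<in> PL \<Longrightarrow> filterlim f at_top at_top"
  unfolding filterlim_at_top
proof
  fix Z assume f: "f \<in> PL"
  show "\<forall>\<^sub>F x in at_top. Z \<le> f x"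
    using eventually_ge_at_top[of "finv f Z"]
    by eventually_elim (use f PL_le[of f "finv f Z"] in simp)
qed

lemma PL_at_bot: "f \<in> PL \<Longrightarrow> filterlim f at_bot at_bot"
  unfolding filterlim_at_bot
proof
  fix Z assume f: "f \<in> PL"
  show "\<forall>\<^sub>F x in at_bot. f x \<le> Z"
    using eventually_le_at_bot[of "finv f Z"]
    by eventually_elim (use f PL_le[of f _ "finv f Z"] in simp)
qed

lemma affine_end_comp:
  assumes f: "affine_end f k c" and g: "affine_end g l d"
  shows "affine_end (f \<circ> g) (k + l) (tau powi k * d + c)"
proof -
  have P: "f \<in> PL" "g \<in> PL" using f g affine_end_PL by auto
  have "\<forall>\<^sub>F x in at_bot. f (g x) = g x" "\<forall>\<^sub>F x in at_top. f (g x) = tau powi k * g x + c"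
    using f eventually_compose_filterlim[OF _ PL_at_bot[OF P(2)]]
      eventually_compose_filterlim[OF _ PL_at_top[OF P(2)]]
    unfolding affine_end_def by blast+
  moreover have "\<forall>\<^sub>F x in at_bot. g x = x" "\<forall>\<^sub>F x in at_top. g x = tau powi l * x + d"
    using g unfolding affine_end_def by auto
  ultimately have "\<forall>\<^sub>F x in at_bot. f (g x) = g x \<and> g x = x"
    and 1: "\<forall>\<^sub>F x in at_top. f (g x) = tau powi k * g x + c \<and> g x = tau powi l * x + d"
    by (auto intro: eventually_conj)
  then have "\<forall>\<^sub>F x in at_bot. (f \<circ> g) x = x" by (auto elim: eventually_mono)
  moreover have "\<forall>\<^sub>F x in at_top. (f \<circ> g) x = tau powi (k + l) * x + (tau powi k * d + c)"
    using 1
  proof eventually_elim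
    case (elim x)
    then have "(f \<circ> g) x = tau powi k * (tau powi l * x + d) + c" by (metis comp_apply)
    then show ?case by (simp add: tau_powi_add distrib_left)
  qed
  ultimately show ?thesis unfolding affine_end_def using PL_comp P by blast
qed

lemma tau_powi_cancel: "tau powi k * (tau powi (- k) * x) = x" "tau powi (- k) * (tau powi k * x) = x"
  by (metis tau_powi_uminus_mult mult.assoc mult_1)+

lemma affine_end_inv:
  assumes f: "affine_end f k c"
  shows "affine_end (finv f) (- k) (- (tau powi (- k) * c))"
proof -
  have P: "f \<in> PL" "finv f \<in> PL" using f affine_end_PL PL_inv by auto
  have "\<forall>\<^sub>F x in at_bot. f (finv f x) = finv f x"
    using f eventually_compose_filterlim[OF _ PL_at_bot[OF P(2)]] unfolding affine_end_def by blast
  then have "\<forall>\<^sub>F x in at_bot. finv f x = x" by eventually_elim (simp add: P(1))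
  moreover have 1: "\<forall>\<^sub>F x in at_top. f (finv f x) = tau powi k * finv f x + c"
    using f eventually_compose_filterlim[OF _ PL_at_top[OF P(2)]] unfolding affine_end_def by blast
  moreover have "\<forall>\<^sub>F x in at_top. finv f x = tau powi (- k) * x + (- (tau powi (- k) * c))"
    using 1
  proof eventually_elim
    case (elim x)
    then have "x = tau powi k * finv f x + c" using P(1) by simp
    then have "tau powi (- k) * (x - c) = finv f x" using tau_powi_cancel(2) by (metis add_diff_cancel_right')
    then show ?case by (simp only: right_diff_distrib)
  qed
  ultimately show ?thesis unfolding affine_end_def using P(2) by blast
qed

lemma affine_eq:
  assumes "tau powi k * x + c = tau powi l * x + d" "tau powi k * y + c = tau powi l * y + d" "x < y"
  shows "k = l" "c = d"
proof -
  have "tau powi k * (y - x) = tau powi l * (y - x)"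
    using assms(1,2) by (simp only: right_diff_distrib)
  then show "k = l" using assms(3) tau_powi_inj by simp
  then show "c = d" using assms(1) by simp
qed

lemma affine_end_unique:
  assumes "affine_end f k c" "affine_end f l d"
  shows "k = l" "c = d"
proof -
  have "\<forall>\<^sub>F x in at_top. tau powi k * x + c = tau powi l * x + d"
    using assms unfolding affine_end_def by (auto elim: eventually_elim2)
  then obtain N where "\<And>x. N \<le> x \<Longrightarrow> tau powi k * x + c = tau powi l * x + d"
    unfolding eventually_at_top_linorder by blast
  then have "tau powi k * N + c = tau powi l * N + d" "tau powi k * (N + 1) + c = tau powi l * (N + 1) + d"
    by simp_all
  then show "k = l" "c = d" using affine_eq[of k N c l d "N + 1"] by simp_all
qed

lemma affine_end_Z_tau:
  assumes "affine_end f k c"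
  shows "c \<in> Z_tau"
proof -
  obtain N where N: "\<And>x. N \<le> x \<Longrightarrow> f x = tau powi k * x + c"
    using assms unfolding affine_end_def eventually_at_top_linorder by blast
  define x :: real where "x = of_int \<lceil>N\<rceil>"
  have "x \<in> Z_tau" unfolding x_def by simp
  then have "f x \<in> Z_tau" "tau powi k * x \<in> Z_tau"
    using PL_D(6)[OF affine_end_PL[OF assms]] by (blast, intro Z_tau_mult Z_tau_powi)
  moreover have "c = f x - tau powi k * x" using N[of x] unfolding x_def by simp
  ultimately show ?thesis using Z_tau_diff by simp
qed

definition end_group :: "(real \<Rightarrow> real) monoid" where
  "end_group = \<lparr>carrier = {f. \<exists>k c. affine_end f k c}, mult = (\<circ>), one = id\<rparr>"

definition end_translations :: "(real \<Rightarrow> real) set" where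
  "end_translations = {f. \<exists>c. affine_end f 0 c}"

definition compact_PL :: "(real \<Rightarrow> real) set" where
  "compact_PL = {f. affine_end f 0 0}"

lemma end_group_simps [simp]: "mult end_group = (\<circ>)" "one end_group = id"
  "f \<in> carrier end_group \<longleftrightarrow> (\<exists>k c. affine_end f k c)"
  unfolding end_group_def by auto

lemma affine_end_id: "affine_end id 0 0" unfolding affine_end_def by simp

lemma finv_comp_id: "affine_end f k c \<Longrightarrow> finv f \<circ> f = id"
  using affine_end_PL by simp

lemma group_end_group: "group end_group"
proof (rule groupI)
  fix f g assume "f \<in> carrier end_group" "g \<in> carrier end_group"
  then show "f \<otimes>\<^bsub>end_group\<^esub> g \<in> carrier end_group" using affine_end_comp by (simp, blast)
next
  fix f assume "f \<in> carrier end_group"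
  then obtain k c where "affine_end f k c" by auto
  then show "\<exists>g\<in>carrier end_group. g \<otimes>\<^bsub>end_group\<^esub> f = \<one>\<^bsub>end_group\<^esub>"
    using affine_end_inv[of f k c] finv_comp_id[of f k c] by (intro bexI[of _ "finv f"]) auto
qed (use affine_end_id in \<open>auto simp: comp_assoc\<close>)

interpretation EG: group end_group by (rule group_end_group)

lemma end_group_inv: "affine_end f k c \<Longrightarrow> inv\<^bsub>end_group\<^esub> f = finv f"
  using affine_end_inv[of f k c] finv_comp_id[of f k c] by (intro EG.inv_equality) auto

lemma affine_end_conj:
  assumes f: "affine_end f k c" and g: "affine_end g 0 d"
  shows "affine_end (f \<circ> g \<circ> finv f) 0 (tau powi k * d)"
  using affine_end_comp[OF affine_end_comp[OF f g] affine_end_inv[OF f]] by (simp add: tau_powi_cancel)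

lemma normal_compact_PL: "compact_PL \<lhd> end_group"
  and normal_end_translations: "end_translations \<lhd> end_group"
proof -
  have s1: "subgroup compact_PL end_group"
  proof (rule EG.subgroupI)
    fix f assume "f \<in> compact_PL"
    then show "inv\<^bsub>end_group\<^esub> f \<in> compact_PL"
      using affine_end_inv[of f 0 0] end_group_inv[of f 0 0] unfolding compact_PL_def by simp
  next
    fix f g assume "f \<in> compact_PL" "g \<in> compact_PL"
    then show "f \<otimes>\<^bsub>end_group\<^esub> g \<in> compact_PL"
      using affine_end_comp[of f 0 0 g 0 0] unfolding compact_PL_def by simp
  qed (use affine_end_id in \<open>auto simp: compact_PL_def, blast\<close>)
  have s2: "subgroup end_translations end_group"
  proof (rule EG.subgroupI)
    fix f assume "f \<in> end_translations"
    then show "inv\<^bsub>end_group\<^esub> f \<in> end_translations"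
      using affine_end_inv[of f 0] end_group_inv[of f 0] unfolding end_translations_def by fastforce
  next
    fix f g assume "f \<in> end_translations" "g \<in> end_translations"
    then show "f \<otimes>\<^bsub>end_group\<^esub> g \<in> end_translations"
      using affine_end_comp[of f 0 _ g 0] unfolding end_translations_def by fastforce
  qed (use affine_end_id in \<open>auto simp: end_translations_def, blast\<close>)
  show "compact_PL \<lhd> end_group"
  proof (rule EG.normal_invI[OF s1])
    fix f g assume "f \<in> carrier end_group" "g \<in> compact_PL"
    then show "f \<otimes>\<^bsub>end_group\<^esub> g \<otimes>\<^bsub>end_group\<^esub> inv\<^bsub>end_group\<^esub> f \<in> compact_PL"
      using affine_end_conj[of f _ _ g 0] end_group_inv[of f] unfolding compact_PL_def by fastforce
  qed
  show "end_translations \<lhd> end_group"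
  proof (rule EG.normal_invI[OF s2])
    fix f g assume "f \<in> carrier end_group" "g \<in> end_translations"
    then show "f \<otimes>\<^bsub>end_group\<^esub> g \<otimes>\<^bsub>end_group\<^esub> inv\<^bsub>end_group\<^esub> f \<in> end_translations"
      using affine_end_conj[of f _ _ g] end_group_inv[of f] unfolding end_translations_def by fastforce
  qed
qed

lemma compact_PL_iff:
  "f \<in> compact_PL \<longleftrightarrow> f \<in> PL \<and> (\<exists>n::nat. \<forall>x. real n \<le> \<bar>x\<bar> \<longrightarrow> f x = x)"
proof
  assume "f \<in> compact_PL"
  then obtain a b where ab: "f \<in> PL" "\<And>x. x \<le> a \<Longrightarrow> f x = x" "\<And>x. b \<le> x \<Longrightarrow> f x = x"
    unfolding compact_PL_def affine_end_def eventually_at_top_linorder eventually_at_bot_linorder by auto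
  obtain n :: nat where "max \<bar>a\<bar> \<bar>b\<bar> \<le> n" using real_arch_simple by blast
  then have "f x = x" if "real n \<le> \<bar>x\<bar>" for x using that ab(2)[of x] ab(3)[of x] by linarith
  then show "f \<in> PL \<and> (\<exists>n::nat. \<forall>x. real n \<le> \<bar>x\<bar> \<longrightarrow> f x = x)" using ab(1) by blast
next
  assume "f \<in> PL \<and> (\<exists>n::nat. \<forall>x. real n \<le> \<bar>x\<bar> \<longrightarrow> f x = x)"
  then obtain n :: nat where n: "f \<in> PL" "\<And>x. real n \<le> \<bar>x\<bar> \<Longrightarrow> f x = x" by blast
  then have "f x = x" if "x \<le> - real n" for x using that n(2)[of x] by linarith
  moreover have "f x = x" if "real n \<le> x" for x using that n(2)[of x] by linarith
  ultimately show "f \<in> compact_PL"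
    unfolding compact_PL_def affine_end_def eventually_at_top_linorder eventually_at_bot_linorder
    using n(1) by auto
qed

lemma conj_cong_on_support:
  fixes f :: "'a \<Rightarrow> 'a" and g h :: "'a \<Rightarrow> 'b"
  assumes "bij f" "bij g" "bij h" and gh: "\<And>x. f x \<noteq> x \<Longrightarrow> g x = h x"
  shows "g \<circ> f \<circ> finv g = h \<circ> f \<circ> finv h"
proof
  fix y
  define x where "x = finv g y"
  have y: "g x = y" unfolding x_def using assms(2) by (simp add: bij_is_surj surj_f_inv_f)
  have hi: "finv h (h z) = z" "h (finv h w) = w" for z w
    using assms(3) by (simp_all add: bij_is_inj bij_is_surj surj_f_inv_f)
  show "(g \<circ> f \<circ> finv g) y = (h \<circ> f \<circ> finv h) y"
  proof (cases "f x = x")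
    case False
    then have "f (f x) \<noteq> f x" using assms(1) bij_is_inj injD by metis
    then have "g (f x) = h (f x)" using gh by blast
    moreover have "finv h y = x" using gh[OF False] y hi(1)[of x] by simp
    ultimately show ?thesis by (simp add: x_def[symmetric])
  next
    case True
    have "f (finv h y) = finv h y"
    proof (rule ccontr)
      assume n: "f (finv h y) \<noteq> finv h y"
      then have "g (finv h y) = g x" using gh hi y by simp
      then have "finv h y = x" using assms(2) bij_is_inj injD by metis
      then show False using n True by simp
    qed
    then show ?thesis using hi y True by (simp add: x_def[symmetric])
  qed
qed

text \<open>On the support of \<open>f\<close> the map \<open>b\<close> agrees with a compactly supported \<open>h\<close>, so that conjugation by \<open>b\<close> and by
\<open>h\<close> have the same effect on \<open>f\<close>.\<close>

lemma compact_PL_central: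
  assumes f: "f \<in> compact_PL" and b: "b \<in> carrier end_group"
  shows "comm end_group b f \<in> derived end_group compact_PL"
proof -
  obtain k c where kc: "affine_end b k c" using b by auto
  obtain n :: nat where n: "f \<in> PL" "\<And>x. real n \<le> \<bar>x\<bar> \<Longrightarrow> f x = x" using f compact_PL_iff by blast
  have bP: "b \<in> PL" using kc affine_end_PL by blast
  obtain m :: nat where "max (real n) (max \<bar>b (- real n)\<bar> \<bar>b (real n)\<bar>) < real m"
    using reals_Archimedean2 by blast
  then have m: "- real n \<le> real n" "- real m < - real n" "- real m < b (- real n)"
    "real n < real m" "b (real n) < real m" by linarith+
  have mZ: "- real n \<in> Z_tau" "real n \<in> Z_tau" "- real m \<in> Z_tau" "real m \<in> Z_tau"
    using Z_tau_of_nat[of n] Z_tau_of_nat[of m] by simp_all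
  obtain h where h: "h \<in> PL" "\<And>x. - real n \<le> x \<Longrightarrow> x \<le> real n \<Longrightarrow> h x = b x"
    "\<And>x. x \<le> - real m \<Longrightarrow> h x = x" "\<And>x. real m \<le> x \<Longrightarrow> h x = x"
    using PL_localize[OF bP mZ m] by blast
  have "h x = x" if "real m \<le> \<bar>x\<bar>" for x using that h(3)[of x] h(4)[of x] by linarith
  then have hc: "h \<in> compact_PL" unfolding compact_PL_iff using h(1) by blast
  have "b \<circ> f \<circ> finv b = h \<circ> f \<circ> finv h"
  proof (rule conj_cong_on_support)
    fix x assume "f x \<noteq> x"
    then have "\<bar>x\<bar> \<le> n" using n(2)[of x] by linarith
    then show "b x = h x" using h(2)[of x] by simp
  qed (use PL_D(4) n(1) bP h(1) in auto)
  then have "comm end_group b f = comm end_group h f"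
    using kc hc end_group_inv unfolding compact_PL_def by simp
  then show ?thesis unfolding derived_def using f hc by (auto intro!: generate.incl)
qed

definition stretch :: "real \<Rightarrow> int \<Rightarrow> real \<Rightarrow> real" where
  "stretch a k = glue a id (\<lambda>x. tau powi k * x + (a - tau powi k * a))"

lemma stretch_le: "x \<le> a \<Longrightarrow> stretch a k x = x"
  and stretch_ge: "a \<le> x \<Longrightarrow> stretch a k x = a + tau powi k * (x - a)"
  unfolding stretch_def glue_def by (auto simp: right_diff_distrib)

lemma affine_end_stretch:
  assumes "a \<in> Z_tau"
  shows "affine_end (stretch a k) k (a - tau powi k * a)"
proof -
  have "a - tau powi k * a \<in> Z_tau" using assms by (intro Z_tau_diff Z_tau_mult Z_tau_powi)
  then have "stretch a k \<in> PL" unfolding stretch_def using assms by (intro PL_glue PL_id PL_affine) auto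
  moreover have "\<forall>\<^sub>F x in at_bot. stretch a k x = x"
    using eventually_le_at_bot[of a] by eventually_elim (rule stretch_le)
  moreover have "\<forall>\<^sub>F x in at_top. stretch a k x = tau powi k * x + (a - tau powi k * a)"
    using eventually_gt_at_top[of a] by eventually_elim (simp add: stretch_def glue_def)
  ultimately show ?thesis unfolding affine_end_def by blast
qed

lemma stretch_comp: "stretch a k \<circ> stretch a l = stretch a (k + l)"
proof
  fix x
  show "(stretch a k \<circ> stretch a l) x = stretch a (k + l) x"
  proof (cases "x \<le> a")
    case False
    then have "a \<le> stretch a l x" using less_imp_le[OF tau_powi_pos, of l] by (simp add: stretch_ge)
    then show ?thesis using False by (simp add: stretch_ge tau_powi_add)
  qed (simp add: stretch_le)
qed

lemma stretch_0: "stretch a 0 = id"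
  unfolding stretch_def glue_def by auto

lemma stretch_pow:
  assumes "a \<in> Z_tau"
  shows "stretch a 1 [^]\<^bsub>end_group\<^esub> (k::int) = stretch a k"
proof -
  have nat: "stretch a 1 [^]\<^bsub>end_group\<^esub> (n::nat) = stretch a (int n)" for n
  proof (induction n)
    case (Suc n)
    then show ?case using stretch_comp[of a "int n" 1] by (simp add: add.commute)
  qed (simp add: stretch_0)
  show ?thesis
  proof (cases k rule: int_cases2)
    case (nonneg n)
    then show ?thesis using nat by (simp add: int_pow_int)
  next
    case (nonpos n)
    have "inv\<^bsub>end_group\<^esub> (stretch a (int n)) = stretch a (- int n)"
      using affine_end_stretch[OF assms] stretch_comp[of a "- int n" "int n"] stretch_0[of a]
      by (intro EG.inv_equality) auto
    moreover have "stretch a 1 \<in> carrier end_group" using affine_end_stretch[OF assms] by auto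
    ultimately show ?thesis using nat[of n] nonpos by (simp add: EG.int_pow_neg int_pow_int)
  qed
qed

text \<open>A translation near \<open>+\<infinity>\<close> that is already a translation on the whole positive half line, so that it moves
the breakpoint \<open>0\<close> together with its germ on the right.\<close>

lemma end_translation_exists:
  assumes "a \<in> Z_tau"
  obtains c where "affine_end c 0 a" "\<And>x. 0 \<le> x \<Longrightarrow> c x = x + a"
proof -
  obtain n :: nat where n: "\<bar>a\<bar> < real n" using reals_Archimedean2 by blast
  then have n': "- real n < 0" "- real n < a" by linarith+
  have nZ: "- real n \<in> Z_tau" using Z_tau_of_nat[of n] by simp
  obtain l where l: "l \<in> PL" "l (- real n) = - real n" "l 0 = a"
    using PL_interpolate[OF nZ Z_tau_0 nZ assms n'] .
  define c where "c = glue 0 (glue (- real n) id l) (\<lambda>x. x + a)"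
  have 1: "glue (- real n) id l \<in> PL" using l nZ by (intro PL_glue PL_id) auto
  have "c \<in> PL" unfolding c_def
    by (rule PL_glue[OF 1 PL_translation[OF assms]]) (use l n in \<open>auto simp: glue_def\<close>)
  moreover have "\<forall>\<^sub>F x in at_bot. c x = x"
    using eventually_le_at_bot[of "- real n"] by eventually_elim (simp add: c_def glue_def)
  moreover have 2: "c x = x + a" if "0 \<le> x" for x
    using that n l by (cases "x = 0") (auto simp: c_def glue_def)
  moreover have "\<forall>\<^sub>F x in at_top. c x = tau powi 0 * x + a"
    using eventually_ge_at_top[of 0] by eventually_elim (simp add: 2)
  ultimately have "affine_end c 0 a" unfolding affine_end_def by blast
  then show thesis by (rule that[OF _ 2])
qed

lemma stretch_conj:
  assumes "a \<in> Z_tau"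
  shows "stretch a 1 \<in> (\<lambda>c. c \<otimes>\<^bsub>end_group\<^esub> stretch 0 1 \<otimes>\<^bsub>end_group\<^esub> inv\<^bsub>end_group\<^esub> c) ` end_translations"
proof -
  obtain c where c: "affine_end c 0 a" "\<And>x. 0 \<le> x \<Longrightarrow> c x = x + a"
    using end_translation_exists[OF assms] by blast
  have cP: "c \<in> PL" using c affine_end_PL by blast
  have "c \<circ> stretch 0 1 = stretch a 1 \<circ> c"
  proof
    fix x
    show "(c \<circ> stretch 0 1) x = (stretch a 1 \<circ> c) x"
    proof (cases "x \<le> 0")
      case True
      then have "c x \<le> a" using PL_le[OF cP, of x 0] c(2)[of 0] by simp
      then show ?thesis using True by (simp add: stretch_le)
    next
      case False
      then show ?thesis using c(2)[of x] c(2)[of "tau * x"] tau_pos by (simp add: stretch_ge)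
    qed
  qed
  then have "c \<circ> stretch 0 1 \<circ> finv c = stretch a 1"
    using PL_comp_inv[OF cP] by (simp add: comp_assoc)
  then have "stretch a 1 = c \<otimes>\<^bsub>end_group\<^esub> stretch 0 1 \<otimes>\<^bsub>end_group\<^esub> inv\<^bsub>end_group\<^esub> c"
    using end_group_inv[OF c(1)] by simp
  moreover have "c \<in> end_translations" using c(1) unfolding end_translations_def by blast
  ultimately show ?thesis by (rule image_eqI)
qed

text \<open>Moving from left to right, every change of slope of \<open>f\<close> is produced by composing with a power of a conjugate of
\<open>stretch 0 1\<close>.  Compactness enters through \<open>Bolzano\<close>, with the property that some product of generators
follows \<open>f\<close> up to a given point.\<close>

lemma end_group_generated:
  "carrier end_group \<subseteq> generate end_group
     ((\<lambda>c. c \<otimes>\<^bsub>end_group\<^esub> stretch 0 1 \<otimes>\<^bsub>end_group\<^esub> inv\<^bsub>end_group\<^esub> c) ` end_translations)"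
proof
  define X where "X = generate end_group
     ((\<lambda>c. c \<otimes>\<^bsub>end_group\<^esub> stretch 0 1 \<otimes>\<^bsub>end_group\<^esub> inv\<^bsub>end_group\<^esub> c) ` end_translations)"
  have tr: "c \<in> carrier end_group" if "c \<in> end_translations" for c
    using that unfolding end_translations_def by auto
  have s0: "stretch 0 1 \<in> carrier end_group" using affine_end_stretch[OF Z_tau_0] by auto
  have sub: "subgroup X end_group"
    unfolding X_def by (rule EG.generate_is_subgroup) (use tr s0 in blast)
  have stX: "stretch a k \<in> X" if a: "a \<in> Z_tau" for a k
  proof -
    have "stretch a 1 \<in> X" unfolding X_def using stretch_conj[OF a] by (rule generate.incl)
    then show ?thesis using EG.subgroup_int_pow_closed[OF sub, of "stretch a 1" k] stretch_pow[OF a] by simp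
  qed
  have XPL: "g \<in> PL" if "g \<in> X" for g
    using subgroup.mem_carrier[OF sub that] affine_end_PL by auto
  fix f assume "f \<in> carrier end_group"
  then obtain k0 c0 where f: "affine_end f k0 c0" by auto
  then have fP: "f \<in> PL" by (rule affine_end_PL)
  obtain u where u: "\<And>x. x \<le> u \<Longrightarrow> f x = x"
    using f unfolding affine_end_def eventually_at_bot_linorder by blast
  obtain v where v: "\<And>x. v \<le> x \<Longrightarrow> f x = tau powi k0 * x + c0"
    using f unfolding affine_end_def eventually_at_top_linorder by blast
  \<comment> \<open>\<open>g\<close> follows \<open>f\<close> up to \<open>x\<close> and then continues along the tangent on the left of \<open>x\<close>\<close>
  define Q where "Q x \<longleftrightarrow> (\<exists>g\<in>X. (\<forall>y\<le>x. g y = f y) \<and> (\<exists>k c d. 0 < d \<and> (\<forall>y\<ge>x - d. g y = tau powi k * y + c)))"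
    for x
  have QI: "Q x" if "g \<in> X" "\<And>y. y \<le> x \<Longrightarrow> g y = f y" "0 < d" "\<And>y. x - d \<le> y \<Longrightarrow> g y = tau powi k * y + c"
    for x g d k c
    unfolding Q_def using that by (intro bexI[of _ g] conjI exI[of _ k] exI[of _ c] exI[of _ d]) auto
  define w where "w = max (v + 1) (u + 1)"
  have "u \<le> w" unfolding w_def by simp
  then have "Q u \<longrightarrow> Q w"
  proof (induction u w rule: Bolzano)
    case (local x)
    obtain k l :: int and e where e: "0 < e"
      "\<And>t. 0 \<le> t \<Longrightarrow> t < e \<Longrightarrow> f (x + t) = f x + tau powi k * t"
      "\<And>t. 0 \<le> t \<Longrightarrow> t < e \<Longrightarrow> f (x - t) = f x - tau powi l * t"
      "k \<noteq> l \<Longrightarrow> x \<in> Z_tau" "x \<in> Z_tau \<longleftrightarrow> f x \<in> Z_tau"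
      using PL_D(5)[OF fP, of x] by (rule tau_linear_atE) blast
    have fl: "f y = f x + tau powi l * (y - x)" if "x - e < y" "y \<le> x" for y
      using e(3)[of "x - y"] that by (simp add: right_diff_distrib)
    have fr: "f y = f x + tau powi k * (y - x)" if "x \<le> y" "y < x + e" for y
      using e(2)[of "y - x"] that by simp
    have "Q a \<longrightarrow> Q b" if ab: "a \<le> x" "x \<le> b" "b - a < e" for a b
    proof
      assume "Q a"
      then obtain g m c d where g: "g \<in> X" "\<And>y. y \<le> a \<Longrightarrow> g y = f y" "0 < d"
        "\<And>y. a - d \<le> y \<Longrightarrow> g y = tau powi m * y + c" unfolding Q_def by blast
      have ae: "x - e < a" using ab by simp
      define s where "s = max (a - d) ((a + (x - e)) / 2)"
      have "x - e < (a + (x - e)) / 2" "(a + (x - e)) / 2 < a" using ae by (simp_all add: field_simps)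
      then have s: "s < a" "a - d \<le> s" "x - e < s"
        using g(3) unfolding s_def by (simp_all add: less_max_iff_disj)
      have "tau powi m * y + c = tau powi l * y + (f x - tau powi l * x)" if "s \<le> y" "y \<le> a" for y
        using g(2)[of y] g(4)[of y] fl[of y] s that ab(1) by (simp add: right_diff_distrib)
      from this[of s] this[of a] have "m = l" "c = f x - tau powi l * x"
        using affine_eq[of m s c l "f x - tau powi l * x" a] s by simp_all
      then have gl: "g y = f x + tau powi l * (y - x)" if "a - d \<le> y" for y
        using g(4)[OF that] by (simp add: right_diff_distrib)
      have gx: "g y = f y" if "y \<le> x" for y
        using g(2)[of y] gl[of y] fl[of y] that g(3) ae by (cases "y \<le> a") auto
      have ga: "g y = tau powi l * y + (f x - tau powi l * x)" if "x - d \<le> y" for y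
        using gl[of y] that ab(1) by (simp add: right_diff_distrib)
      show "Q b"
      proof (cases "b = x")
        case True
        then show ?thesis using QI[OF g(1) gx g(3) ga] by simp
      next
        case False
        then have xb: "x < b" "b < x + e" using ab by auto
        define h where "h = (if k = l then g else g \<circ> stretch x (k - l))"
        have hX: "h \<in> X"
          using g(1) stX[of x "k - l"] e(4) subgroup.m_closed[OF sub, of g "stretch x (k - l)"]
          unfolding h_def by auto
        have h1: "h y = f y" if "y \<le> x" for y using gx[OF that] that by (simp add: h_def stretch_le)
        have h2: "h y = f x + tau powi k * (y - x)" if "x \<le> y" for y
        proof (cases "k = l")
          case True
          then show ?thesis using gl[of y] that ab g(3) by (simp add: h_def)
        next
          case False
          have p: "0 \<le> tau powi (k - l) * (y - x)" using that by (intro mult_nonneg_nonneg) (auto intro: less_imp_le)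
          have "h y = g (x + tau powi (k - l) * (y - x))" using that False by (simp add: h_def stretch_ge)
          also have "\<dots> = f x + tau powi l * (tau powi (k - l) * (y - x))" using gl p ab g(3) by simp
          also have "\<dots> = f x + tau powi k * (y - x)" using tau_powi_add[of l "k - l"] by simp
          finally show ?thesis .
        qed
        have h3: "h y = f y" if "y \<le> b" for y
        proof (cases "y \<le> x")
          case False
          then have "x \<le> y" "y < x + e" using that xb by auto
          then show ?thesis unfolding h2[OF \<open>x \<le> y\<close>] by (rule fr[symmetric])
        qed (rule h1)
        have h4: "h y = tau powi k * y + (f x - tau powi k * x)" if "b - (b - x) \<le> y" for y
          using h2[of y] that by (simp add: right_diff_distrib)
        have "0 < b - x" using xb by simp
        from QI[OF hX h3 this h4] show ?thesis .
      qed
    qed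
    then have "\<forall>a b. a \<le> x \<and> x \<le> b \<and> b - a < e \<longrightarrow> (Q a \<longrightarrow> Q b)" by blast
    then show ?case using e(1) by (rule_tac exI[of _ e]) (rule conjI)
  qed blast
  moreover have "Q u"
  proof -
    have "id \<in> X" using subgroup.one_closed[OF sub] by simp
    then show ?thesis unfolding Q_def using u
      by (intro bexI[of _ id] conjI exI[of _ 0] exI[of _ 1]) auto
  qed
  ultimately obtain g m c d where g: "g \<in> X" "\<And>y. y \<le> w \<Longrightarrow> g y = f y" "0 < d"
        "\<And>y. w - d \<le> y \<Longrightarrow> g y = tau powi m * y + c" unfolding Q_def by blast
  define s where "s = max (w - d) (w - 1)"
  have s: "s < w" "w - d \<le> s" "v \<le> s" "v \<le> w" using g(3) unfolding s_def w_def by auto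
  have "m = k0" "c = c0"
    using affine_eq[of m s c k0 c0 w] g(2)[of s] g(2)[of w] g(4)[of s] g(4)[of w] v[of s] v[of w] s by simp_all
  then have "g y = f y" for y
    using g(2)[of y] g(4)[of y] v[of y] g(3) s by (cases "y \<le> w") auto
  then have "g = f" by blast
  then show "f \<in> generate end_group
     ((\<lambda>c. c \<otimes>\<^bsub>end_group\<^esub> stretch 0 1 \<otimes>\<^bsub>end_group\<^esub> inv\<^bsub>end_group\<^esub> c) ` end_translations)"
    using g(1) unfolding X_def by simp
qed

lemma affine_end_pow:
  assumes "affine_end f 0 c"
  shows "affine_end (f [^]\<^bsub>end_group\<^esub> (i::int)) 0 (of_int i * c)"
proof -
  have nat: "affine_end (f [^]\<^bsub>end_group\<^esub> (n::nat)) 0 (of_nat n * c)" for n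
  proof (induction n)
    case (Suc n)
    then show ?case using affine_end_comp[OF Suc assms] by (simp add: algebra_simps comp_def)
  qed (use affine_end_id in \<open>simp add: id_def\<close>)
  show ?thesis
  proof (cases i rule: int_cases2)
    case (nonneg n)
    then show ?thesis using nat by (simp add: int_pow_int)
  next
    case (nonpos n)
    have "f \<in> carrier end_group" using assms by auto
    then show ?thesis
      using affine_end_inv[OF nat[of n]] end_group_inv[OF nat[of n]] nonpos
      by (simp add: EG.int_pow_neg int_pow_int)
  qed
qed

text \<open>The abstract result on two classes, with \<open>p\<close>, \<open>q\<close> translations by \<open>1\<close>, \<open>\<tau>\<close> near \<open>+\<infinity>\<close> and \<open>t\<close> a stretch by \<open>\<tau>\<close>.
Conjugation by \<open>t\<close> multiplies translation lengths by \<open>\<tau>\<close>, so all hypotheses become identities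
between translation lengths, which hold by \<open>\<tau>\<^sup>2 = 1 - \<tau>\<close>.\<close>

lemma compact_PL_index_le_two:
  assumes x: "x \<in> compact_PL" "x \<notin> derived end_group compact_PL"
    and y: "y \<in> compact_PL" "y \<notin> derived end_group compact_PL"
  shows "x \<circ> finv y \<in> derived end_group compact_PL"
proof -
  obtain p where p: "affine_end p 0 1" using end_translation_exists[OF Z_tau_1] .
  obtain q where q: "affine_end q 0 tau" using end_translation_exists[OF Z_tau_tau] .
  define t where "t = stretch 0 1"
  have t: "affine_end t 1 0" unfolding t_def using affine_end_stretch[OF Z_tau_0, of 1] by simp
  have inv: "inv\<^bsub>end_group\<^esub> f = finv f" if "affine_end f k c" for f k c
    using end_group_inv[OF that] .
  have tconj: "affine_end (t \<circ> m \<circ> finv t) 0 (tau * c)" if "affine_end m 0 c" for m c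
    using affine_end_conj[OF t that] by simp
  have mono: "F \<in> compact_PL" if "affine_end F k c" "k = 0" "c = 0" for F k c
    using that unfolding compact_PL_def by simp
  have "x \<otimes>\<^bsub>end_group\<^esub> inv\<^bsub>end_group\<^esub> y \<in> derived end_group compact_PL"
  proof (rule EG.derived_index_le_two[OF normal_compact_PL normal_end_translations _ _ compact_PL_central,
        where p = p and q = q and t = t])
    show "compact_PL \<subseteq> end_translations" unfolding compact_PL_def end_translations_def by blast
    show "t \<in> carrier end_group" using t by auto
    show "p \<in> end_translations" "q \<in> end_translations" using p q unfolding end_translations_def by blast+
    show "carrier end_group \<subseteq> generate end_group
       ((\<lambda>c. c \<otimes>\<^bsub>end_group\<^esub> t \<otimes>\<^bsub>end_group\<^esub> inv\<^bsub>end_group\<^esub> c) ` end_translations)"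
      unfolding t_def by (rule end_group_generated)
  next
    fix m n assume "m \<in> end_translations" "n \<in> end_translations"
    then obtain c d where m: "affine_end m 0 c" and n: "affine_end n 0 d" unfolding end_translations_def by blast
    have "affine_end (m \<circ> n \<circ> finv m \<circ> finv n) 0 0"
      using affine_end_comp[OF affine_end_comp[OF affine_end_comp[OF m n] affine_end_inv[OF m]] affine_end_inv[OF n]]
      by simp
    then show "comm end_group m n \<in> compact_PL" unfolding compact_PL_def using inv[OF m] inv[OF n] by simp
  next
    fix m assume "m \<in> end_translations"
    then obtain c where m: "affine_end m 0 c" unfolding end_translations_def by blast
    have "affine_end (t \<circ> (t \<circ> m \<circ> finv t) \<circ> finv t \<circ> (t \<circ> m \<circ> finv t) \<circ> finv m) 0 (tau * (tau * c) + tau * c - c)"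
      using affine_end_comp[OF affine_end_comp[OF tconj[OF tconj[OF m]] tconj[OF m]] affine_end_inv[OF m]]
      by (simp add: algebra_simps)
    moreover have "tau * (tau * c) + tau * c - c = 0"
      using arg_cong[OF tau_sq, of "\<lambda>z. z * c"] by (simp add: algebra_simps)
    ultimately show "t \<otimes>\<^bsub>end_group\<^esub> (t \<otimes>\<^bsub>end_group\<^esub> m \<otimes>\<^bsub>end_group\<^esub> inv\<^bsub>end_group\<^esub> t) \<otimes>\<^bsub>end_group\<^esub> inv\<^bsub>end_group\<^esub> t \<otimes>\<^bsub>end_group\<^esub>
      (t \<otimes>\<^bsub>end_group\<^esub> m \<otimes>\<^bsub>end_group\<^esub> inv\<^bsub>end_group\<^esub> t) \<otimes>\<^bsub>end_group\<^esub> inv\<^bsub>end_group\<^esub> m \<in> compact_PL"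
      unfolding compact_PL_def using inv[OF m] inv[OF t] by simp
  next
    fix k :: int assume "t [^]\<^bsub>end_group\<^esub> k \<in> end_translations"
    then obtain c where "affine_end (stretch 0 k) 0 c"
      unfolding t_def stretch_pow[OF Z_tau_0] end_translations_def by blast
    then show "k = 0" using affine_end_unique(1)[OF affine_end_stretch[OF Z_tau_0]] by simp
  next
    show "end_translations \<subseteq> generate end_group (compact_PL \<union> {p, q})"
    proof
      fix m assume "m \<in> end_translations"
      then obtain c where m: "affine_end m 0 c" unfolding end_translations_def by blast
      obtain i j :: int where c: "c = of_int i + of_int j * tau"
        using affine_end_Z_tau[OF m] unfolding Z_tau_iff by auto
      define g where "g = p [^]\<^bsub>end_group\<^esub> i \<circ> q [^]\<^bsub>end_group\<^esub> j"
      have g: "affine_end g 0 c"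
        unfolding g_def c using affine_end_comp[OF affine_end_pow[OF p, of i] affine_end_pow[OF q, of j]]
        by (simp add: add.commute)
      define X where "X = generate end_group (compact_PL \<union> {p, q})"
      have sub: "subgroup X end_group" unfolding X_def
        by (rule EG.generate_is_subgroup) (use p q in \<open>auto simp: compact_PL_def, blast\<close>)
      have "p \<in> X" "q \<in> X" unfolding X_def by (auto intro: generate.incl)
      then have gX: "g \<in> X" unfolding g_def
        using EG.subgroup_int_pow_closed[OF sub] subgroup.m_closed[OF sub] by simp
      have "affine_end (m \<circ> finv g) 0 0" using affine_end_comp[OF m affine_end_inv[OF g]] by simp
      then have "m \<circ> finv g \<in> X" unfolding X_def compact_PL_def by (auto intro: generate.incl)
      then have "m \<circ> finv g \<circ> g \<in> X" using subgroup.m_closed[OF sub _ gX] by simp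
      then show "m \<in> generate end_group (compact_PL \<union> {p, q})"
        unfolding X_def comp_assoc finv_comp_id[OF g] by simp
    qed
  next
    show "inv\<^bsub>end_group\<^esub> q \<otimes>\<^bsub>end_group\<^esub> (t \<otimes>\<^bsub>end_group\<^esub> p \<otimes>\<^bsub>end_group\<^esub> inv\<^bsub>end_group\<^esub> t) \<in> compact_PL"
      using mono[OF affine_end_comp[OF affine_end_inv[OF q] tconj[OF p]]] inv[OF q] inv[OF t] by simp
    have pq: "affine_end (p \<circ> finv q) 0 (1 - tau)" using affine_end_comp[OF p affine_end_inv[OF q]] by simp
    show "inv\<^bsub>end_group\<^esub> (p \<otimes>\<^bsub>end_group\<^esub> inv\<^bsub>end_group\<^esub> q) \<otimes>\<^bsub>end_group\<^esub>
        (t \<otimes>\<^bsub>end_group\<^esub> q \<otimes>\<^bsub>end_group\<^esub> inv\<^bsub>end_group\<^esub> t) \<in> compact_PL"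
      using mono[OF affine_end_comp[OF affine_end_inv[OF pq] tconj[OF q]]] inv[OF q] inv[OF t] inv[OF pq] tau_sq
      by simp
  qed (use x y in auto)
  then show ?thesis using y(1) inv[of y 0 0] unfolding compact_PL_def by simp
qed

section \<open>Compactly supported maps as products of two commutators\<close>

lemma commute_of_disjoint_support:
  assumes "inj f" "inj g" and fixes_one: "\<And>x. f x = x \<or> g x = x"
  shows "f \<circ> g = g \<circ> f"
proof
  fix x
  show "(f \<circ> g) x = (g \<circ> f) x"
  proof (cases "f x = x")
    case True
    have "f (g x) = g x"
    proof (cases "g x = x")
      case False
      then have "g (g x) \<noteq> g x" using assms(2) injD by metis
      then show ?thesis using fixes_one by blast
    qed (use True in simp)
    then show ?thesis using True by simp
  next
    case False
    then have "g x = x" using fixes_one by blast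
    moreover have "f (f x) \<noteq> f x" using False assms(1) injD by metis
    then have "g (f x) = f x" using fixes_one by blast
    ultimately show ?thesis by simp
  qed
qed

lemma compact_PL_subgroup: "subgroup compact_PL end_group"
  using normal_compact_PL by (simp add: normal_def)

lemma compact_PL_inv: "f \<in> compact_PL \<Longrightarrow> inv\<^bsub>end_group\<^esub> f = finv f"
  unfolding compact_PL_def using end_group_inv by blast

lemma compact_PL_PL: "f \<in> compact_PL \<Longrightarrow> f \<in> PL"
  using compact_PL_iff by blast

text \<open>An element of \<open>[F, F]\<close> involves finitely many maps, all supported in some \<open>[-n, n]\<close>.  A compactly supported \<open>h\<close> with
\<open>h (-n) > n\<close> pushes this interval off itself under all positive powers.\<close>

lemma derived_compact_PL_two_commutators:
  assumes x: "x \<in> derived end_group compact_PL"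
  obtains a b c d where "a \<in> compact_PL" "b \<in> compact_PL" "c \<in> compact_PL" "d \<in> compact_PL"
    "x = comm end_group a b \<circ> comm end_group c d"
proof -
  define H where "H n = {f \<in> compact_PL. \<forall>x. real n \<le> \<bar>x\<bar> \<longrightarrow> f x = x}" for n
  have Hmono: "H n \<subseteq> H m" if "n \<le> m" for n m unfolding H_def using that by auto
  have Hc: "H n \<subseteq> compact_PL" for n unfolding H_def by blast
  have car: "compact_PL \<subseteq> carrier end_group" using compact_PL_subgroup subgroup.subset by blast
  have "\<exists>n. x \<in> derived end_group (H n)"
    using x
  proof (induction x rule: EG.derived_induct)
    case subset
    show ?case by (rule car)
  next
    case one
    show ?case unfolding derived_def by (rule exI[of _ 0]) (rule generate.one)
  next
    case (mult a b y)
    obtain i j where "a \<in> H i" "b \<in> H j"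
      using mult(1,2) unfolding H_def compact_PL_iff by auto
    moreover obtain k where "y \<in> derived end_group (H k)" using mult.IH by blast
    moreover define n where "n = max i (max j k)"
    have "i \<le> n" "j \<le> n" "k \<le> n" unfolding n_def by auto
    ultimately have n: "a \<in> H n" "b \<in> H n" "y \<in> derived end_group (H n)"
      using Hmono EG.mono_derived by blast+
    have "comm end_group a b \<in> derived end_group (H n)"
      unfolding derived_def using n(1,2) by (auto intro!: generate.incl)
    moreover have "subgroup (derived end_group (H n)) end_group"
      using EG.derived_is_subgroup Hc car by blast
    ultimately show ?case using n(3) subgroup.m_closed by metis
  qed
  then obtain n where xn: "x \<in> derived end_group (H n)" by blast
  have nZ: "- real n \<in> Z_tau" "real n \<in> Z_tau" "2 * real n + 1 \<in> Z_tau"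
    "- real n - 1 \<in> Z_tau" "real n + 2 \<in> Z_tau"
    using Z_tau_of_int[of "- int n"] Z_tau_of_int[of "int n"] Z_tau_of_int[of "2 * int n + 1"]
      Z_tau_of_int[of "- int n - 1"] Z_tau_of_int[of "int n + 2"] by simp_all
  obtain h where h: "h \<in> PL" "\<And>x. - real n \<le> x \<Longrightarrow> x \<le> - real n \<Longrightarrow> h x = x + (2 * real n + 1)"
    "\<And>x. x \<le> - real n - 1 \<Longrightarrow> h x = x" "\<And>x. real n + 2 \<le> x \<Longrightarrow> h x = x"
    by (rule PL_localize[OF PL_translation[OF nZ(3)] nZ(1) nZ(1) nZ(4) nZ(5)]) auto
  have "h x = x" if "real (n + 2) \<le> \<bar>x\<bar>" for x
  proof -
    have "x \<le> - real n - 1 \<or> real n + 2 \<le> x" using that by (simp, linarith)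
    then show ?thesis using h(3,4) by blast
  qed
  then have hc: "h \<in> compact_PL" unfolding compact_PL_iff using h(1) by blast
  have hn: "real n < h (- real n)" using h(2)[of "- real n"] by simp
  define s where "s = (\<lambda>z. h \<otimes>\<^bsub>end_group\<^esub> z \<otimes>\<^bsub>end_group\<^esub> inv\<^bsub>end_group\<^esub> h)"
  have s: "s z = h \<circ> z \<circ> finv h" for z unfolding s_def using compact_PL_inv[OF hc] by simp
  have sc: "(s ^^ k) b \<in> compact_PL" if "b \<in> compact_PL" for k b
  proof (induction k)
    case (Suc k)
    then show ?case unfolding s_def
      using compact_PL_subgroup hc by (simp add: subgroup.m_closed subgroup.m_inv_closed del: end_group_simps)
  qed (use that in simp)
  have sfix: "s z x = x" if "\<And>x. x \<le> - real n \<Longrightarrow> z x = x" "x \<le> real n" for z x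
  proof -
    have "h (finv h x) \<le> h (- real n)" using that(2) hn h(1) by simp
    then have "finv h x \<le> - real n" using PL_le[OF h(1)] by blast
    then show ?thesis unfolding s using that(1) h(1) by simp
  qed
  have sfix': "(s ^^ Suc k) b x = x" if "b \<in> H n" "x \<le> real n" for b x k
    using that(2)
  proof (induction k arbitrary: x)
    case 0
    then show ?case using sfix[of b x] that(1) unfolding H_def by auto
  next
    case (Suc k)
    show ?case using sfix[of "(s ^^ Suc k) b" x] Suc by auto
  qed
  have disp: "a \<otimes>\<^bsub>end_group\<^esub> (s ^^ Suc k) b = (s ^^ Suc k) b \<otimes>\<^bsub>end_group\<^esub> a" if ab: "a \<in> H n" "b \<in> H n" for k a b
  proof -
    have "a \<circ> (s ^^ Suc k) b = (s ^^ Suc k) b \<circ> a"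
    proof (rule commute_of_disjoint_support)
      show "inj a" "inj ((s ^^ Suc k) b)" using ab Hc sc compact_PL_PL PL_D(3) by blast+
      fix x show "a x = x \<or> (s ^^ Suc k) b x = x"
      proof (cases "x \<le> real n")
        case False
        then have "real n \<le> \<bar>x\<bar>" by simp
        then show ?thesis using ab(1) unfolding H_def by blast
      qed (use sfix'[OF ab(2)] in blast)
    qed
    then show ?thesis by simp
  qed
  show thesis
  proof (rule EG.derived_of_displaced[OF compact_PL_subgroup Hc hc disp[unfolded s_def] xn])
    fix f a b assume "f \<in> compact_PL" "a \<in> compact_PL" "b \<in> compact_PL"
      "x = comm end_group f h \<otimes>\<^bsub>end_group\<^esub> comm end_group a b"
    then show thesis using that hc by (metis end_group_simps(1))
  qed
qed

definition unit_PL :: "(real \<Rightarrow> real) set" where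
  "unit_PL = {f \<in> PL. \<exists>e>0. \<forall>x. x \<le> e \<or> 1 - e \<le> x \<longrightarrow> f x = x}"

text \<open>The commutator of two bijections, without reference to a group that contains them.\<close>

definition pcomm :: "('a \<Rightarrow> 'a) \<Rightarrow> ('a \<Rightarrow> 'a) \<Rightarrow> 'a \<Rightarrow> 'a" where
  "pcomm f g = f \<circ> g \<circ> finv f \<circ> finv g"

lemma finv_unique: "bij f \<Longrightarrow> g \<circ> f = id \<Longrightarrow> finv f = g"
  by (metis bij_is_surj comp_assoc comp_id fun.map_id0 id_comp surj_iff)

lemma unit_PL_PL: "f \<in> unit_PL \<Longrightarrow> f \<in> PL" unfolding unit_PL_def by blast

lemma unit_PL_compact: "unit_PL \<subseteq> compact_PL"
proof
  fix f assume "f \<in> unit_PL"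
  then obtain e where e: "f \<in> PL" "0 < e" "\<And>x. x \<le> e \<or> 1 - e \<le> x \<Longrightarrow> f x = x"
    unfolding unit_PL_def by blast
  have "f x = x" if "real 1 \<le> \<bar>x\<bar>" for x
  proof -
    have "x \<le> e \<or> 1 - e \<le> x" using that e(2) by auto
    then show ?thesis by (rule e(3))
  qed
  then show "f \<in> compact_PL" unfolding compact_PL_iff using e(1) by blast
qed

lemma pcomm_conj:
  assumes "bij t" "bij f" "bij g"
  shows "t \<circ> pcomm f g \<circ> finv t = pcomm (t \<circ> f \<circ> finv t) (t \<circ> g \<circ> finv t)"
proof -
  have tt: "finv t \<circ> t = id" using assms(1) by (simp add: bij_is_inj)
  have inv: "finv (t \<circ> k \<circ> finv t) = t \<circ> finv k \<circ> finv t" if "bij k" for k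
  proof (rule finv_unique)
    show "bij (t \<circ> k \<circ> finv t)" using assms(1) that by (simp add: bij_comp bij_imp_bij_inv)
    show "t \<circ> finv k \<circ> finv t \<circ> (t \<circ> k \<circ> finv t) = id"
      using assms(1) that by (auto simp: fun_eq_iff bij_is_inj bij_is_surj surj_f_inv_f)
  qed
  show ?thesis unfolding pcomm_def inv[OF assms(2)] inv[OF assms(3)]
    using assms(1) by (simp add: fun_eq_iff bij_is_inj)
qed

text \<open>The two commutators live in some \<open>[-n, n]\<close>.  Conjugation by a map that squeezes \<open>[-n, n]\<close> into the unit interval and
is the identity on the support of \<open>x\<close> moves them into the unit interval and preserves their product.\<close>

lemma unit_PL_two_commutators:
  assumes x: "x \<in> unit_PL" "x \<in> derived end_group compact_PL"
  obtains a b c d where "a \<in> unit_PL" "b \<in> unit_PL" "c \<in> unit_PL" "d \<in> unit_PL"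
    "x = pcomm a b \<circ> pcomm c d"
proof -
  obtain a b c d where abcd: "a \<in> compact_PL" "b \<in> compact_PL" "c \<in> compact_PL" "d \<in> compact_PL"
    and xeq: "x = comm end_group a b \<circ> comm end_group c d"
    using derived_compact_PL_two_commutators[OF x(2)] .
  have xeq': "x = pcomm a b \<circ> pcomm c d" unfolding xeq pcomm_def using abcd by (simp add: compact_PL_inv)
  obtain i1 i2 i3 i4 :: nat where i: "\<And>x. real i1 \<le> \<bar>x\<bar> \<Longrightarrow> a x = x" "\<And>x. real i2 \<le> \<bar>x\<bar> \<Longrightarrow> b x = x"
    "\<And>x. real i3 \<le> \<bar>x\<bar> \<Longrightarrow> c x = x" "\<And>x. real i4 \<le> \<bar>x\<bar> \<Longrightarrow> d x = x"
    using abcd unfolding compact_PL_iff by blast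
  define n where "n = 1 + i1 + i2 + i3 + i4"
  obtain e0 where e0: "0 < e0" "\<And>y. y \<le> e0 \<or> 1 - e0 \<le> y \<Longrightarrow> x y = y"
    using x(1) unfolding unit_PL_def by blast
  have "0 < min e0 (1 / 2)" using e0(1) by simp
  then obtain e where e: "e \<in> Z_tau" "0 < e" "e < min e0 (1 / 2)" by (rule Z_tau_dense)
  obtain e1 where e1: "e1 \<in> Z_tau" "0 < e1" "e1 < e" using e(2) by (rule Z_tau_dense)
  have nZ: "- real n \<in> Z_tau" "real n \<in> Z_tau" using Z_tau_of_nat[of n] by simp_all
  have eZ: "1 - e \<in> Z_tau" "1 - e1 \<in> Z_tau" using e e1 by (auto intro: Z_tau_diff)
  have n1: "1 \<le> real n" unfolding n_def by simp
  have lt: "- real n < e" "1 - e < real n" "1 - e < 1 - e1" "e < 1 - e" using n1 e e1 by auto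
  obtain l where l: "l \<in> PL" "l (- real n) = e1" "l e = e"
    using PL_interpolate[OF nZ(1) e(1) e1(1) e(1) lt(1) e1(3)] .
  obtain r where r: "r \<in> PL" "r (1 - e) = 1 - e" "r (real n) = 1 - e1"
    using PL_interpolate[OF eZ(1) nZ(2) eZ(1) eZ(2) lt(2) lt(3)] .
  define t where "t = glue (1 - e) (glue e l id) r"
  have 1: "glue e l id \<in> PL" using l e by (intro PL_glue PL_id) auto
  have tP: "t \<in> PL" unfolding t_def
    by (rule PL_glue[OF 1 r(1) eZ(1)]) (use r lt in \<open>auto simp: glue_def\<close>)
  have t1: "t (- real n) = e1" "t (real n) = 1 - e1"
    using l r lt unfolding t_def glue_def by auto
  have t2: "t y = y" if "e \<le> y" "y \<le> 1 - e" for y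
    using that l unfolding t_def glue_def by auto
  define C where "C f = t \<circ> f \<circ> finv t" for f
  have CK: "C f \<in> unit_PL" if f: "f \<in> compact_PL" "\<And>y. real n \<le> \<bar>y\<bar> \<Longrightarrow> f y = y" for f
  proof -
    have "C f y = y" if y: "y \<le> e1 \<or> 1 - e1 \<le> y" for y
    proof -
      have "finv t y \<le> - real n \<or> real n \<le> finv t y"
        using y PL_le[OF tP, of "finv t y" "- real n"] PL_le[OF tP, of "real n" "finv t y"] t1 tP by simp
      then have "real n \<le> \<bar>finv t y\<bar>" by auto
      then show ?thesis unfolding C_def using f(2) tP by simp
    qed
    moreover have "C f \<in> PL" unfolding C_def using tP f(1) compact_PL_PL by (intro PL_comp PL_inv) auto
    ultimately show ?thesis unfolding unit_PL_def using e1(2) by blast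
  qed
  have "C x = id \<circ> x \<circ> finv id" unfolding C_def
  proof (rule conj_cong_on_support)
    fix y assume "x y \<noteq> y"
    then have "\<not> (y \<le> e0 \<or> 1 - e0 \<le> y)" using e0(2) by blast
    then show "t y = id y" using t2[of y] e(3) by simp
  qed (use tP unit_PL_PL[OF x(1)] PL_D(4) in auto)
  then have "x = C x" by (simp add: finv_unique[of id id])
  moreover have "C x = C (pcomm a b) \<circ> C (pcomm c d)"
    unfolding C_def xeq' using tP by (simp add: fun_eq_iff)
  moreover have "C (pcomm a b) = pcomm (C a) (C b)"
    unfolding C_def by (rule pcomm_conj) (use tP abcd compact_PL_PL PL_D(4) in blast)+
  moreover have "C (pcomm c d) = pcomm (C c) (C d)"
    unfolding C_def by (rule pcomm_conj) (use tP abcd compact_PL_PL PL_D(4) in blast)+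
  ultimately have "x = pcomm (C a) (C b) \<circ> pcomm (C c) (C d)" by simp
  moreover have "C a \<in> unit_PL" "C b \<in> unit_PL" "C c \<in> unit_PL" "C d \<in> unit_PL"
    using i abcd by (intro CK; simp add: n_def)+
  ultimately show thesis using that by blast
qed

section \<open>The golden ratio Thompson group through lifts\<close>

lemma to_circle_rep [simp]: "to_circle (rep_circle p) = p"
  by (rule Quotient3_abs_rep[OF Quotient3_circle])

lemma circle_cases: obtains x where "p = to_circle x"
  using to_circle_rep[of p] by metis

lemma to_circle_add_int [simp]: "to_circle (x + of_int n) = to_circle x"
  "to_circle (x + 1) = to_circle x"
  by (simp_all add: to_circle_eq_iff)

lemma Z_tau_mod_Z_iff [simp]: "to_circle x \<in> Z_tau_mod_Z \<longleftrightarrow> x \<in> Z_tau"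
proof
  assume "to_circle x \<in> Z_tau_mod_Z"
  then obtain z where z: "z \<in> Z_tau" "x - z \<in> \<int>"
    unfolding Z_tau_mod_Z_def to_circle_eq_iff[symmetric] by blast
  then obtain n where "x - z = of_int n" by (auto elim: Ints_cases)
  then have "x = z + of_int n" by simp
  then show "x \<in> Z_tau" using z(1) by simp
qed (auto simp: Z_tau_mod_Z_def)

text \<open>The lifts to the line of the elements of the golden ratio Thompson group, see \<open>carrier_T_tau\<close>.\<close>

definition lifts :: "(real \<Rightarrow> real) set" where
  "lifts = {F \<in> PL. \<forall>x. F (x + 1) = F x + 1}"

definition circ :: "(real \<Rightarrow> real) \<Rightarrow> circle \<Rightarrow> circle" where
  "circ F p = to_circle (F (rep_circle p))"

lemma lifts_PL: "F \<in> lifts \<Longrightarrow> F \<in> PL" unfolding lifts_def by blast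

lemma add_of_int_equivariant:
  fixes F :: "real \<Rightarrow> real"
  assumes "\<And>x. F (x + 1) = F x + 1"
  shows "F (x + of_int n) = F x + of_int n"
proof -
  have nat: "F (x + of_nat m) = F x + of_nat m" for x m
  proof (induction m)
    case (Suc m)
    have "F (x + of_nat m + 1) = F (x + of_nat m) + 1" by (rule assms)
    then show ?case using Suc by (simp add: add.assoc add.commute[of 1])
  qed simp
  show ?thesis
  proof (cases n rule: int_cases2)
    case (nonneg m) then show ?thesis using nat by simp
  next
    case (nonpos m) then show ?thesis using nat[of "x - of_nat m" m] by simp
  qed
qed

lemma lift_add_int: "F \<in> lifts \<Longrightarrow> F (x + of_int n) = F x + of_int n"
  unfolding lifts_def by (simp add: add_of_int_equivariant)

lemma circ_to_circle: "F \<in> lifts \<Longrightarrow> circ F (to_circle x) = to_circle (F x)"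
proof -
  assume F: "F \<in> lifts"
  have "rep_circle (to_circle x) - x \<in> \<int>" using to_circle_eq_iff to_circle_rep by blast
  then obtain n where "rep_circle (to_circle x) - x = of_int n" by (auto elim: Ints_cases)
  then have "rep_circle (to_circle x) = x + of_int n" by simp
  then show ?thesis unfolding circ_def using lift_add_int[OF F] by simp
qed

lemma circ_eqI:
  assumes "F \<in> lifts" "\<And>x. g (to_circle x) = to_circle (F x)"
  shows "g = circ F"
proof
  fix p obtain x where "p = to_circle x" by (rule circle_cases)
  then show "g p = circ F p" using assms circ_to_circle by simp
qed

lemma lifts_comp: "F \<in> lifts \<Longrightarrow> G \<in> lifts \<Longrightarrow> F \<circ> G \<in> lifts"
  unfolding lifts_def using PL_comp by simp

lemma lifts_inv: "F \<in> lifts \<Longrightarrow> finv F \<in> lifts"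
  unfolding lifts_def using PL_inv by (simp add: PL_inv_eq_iff)

lemma lifts_id: "id \<in> lifts" unfolding lifts_def by simp

lemma lifts_translation: "c \<in> Z_tau \<Longrightarrow> (\<lambda>x. x + c) \<in> lifts"
  unfolding lifts_def using PL_translation by simp

lemma circ_comp: "F \<in> lifts \<Longrightarrow> G \<in> lifts \<Longrightarrow> circ (F \<circ> G) = circ F \<circ> circ G"
  by (rule circ_eqI[symmetric]) (simp_all add: lifts_comp circ_to_circle)

lemma circ_id: "circ id = id"
  by (rule circ_eqI[symmetric]) (simp_all add: lifts_id)

lemma circ_inv:
  assumes "F \<in> lifts"
  shows "circ F \<circ> circ (finv F) = id" "circ (finv F) \<circ> circ F = id"
  using assms circ_comp[of F "finv F"] circ_comp[of "finv F" F] lifts_inv circ_id lifts_PL by simp_all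

lemma int_valued_constant:
  fixes f :: "real \<Rightarrow> real"
  assumes "connected S" "continuous_on S f" "\<And>x. x \<in> S \<Longrightarrow> f x \<in> \<int>" "a \<in> S" "b \<in> S"
  shows "f a = f b"
proof -
  have "f constant_on S"
  proof (rule continuous_discrete_range_constant[OF assms(1,2)])
    fix x assume x: "x \<in> S"
    show "\<exists>e>0. \<forall>y. y \<in> S \<and> f y \<noteq> f x \<longrightarrow> e \<le> norm (f y - f x)"
    proof (intro exI[of _ 1] conjI allI impI)
      fix y assume y: "y \<in> S \<and> f y \<noteq> f x"
      show "1 \<le> norm (f y - f x)"
        using Ints_nonzero_abs_less1[of "f y - f x"] assms(3) x y by (auto simp: Ints_diff not_less[symmetric])
    qed simp
  qed
  then show ?thesis using assms(4,5) unfolding constant_on_def by auto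
qed

lemma circ_continuous:
  assumes F: "F \<in> lifts"
  shows "continuous_on UNIV (circ F)"
proof -
  have "open (circ F -` B)" if "open B" for B
  proof -
    have "to_circle -` (circ F -` B) = F -` (to_circle -` B)"
      using circ_to_circle[OF F] by auto
    moreover have "open (F -` (to_circle -` B))"
      using that PL_continuous[OF lifts_PL[OF F]] open_vimage unfolding open_circle_def by blast
    ultimately show ?thesis unfolding open_circle_def by simp
  qed
  then show ?thesis by (simp add: continuous_on_open_vimage)
qed

lemma nearby_linear:
  assumes f: "f \<in> PL"
  obtains e where "0 < e" "\<And>y. 0 < \<bar>y - x\<bar> \<Longrightarrow> \<bar>y - x\<bar> < e \<Longrightarrow>
    \<exists>k::int. \<exists>d>0. \<forall>t. \<bar>t\<bar> < d \<longrightarrow> f (y + t) = f y + tau powi k * t"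
proof -
  obtain k l :: int and e where e: "0 < e"
    "\<And>t. 0 \<le> t \<Longrightarrow> t < e \<Longrightarrow> f (x + t) = f x + tau powi k * t"
    "\<And>t. 0 \<le> t \<Longrightarrow> t < e \<Longrightarrow> f (x - t) = f x - tau powi l * t"
    using PL_D(5)[OF f, of x] by (rule tau_linear_atE) blast
  have "\<exists>k::int. \<exists>d>0. \<forall>t. \<bar>t\<bar> < d \<longrightarrow> f (y + t) = f y + tau powi k * t"
    if y: "0 < \<bar>y - x\<bar>" "\<bar>y - x\<bar> < e" for y
  proof (cases "x < y")
    case True
    have r: "f z = f x + tau powi k * (z - x)" if "x \<le> z" "z < x + e" for z using e(2)[of "z - x"] that by simp
    have "f (y + t) = f y + tau powi k * t" if "\<bar>t\<bar> < min (y - x) (x + e - y)" for t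
    proof -
      have b: "x \<le> y + t" "y + t < x + e" "x \<le> y" "y < x + e" using that True y by (auto simp: abs_less_iff)
      show ?thesis using r[OF b(1,2)] r[OF b(3,4)] by (simp add: algebra_simps)
    qed
    moreover have "0 < min (y - x) (x + e - y)" using True y by simp
    ultimately show ?thesis by blast
  next
    case False
    have r: "f z = f x - tau powi l * (x - z)" if "z \<le> x" "x - e < z" for z using e(3)[of "x - z"] that by simp
    have "f (y + t) = f y + tau powi l * t" if "\<bar>t\<bar> < min (x - y) (y - (x - e))" for t
    proof -
      have b: "y + t \<le> x" "x - e < y + t" "y \<le> x" "x - e < y" using that False y by (auto simp: abs_less_iff)
      show ?thesis using r[OF b(1,2)] r[OF b(3,4)] by (simp add: algebra_simps)
    qed
    moreover have "0 < min (x - y) (y - (x - e))" using False y by auto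
    ultimately show ?thesis by blast
  qed
  then show thesis using that e(1) by blast
qed

lemma has_slope_circ:
  assumes F: "F \<in> lifts" and d: "0 < d" "\<And>t. \<bar>t\<bar> < d \<Longrightarrow> F (x + t) = F x + s * t"
  shows "has_slope (circ F) s (to_circle x)"
  unfolding has_slope_def
  by (rule exI[of _ x], rule exI[of _ "F x"]) (use d circ_to_circle[OF F] in auto)

text \<open>Breakpoints are isolated, so on a compact fundamental domain there are finitely many.\<close>

lemma breakpoints_circ:
  assumes F: "F \<in> lifts"
  shows "breakpoints (circ F) \<subseteq> Z_tau_mod_Z" "finite (breakpoints (circ F))"
proof -
  have FP: "F \<in> PL" using F lifts_PL by blast
  show "breakpoints (circ F) \<subseteq> Z_tau_mod_Z"
  proof
    fix p assume p: "p \<in> breakpoints (circ F)"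
    obtain x where x: "p = to_circle x" by (rule circle_cases)
    show "p \<in> Z_tau_mod_Z"
    proof (rule ccontr)
      assume "p \<notin> Z_tau_mod_Z"
      then have xZ: "x \<notin> Z_tau" unfolding x by simp
      obtain k l :: int and e where e: "0 < e"
        "\<And>t. 0 \<le> t \<Longrightarrow> t < e \<Longrightarrow> F (x + t) = F x + tau powi k * t"
        "\<And>t. 0 \<le> t \<Longrightarrow> t < e \<Longrightarrow> F (x - t) = F x - tau powi l * t"
        "k \<noteq> l \<Longrightarrow> x \<in> Z_tau"
        using PL_D(5)[OF FP, of x] by (rule tau_linear_atE) blast
      have kl: "k = l" using e(4) xZ by blast
      have "F (x + t) = F x + tau powi k * t" if "\<bar>t\<bar> < e" for t
        using e(2)[of t] e(3)[of "-t"] that kl by (cases "0 \<le> t") auto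
      from has_slope_circ[OF F e(1) this] show False using p unfolding breakpoints_def x by blast
    qed
  qed
  define S where "S = {x \<in> {0..1}. to_circle x \<in> breakpoints (circ F)}"
  have "finite S"
  proof (rule ccontr)
    assume "infinite S"
    then obtain x where x: "x islimpt S"
      using compact_eq_Bolzano_Weierstrass[of "{0..1::real}"] compact_Icc unfolding S_def by blast
    obtain e where e: "0 < e" "\<And>y. 0 < \<bar>y - x\<bar> \<Longrightarrow> \<bar>y - x\<bar> < e \<Longrightarrow>
      \<exists>k::int. \<exists>d>0. \<forall>t. \<bar>t\<bar> < d \<longrightarrow> F (y + t) = F y + tau powi k * t"
      using nearby_linear[OF FP] by blast
    obtain y where y: "y \<in> S" "y \<noteq> x" "dist y x < e" using x e(1) unfolding islimpt_approachable by blast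
    have "0 < \<bar>y - x\<bar>" "\<bar>y - x\<bar> < e" using y by (auto simp: dist_real_def)
    from e(2)[OF this] obtain k :: int and d where "0 < d" "\<And>t. \<bar>t\<bar> < d \<Longrightarrow> F (y + t) = F y + tau powi k * t"
      by blast
    from has_slope_circ[OF F this] show False using y(1) unfolding S_def breakpoints_def by blast
  qed
  moreover have "breakpoints (circ F) \<subseteq> to_circle ` S"
  proof
    fix p assume p: "p \<in> breakpoints (circ F)"
    obtain x where x: "p = to_circle x" by (rule circle_cases)
    have "to_circle (frac x) = p" unfolding x to_circle_eq_iff frac_def by simp
    moreover have "0 \<le> frac x" "frac x \<le> 1" using frac_lt_1[of x] by (auto intro: less_imp_le)
    ultimately show "p \<in> to_circle ` S" using p unfolding S_def by force
  qed
  ultimately show "finite (breakpoints (circ F))" using finite_surj by blast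
qed

text \<open>The slope on the circle agrees with the right slope of the lift: their difference times a small \<open>t\<close> is an
integer of absolute value less than \<open>1\<close>.\<close>

lemma slopes_circ:
  assumes F: "F \<in> lifts" and s: "has_slope (circ F) s p"
  shows "\<exists>k::int. s = tau powi k"
proof -
  obtain x y e where e: "p = to_circle x" "0 < e"
    "\<And>t. \<bar>t\<bar> < e \<Longrightarrow> circ F (to_circle (x + t)) = to_circle (y + s * t)"
    using s unfolding has_slope_def by blast
  obtain k l :: int and d where d: "0 < d"
    "\<And>t. 0 \<le> t \<Longrightarrow> t < d \<Longrightarrow> F (x + t) = F x + tau powi k * t"
    using PL_D(5)[OF lifts_PL[OF F], of x] by (rule tau_linear_atE) blast
  define t where "t = min (min e d / 2) (1 / (2 * (\<bar>tau powi k - s\<bar> + 1)))"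
  have "0 < 1 / (2 * (\<bar>tau powi k - s\<bar> + 1))" by (simp add: add_nonneg_pos)
  then have "0 < t" using e(2) d(1) unfolding t_def by simp
  moreover have "t \<le> min e d / 2" unfolding t_def by (rule min.cobounded1)
  ultimately have t: "0 < t" "t < e" "t < d" "\<bar>t\<bar> < e" by auto
  have int: "F x + tau powi k * u - (y + s * u) \<in> \<int>" if "0 \<le> u" "u < e" "u < d" for u
    using e(3)[of u] d(2)[of u] that unfolding circ_to_circle[OF F] to_circle_eq_iff by simp
  have "(tau powi k - s) * t \<in> \<int>"
    using Ints_diff[OF int[of t] int[of 0]] t e(2) d(1) by (simp add: algebra_simps)
  moreover have "\<bar>(tau powi k - s) * t\<bar> < 1"
  proof -
    have "\<bar>tau powi k - s\<bar> * t \<le> \<bar>tau powi k - s\<bar> * (1 / (2 * (\<bar>tau powi k - s\<bar> + 1)))"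
      by (rule mult_left_mono) (auto simp: t_def)
    also have "\<dots> < 1"
    proof -
      have "A * (1 / (2 * (A + 1))) < 1" if "0 \<le> A" for A :: real
        using that by (simp add: divide_less_eq)
      from this[OF abs_ge_zero] show ?thesis .
    qed
    finally show ?thesis using t by (simp add: abs_mult)
  qed
  ultimately have "(tau powi k - s) * t = 0" by (rule Ints_nonzero_abs_less1)
  then show ?thesis using t(1) by auto
qed

lemma circ_in_T_tau:
  assumes F: "F \<in> lifts"
  shows "circ F \<in> carrier T_tau"
proof -
  have FP: "F \<in> PL" using F lifts_PL by blast
  note inv = circ_inv[OF F, unfolded fun_eq_iff comp_apply id_apply, rule_format]
  have "homeomorphism UNIV UNIV (circ F) (circ (finv F))"
    unfolding homeomorphism_def
    using circ_continuous[OF F] circ_continuous[OF lifts_inv[OF F]] inv surjI[of "circ F", OF inv(1)]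
      surjI[of "circ (finv F)", OF inv(2)] by blast
  then have "homeo (circ F)" unfolding homeo_def by blast
  moreover have "orientation_preserving (circ F)"
    unfolding orientation_preserving_def lift_of_def
    using PL_continuous[OF FP] circ_to_circle[OF F] PL_D(1)[OF FP] by metis
  moreover have "circ F ` Z_tau_mod_Z = Z_tau_mod_Z"
  proof
    show "circ F ` Z_tau_mod_Z \<subseteq> Z_tau_mod_Z"
      using circ_to_circle[OF F] PL_D(6)[OF FP] unfolding Z_tau_mod_Z_def by auto
    show "Z_tau_mod_Z \<subseteq> circ F ` Z_tau_mod_Z"
    proof
      fix p assume "p \<in> Z_tau_mod_Z"
      then obtain z where z: "p = to_circle z" "z \<in> Z_tau" unfolding Z_tau_mod_Z_def by blast
      have "finv F z \<in> Z_tau" using PL_D(6)[OF FP, of "finv F z"] z(2) FP by simp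
      moreover have "circ F (to_circle (finv F z)) = p" using circ_to_circle[OF F] z FP by simp
      ultimately show "p \<in> circ F ` Z_tau_mod_Z" by (metis Z_tau_mod_Z_iff image_eqI)
    qed
  qed
  ultimately show ?thesis
    using breakpoints_circ[OF F] slopes_circ[OF F] unfolding T_tau_def piecewise_linear_def by simp
qed

text \<open>The derivative is locally constant on the open interval, hence constant; continuity includes the end points.\<close>

lemma locally_affine_imp_affine:
  fixes f :: "real \<Rightarrow> real"
  assumes ab: "a < b" and cont: "continuous_on UNIV f"
    and loc: "\<And>y. a < y \<Longrightarrow> y < b \<Longrightarrow> \<exists>k::int. \<exists>d>0. \<forall>t. \<bar>t\<bar> < d \<longrightarrow> f (y + t) = f y + tau powi k * t"
  shows "\<exists>k::int. \<forall>y\<in>{a..b}. \<forall>z\<in>{a..b}. f z - f y = tau powi k * (z - y)"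
proof -
  have der: "\<exists>k::int. \<exists>d>0. \<forall>z. \<bar>z - y\<bar> < d \<longrightarrow> (f has_real_derivative tau powi k) (at z)"
    if y: "a < y" "y < b" for y
  proof -
    obtain k :: int and d where d: "0 < d" "\<And>t. \<bar>t\<bar> < d \<Longrightarrow> f (y + t) = f y + tau powi k * t"
      using loc[OF y] by blast
    have "(f has_real_derivative tau powi k) (at z)" if "\<bar>z - y\<bar> < d" for z
    proof (rule has_field_derivative_transform_within_open
        [where f = "\<lambda>z. f y + tau powi k * (z - y)" and S = "{y - d<..<y + d}"])
      show "((\<lambda>z. f y + tau powi k * (z - y)) has_real_derivative tau powi k) (at z)"
        by (auto intro!: derivative_eq_intros)
      show "z \<in> {y - d<..<y + d}" using that by (auto simp: abs_less_iff)
      fix w assume "w \<in> {y - d<..<y + d}"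
      then have "\<bar>w - y\<bar> < d" by (auto simp: abs_less_iff)
      from d(2)[OF this] show "f y + tau powi k * (w - y) = f w" by simp
    qed simp
    then show ?thesis using d(1) by blast
  qed
  define m where "m = (a + b) / 2"
  have m: "a < m" "m < b" using ab unfolding m_def by (simp_all add: field_simps)
  obtain k :: int where k: "(f has_real_derivative tau powi k) (at m)"
    using der[OF m] by (metis abs_zero diff_self)
  have const: "deriv f y = deriv f m" if "a < y" "y < b" for y
  proof (rule connected_local_const[where f = "deriv f" and A = "{a<..<b}"])
    show "\<forall>y\<in>{a<..<b}. eventually (\<lambda>z. deriv f y = deriv f z) (at y within {a<..<b})"
    proof
      fix y assume "y \<in> {a<..<b}"
      then obtain l :: int and d where d: "0 < d" "\<And>z. \<bar>z - y\<bar> < d \<Longrightarrow> (f has_real_derivative tau powi l) (at z)"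
        using der[of y] by auto
      have "deriv f y = deriv f z" if "\<bar>z - y\<bar> < d" for z
        using DERIV_imp_deriv[OF d(2)[OF that]] DERIV_imp_deriv[OF d(2)[of y]] d(1) by simp
      then show "eventually (\<lambda>z. deriv f y = deriv f z) (at y within {a<..<b})"
        unfolding eventually_at using d(1) by (intro exI[of _ d]) (auto simp: dist_real_def)
    qed
  qed (use that m in auto)
  have D: "(f has_real_derivative tau powi k) (at y)" if y: "a < y" "y < b" for y
  proof -
    obtain l :: int where l: "(f has_real_derivative tau powi l) (at y)"
      using der[OF y] by (metis abs_zero diff_self)
    then show ?thesis using const[OF y] DERIV_imp_deriv[OF l] DERIV_imp_deriv[OF k] by simp
  qed
  have "f y - tau powi k * y = f a - tau powi k * a" if "a \<le> y" "y \<le> b" for y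
  proof (rule DERIV_isconst2[OF ab, where f = "\<lambda>y. f y - tau powi k * y"])
    show "continuous_on {a..b} (\<lambda>y. f y - tau powi k * y)"
      using continuous_on_subset[OF cont] by (intro continuous_intros) auto
    fix y assume "a < y" "y < b"
    from D[OF this] show "((\<lambda>y. f y - tau powi k * y) has_real_derivative 0) (at y)"
      by (auto intro!: derivative_eq_intros)
  qed (use that in auto)
  then have "f z - f y = tau powi k * (z - y)" if "y \<in> {a..b}" "z \<in> {a..b}" for y z
    using that by (smt (verit) right_diff_distrib atLeastAtMost_iff)
  then show ?thesis by blast
qed

lemma isolated_from_finite_circle_set:
  assumes "finite S"
  shows "\<exists>e>0. \<forall>y. 0 < \<bar>y - x\<bar> \<and> \<bar>y - x\<bar> < e \<longrightarrow> to_circle y \<notin> S"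
  using assms
proof (induction S)
  case empty
  then show ?case by (auto intro: exI[of _ 1])
next
  case (insert p S)
  then obtain e where e: "0 < e" "\<And>y. 0 < \<bar>y - x\<bar> \<Longrightarrow> \<bar>y - x\<bar> < e \<Longrightarrow> to_circle y \<notin> S" by blast
  have "\<exists>d>0. \<forall>y. 0 < \<bar>y - x\<bar> \<and> \<bar>y - x\<bar> < d \<longrightarrow> to_circle y \<noteq> p"
  proof (cases "\<exists>z. 0 < \<bar>z - x\<bar> \<and> \<bar>z - x\<bar> < 1 / 2 \<and> to_circle z = p")
    case True
    then obtain z where z: "0 < \<bar>z - x\<bar>" "\<bar>z - x\<bar> < 1 / 2" "to_circle z = p" by blast
    have "to_circle y \<noteq> p" if y: "\<bar>y - x\<bar> < \<bar>z - x\<bar>" for y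
    proof
      assume "to_circle y = p"
      then have "to_circle y = to_circle z" by (simp only: z(3))
      then have "y - z \<in> \<int>" by (simp only: to_circle_eq_iff)
      moreover have "\<bar>y - z\<bar> < 1" using z(2) y by linarith
      ultimately have "y - z = 0" by (rule Ints_nonzero_abs_less1)
      then show False using y by simp
    qed
    then show ?thesis using z(1) by blast
  next
    case False
    then show ?thesis by (intro exI[of _ "1/2"]) auto
  qed
  then obtain d where d: "0 < d" "\<And>y. 0 < \<bar>y - x\<bar> \<Longrightarrow> \<bar>y - x\<bar> < d \<Longrightarrow> to_circle y \<noteq> p" by blast
  show ?case by (rule exI[of _ "min d e"]) (use d e in auto)
qed

text \<open>The given monotone lift satisfies \<open>f (x + 1) = f x + n\<close>, and injectivity of \<open>g\<close> forces \<open>n = 1\<close>.  Between consecutive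
breakpoints \<open>f\<close> is locally affine, hence affine.\<close>

lemma T_tau_lift:
  assumes g: "g \<in> carrier T_tau"
  obtains F where "F \<in> lifts" "g = circ F"
proof -
  have T: "homeo g" "orientation_preserving g" "finite (breakpoints g)" "breakpoints g \<subseteq> Z_tau_mod_Z"
    "\<And>p s. has_slope g s p \<Longrightarrow> \<exists>k::int. s = tau powi k" "g ` Z_tau_mod_Z = Z_tau_mod_Z"
    using g unfolding T_tau_def piecewise_linear_def by auto
  obtain f where f: "continuous_on UNIV f" "\<And>x. to_circle (f x) = g (to_circle x)" "strict_mono f"
    using T(2) unfolding orientation_preserving_def lift_of_def by blast
  have ginj: "p = q" if "g p = g q" for p q
    using T(1) that unfolding homeo_def homeomorphism_def by (metis UNIV_I)
  have finj: "x - y \<in> \<int>" if "f x - f y \<in> \<int>" for x y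
  proof -
    have "g (to_circle x) = g (to_circle y)" using that f(2)[symmetric] to_circle_eq_iff by simp
    then show ?thesis using ginj to_circle_eq_iff by blast
  qed
  have fint: "f x - f y \<in> \<int>" if "x - y \<in> \<int>" for x y
    using that f(2)[of x] f(2)[of y] to_circle_eq_iff by metis
  \<comment> \<open>The degree of \<open>f\<close> is one because \<open>g\<close> is injective.\<close>
  have "f 1 - f 0 \<in> \<int>" by (rule fint) simp
  then obtain n where n: "f 1 - f 0 = of_int n" by (auto elim: Ints_cases)
  have "f 0 < f 1" using f(3) by (simp add: strict_mono_less)
  then have "0 < n" using n by simp
  have "n = 1"
  proof (rule ccontr)
    assume "n \<noteq> 1"
    then have "2 \<le> n" using \<open>0 < n\<close> by linarith
    then have n2: "(2::real) \<le> of_int n" by linarith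
    then have "\<exists>x\<ge>0. x \<le> 1 \<and> f x = f 0 + 1"
      using n n2 by (intro IVT') (auto intro: continuous_on_subset[OF f(1)])
    then obtain x where x: "0 \<le> x" "x \<le> 1" "f x = f 0 + 1" by blast
    then have "x - 0 \<in> \<int>" using finj[of x 0] by simp
    then obtain i where i: "x = of_int i" by (auto elim: Ints_cases)
    then have "i = 0 \<or> i = 1" using x(1,2) by auto
    then show False using x(3) n i n2 by auto
  qed
  have per: "f (x + 1) = f x + 1" for x
  proof -
    have "f (x + 1) - f x = f (0 + 1) - f 0"
    proof (rule int_valued_constant[where S = UNIV and f = "\<lambda>x. f (x + 1) - f x"])
      show "continuous_on UNIV (\<lambda>x. f (x + 1) - f x)"
        by (intro continuous_intros continuous_on_compose2[OF f(1)]) auto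
    qed (use fint in auto)
    then show ?thesis using n \<open>n = 1\<close> by simp
  qed
  have lin: "\<exists>k::int. \<exists>d>0. \<forall>t. \<bar>t\<bar> < d \<longrightarrow> f (x + t) = f x + tau powi k * t"
    if x: "to_circle x \<notin> breakpoints g" for x
  proof -
    obtain s where s: "has_slope g s (to_circle x)" using x unfolding breakpoints_def by blast
    then obtain x' y e where e: "to_circle x = to_circle x'" "0 < e"
      "\<And>t. \<bar>t\<bar> < e \<Longrightarrow> g (to_circle (x' + t)) = to_circle (y + s * t)"
      unfolding has_slope_def by blast
    obtain k :: int where k: "s = tau powi k" using T(5)[OF s] by blast
    have "f (x + t) - (y + s * t) \<in> \<int>" if "\<bar>t\<bar> < e" for t
    proof -
      have "to_circle (x + t) = to_circle (x' + t)" using e(1) by (simp add: to_circle_eq_iff)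
      then have "to_circle (f (x + t)) = to_circle (y + s * t)" using e(3)[OF that] f(2) by simp
      then show ?thesis by (simp add: to_circle_eq_iff)
    qed
    then have "f (x + t) - (y + s * t) = f (x + 0) - (y + s * 0)" if "\<bar>t\<bar> < e" for t
    proof (intro int_valued_constant[where S = "{-e<..<e}" and f = "\<lambda>t. f (x + t) - (y + s * t)"])
      show "continuous_on {-e<..<e} (\<lambda>t. f (x + t) - (y + s * t))"
        by (intro continuous_intros continuous_on_compose2[OF f(1)]) auto
    qed (use that e(2) in auto)
    then have "f (x + t) = f x + tau powi k * t" if "\<bar>t\<bar> < e" for t using that k by fastforce
    then show ?thesis using e(2) by blast
  qed
  have Z: "x \<in> Z_tau \<longleftrightarrow> f x \<in> Z_tau" for x
  proof -
    have "to_circle x \<in> Z_tau_mod_Z \<longleftrightarrow> g (to_circle x) \<in> Z_tau_mod_Z"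
      using T(6) ginj by (metis image_iff)
    then show ?thesis using f(2)[of x] by (metis Z_tau_mod_Z_iff)
  qed
  have "tau_linear_at f x" for x
  proof (cases "to_circle x \<in> breakpoints g")
    case False
    then obtain k :: int and d where d: "0 < d" "\<And>t. \<bar>t\<bar> < d \<Longrightarrow> f (x + t) = f x + tau powi k * t"
      using lin by blast
    show ?thesis
    proof (rule tau_linear_atI[of d f x k k])
      fix t :: real assume t: "0 \<le> t" "t < d"
      show "f (x + t) = f x + tau powi k * t" using d(2)[of t] t by simp
      show "f (x - t) = f x - tau powi k * t" using d(2)[of "- t"] t by simp
    qed (use d(1) Z[of x] in auto)
  next
    case True
    then have "x \<in> Z_tau" using T(4) Z_tau_mod_Z_iff by blast
    obtain e where e: "0 < e" "\<And>y. 0 < \<bar>y - x\<bar> \<Longrightarrow> \<bar>y - x\<bar> < e \<Longrightarrow> to_circle y \<notin> breakpoints g"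
      using isolated_from_finite_circle_set[OF T(3), of x] by blast
    have right: "\<exists>k::int. \<exists>d>0. \<forall>t. \<bar>t\<bar> < d \<longrightarrow> f (y + t) = f y + tau powi k * t" if "x < y" "y < x + e" for y
      using lin e(2)[of y] that by auto
    have left: "\<exists>k::int. \<exists>d>0. \<forall>t. \<bar>t\<bar> < d \<longrightarrow> f (y + t) = f y + tau powi k * t" if "x - e < y" "y < x" for y
      using lin e(2)[of y] that by auto
    have xe: "x < x + e" "x - e < x" using e(1) by auto
    obtain k :: int where k: "\<forall>y\<in>{x..x + e}. \<forall>z\<in>{x..x + e}. f z - f y = tau powi k * (z - y)"
      using locally_affine_imp_affine[OF xe(1) f(1) right] by blast
    obtain l :: int where l: "\<forall>y\<in>{x - e..x}. \<forall>z\<in>{x - e..x}. f z - f y = tau powi l * (z - y)"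
      using locally_affine_imp_affine[OF xe(2) f(1) left] by blast
    show ?thesis
    proof (rule tau_linear_atI[of e f x k l])
      fix t :: real assume t: "0 \<le> t" "t < e"
      show "f (x + t) = f x + tau powi k * t" using k[rule_format, of x "x + t"] t e(1) by simp
      show "f (x - t) = f x - tau powi l * t" using l[rule_format, of x "x - t"] t e(1) by simp
    qed (use e(1) \<open>x \<in> Z_tau\<close> Z[of x] in auto)
  qed
  moreover have "surj f"
  proof -
    note pint = add_of_int_equivariant[of f, OF per]
    have "\<exists>x. f x = y" for y
    proof -
      define n where "n = \<lfloor>y - f 0\<rfloor>"
      have fl: "of_int n \<le> y - f 0" "y - f 0 \<le> of_int n + 1"
        unfolding n_def by (rule of_int_floor_le, rule real_of_int_floor_add_one_ge)
      have "f (of_int n) \<le> y" "y \<le> f (of_int n + 1)"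
        using pint[of 0 n] per[of "of_int n"] fl by simp_all
      then have "\<exists>x\<ge>of_int n. x \<le> of_int n + 1 \<and> f x = y"
        by (intro IVT') (auto intro: continuous_on_subset[OF f(1)])
      then show ?thesis by blast
    qed
    then show ?thesis by (metis surj_def)
  qed
  ultimately have "f \<in> lifts" unfolding lifts_def PL_def using f(3) per by blast
  then show thesis using that circ_eqI f(2) by metis
qed

lemma T_tau_simps [simp]: "mult T_tau = (\<circ>)" "one T_tau = id"
  unfolding T_tau_def by auto

lemma carrier_T_tau: "carrier T_tau = circ ` lifts"
  using circ_in_T_tau T_tau_lift by blast

lemma group_T_tau: "group T_tau"
proof (rule groupI)
  fix f g assume "f \<in> carrier T_tau" "g \<in> carrier T_tau"
  then show "f \<otimes>\<^bsub>T_tau\<^esub> g \<in> carrier T_tau"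
    unfolding carrier_T_tau using circ_comp lifts_comp by (metis (no_types, lifting) T_tau_simps(1) image_iff)
next
  fix f assume "f \<in> carrier T_tau"
  then obtain F where F: "F \<in> lifts" "f = circ F" by (rule T_tau_lift)
  then show "\<exists>g\<in>carrier T_tau. g \<otimes>\<^bsub>T_tau\<^esub> f = \<one>\<^bsub>T_tau\<^esub>"
    unfolding carrier_T_tau using circ_inv(2)[OF F(1)] lifts_inv[OF F(1)]
    by (intro bexI[of _ "circ (finv F)"]) auto
next
  show "\<one>\<^bsub>T_tau\<^esub> \<in> carrier T_tau" unfolding carrier_T_tau using circ_id lifts_id by force
qed (auto simp: comp_assoc)

interpretation TG: group T_tau by (rule group_T_tau)

lemma T_tau_inv_circ: "F \<in> lifts \<Longrightarrow> inv\<^bsub>T_tau\<^esub> (circ F) = circ (finv F)"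
  using circ_inv(2)[of F] lifts_inv[of F] carrier_T_tau by (intro TG.inv_equality) auto

lemma T_tau_inv_apply: "f \<in> carrier T_tau \<Longrightarrow> (inv\<^bsub>T_tau\<^esub> f) (f p) = p"
  "f \<in> carrier T_tau \<Longrightarrow> f ((inv\<^bsub>T_tau\<^esub> f) p) = p"
  using TG.l_inv[of f] TG.r_inv[of f] by (simp_all add: fun_eq_iff)

section \<open>Dynamics on the circle\<close>

text \<open>The lift that agrees with \<open>H\<close> on \<open>[b, b + 1]\<close>, provided that \<open>H (b + 1) = H b + 1\<close>.\<close>

definition periodize :: "real \<Rightarrow> (real \<Rightarrow> real) \<Rightarrow> real \<Rightarrow> real" where
  "periodize b H x = H (x - of_int \<lfloor>x - b\<rfloor>) + of_int \<lfloor>x - b\<rfloor>"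

lemma periodize_shift:
  assumes "H (b + 1) = H b + 1" "b + of_int n \<le> x" "x \<le> b + of_int n + 1"
  shows "periodize b H x = H (x - of_int n) + of_int n"
proof (cases "x = b + of_int n + 1")
  case True
  then have "\<lfloor>x - b\<rfloor> = n + 1" by simp
  then show ?thesis using assms(1) True by (simp add: periodize_def algebra_simps)
next
  case False
  then have "\<lfloor>x - b\<rfloor> = n" using assms(2,3) by (simp add: floor_eq_iff)
  then show ?thesis by (simp add: periodize_def)
qed

lemma periodize_eq:
  assumes "H (b + 1) = H b + 1" "b \<le> x" "x \<le> b + 1"
  shows "periodize b H x = H x"
  using periodize_shift[of H b 0 x] assms by simp

lemma periodize_lifts:
  assumes H: "H \<in> PL" and b: "b \<in> Z_tau" and Hb: "H (b + 1) = H b + 1"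
  shows "periodize b H \<in> lifts"
proof -
  define K where "K n = (\<lambda>y. y + of_int n) \<circ> H \<circ> (\<lambda>y. y + of_int (- n))" for n
  have KP: "K n \<in> PL" for n unfolding K_def using H by (intro PL_comp PL_translation Z_tau_of_int)
  have PK: "periodize b H x = K n x" if "b + of_int n \<le> x" "x \<le> b + of_int n + 1" for x n
    using periodize_shift[OF Hb that] by (simp add: K_def)
  have fl: "b + of_int \<lfloor>x - b\<rfloor> \<le> x" "x < b + of_int \<lfloor>x - b\<rfloor> + 1" for x
    using of_int_floor_le[of "x - b"] floor_correct[of "x - b"] by linarith+
  have Kb: "K n (b + of_int n + 1) = H b + of_int n + 1" "K n (b + of_int n) = H b + of_int n" for n
    using Hb by (simp_all add: K_def algebra_simps)
  have "tau_linear_at (periodize b H) x" for x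
  proof -
    define n where "n = \<lfloor>x - b\<rfloor>"
    show ?thesis
    proof (cases "x = b + of_int n")
      case True
      show ?thesis
      proof (rule tau_linear_at_glue[OF _ PL_D(5)[OF KP[of "n - 1"]] PL_D(5)[OF KP[of n]], of _ 1])
        show "x \<in> Z_tau" using True b by simp
        fix y assume "x - 1 < y" "y \<le> x"
        then show "periodize b H y = K (n - 1) y" using True by (intro PK) auto
      next
        fix y assume "x \<le> y" "y < x + 1"
        then show "periodize b H y = K n y" using True by (intro PK) auto
      qed simp
    next
      case False
      then have x: "b + of_int n < x" "x < b + of_int n + 1" using fl[of x] unfolding n_def by auto
      show ?thesis
      proof (rule tau_linear_at_cong[OF PL_D(5)[OF KP[of n]], of "min (x - (b + of_int n)) (b + of_int n + 1 - x)"])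
        fix y assume "\<bar>y - x\<bar> < min (x - (b + of_int n)) (b + of_int n + 1 - x)"
        then show "periodize b H y = K n y" by (intro PK) (auto simp: abs_less_iff)
      qed (use x in auto)
    qed
  qed
  moreover have "strict_mono (periodize b H)"
  proof (rule strict_monoI)
    fix x y :: real assume xy: "x < y"
    define m where "m = \<lfloor>x - b\<rfloor>"
    define n where "n = \<lfloor>y - b\<rfloor>"
    have fx: "b + of_int m \<le> x" "x < b + of_int m + 1" and fy: "b + of_int n \<le> y" "y < b + of_int n + 1"
      unfolding m_def n_def using fl by blast+
    have P: "periodize b H x = K m x" "periodize b H y = K n y" using PK fx fy by auto
    have "m \<le> n" unfolding m_def n_def using xy by (intro floor_mono) simp
    show "periodize b H x < periodize b H y"
    proof (cases "m = n")
      case True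
      then show ?thesis using P xy KP by (simp add: PL_less)
    next
      case False
      then have "of_int m + 1 \<le> (of_int n :: real)" using \<open>m \<le> n\<close> by linarith
      moreover have "K m x < K m (b + of_int m + 1)" using fx KP by (simp add: PL_less)
      moreover have "K n (b + of_int n) \<le> K n y" using fy KP by (simp add: PL_le)
      ultimately show ?thesis unfolding P Kb by linarith
    qed
  qed
  moreover have "surj (periodize b H)"
  proof -
    have "\<exists>x. periodize b H x = y" for y
    proof -
      define n where "n = \<lfloor>y - H b\<rfloor>"
      have n: "H b + of_int n \<le> y" "y \<le> H b + of_int n + 1"
        using of_int_floor_le[of "y - H b"] floor_correct[of "y - H b"] unfolding n_def by linarith+
      define x where "x = finv (K n) y"
      have Kx: "K n x = y" unfolding x_def using KP by simp
      have "K n (b + of_int n) \<le> K n x" "K n x \<le> K n (b + of_int n + 1)" unfolding Kx Kb using n by auto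
      then have "b + of_int n \<le> x" "x \<le> b + of_int n + 1" using KP by (simp_all add: PL_le)
      then show ?thesis using PK Kx by metis
    qed
    then show ?thesis by (metis surj_def)
  qed
  moreover have "periodize b H (x + 1) = periodize b H x + 1" for x
  proof -
    have "x + 1 - b = (x - b) + 1" by simp
    then have "\<lfloor>x + 1 - b\<rfloor> = \<lfloor>x - b\<rfloor> + 1" by (simp only: one_add_floor)
    then show ?thesis unfolding periodize_def by (simp add: algebra_simps)
  qed
  ultimately show ?thesis unfolding lifts_def PL_def by blast
qed

definition circle_arc :: "real \<Rightarrow> real \<Rightarrow> circle set" where
  "circle_arc a b = to_circle ` {a<..<b}"

lemma arc_iff: "to_circle x \<in> circle_arc a b \<longleftrightarrow> (\<exists>n::int. a < x + of_int n \<and> x + of_int n < b)"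
proof
  assume "to_circle x \<in> circle_arc a b"
  then obtain y where y: "a < y" "y < b" "y - x \<in> \<int>" unfolding circle_arc_def to_circle_eq_iff[symmetric] by auto
  then obtain n where "y - x = of_int n" by (auto elim: Ints_cases)
  then have "y = x + of_int n" by simp
  then show "\<exists>n::int. a < x + of_int n \<and> x + of_int n < b" using y by blast
next
  assume "\<exists>n::int. a < x + of_int n \<and> x + of_int n < b"
  then obtain n :: int where "x + of_int n \<in> {a<..<b}" by auto
  then show "to_circle x \<in> circle_arc a b" unfolding circle_arc_def by (metis image_eqI to_circle_add_int(1))
qed

lemma arc_disjoint:
  assumes "b \<le> c" "d \<le> a + 1" "p \<in> circle_arc a b"
  shows "p \<notin> circle_arc c d"
proof
  assume "p \<in> circle_arc c d"
  obtain x where x: "a < x" "x < b" "p = to_circle x" using assms(3) unfolding circle_arc_def by auto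
  obtain n :: int where n: "c < x + of_int n" "x + of_int n < d"
    using \<open>p \<in> circle_arc c d\<close> unfolding x(3) arc_iff by blast
  have "0 < (of_int n :: real)" "(of_int n :: real) < 1" using n x assms(1,2) by linarith+
  then show False by simp
qed

lemma arc_mono: "a \<le> a' \<Longrightarrow> b' \<le> b \<Longrightarrow> circle_arc a' b' \<subseteq> circle_arc a b"
  unfolding circle_arc_def by auto

text \<open>The complement of an arc is an arc, and arcs with end points in \<open>\<int>[\<tau>]\<close> can be mapped onto each other.\<close>

lemma compress_into_arc:
  assumes "a < b" "c < d"
  obtains s where "s \<in> carrier T_tau" "\<And>p. p \<notin> circle_arc a b \<Longrightarrow> s p \<in> circle_arc c d"
proof -
  obtain a' where a': "a' \<in> Z_tau" "a < a'" "a' < b" using assms(1) by (rule Z_tau_dense)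
  have "a' < min b (a' + 1)" using a' by simp
  then obtain b' where b': "b' \<in> Z_tau" "a' < b'" "b' < min b (a' + 1)" by (rule Z_tau_dense)
  obtain c' where c': "c' \<in> Z_tau" "c < c'" "c' < d" using assms(2) by (rule Z_tau_dense)
  have "c' < min d (c' + 1)" using c' by simp
  then obtain d' where d': "d' \<in> Z_tau" "c' < d'" "d' < min d (c' + 1)" by (rule Z_tau_dense)
  have Z: "a' + 1 \<in> Z_tau" "b' + 1 \<in> Z_tau" "c' + 1 \<in> Z_tau" using a' b' c' by simp_all
  have lt: "b' < a' + 1" "a' + 1 < b' + 1" "d' < c' + 1" using b' d' by auto
  obtain H1 where H1: "H1 \<in> PL" "H1 b' = c'" "H1 (a' + 1) = d'"
    using PL_interpolate[OF b'(1) Z(1) c'(1) d'(1) lt(1) d'(2)] .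
  obtain H2 where H2: "H2 \<in> PL" "H2 (a' + 1) = d'" "H2 (b' + 1) = c' + 1"
    using PL_interpolate[OF Z(1) Z(2) d'(1) Z(3) lt(2) lt(3)] .
  define H where "H = glue (a' + 1) H1 H2"
  have HP: "H \<in> PL" unfolding H_def using H1 H2 Z by (intro PL_glue) auto
  have Hb: "H (b' + 1) = H b' + 1" using H1 H2 lt unfolding H_def glue_def by simp
  define s where "s = circ (periodize b' H)"
  have L: "periodize b' H \<in> lifts" using periodize_lifts[OF HP b'(1) Hb] .
  have "s p \<in> circle_arc c d" if p: "p \<notin> circle_arc a b" for p
  proof -
    obtain x0 where x0: "p = to_circle x0" by (rule circle_cases)
    define x where "x = x0 - of_int \<lfloor>x0 - b'\<rfloor>"
    have px: "p = to_circle x" unfolding x0 x_def by (simp add: to_circle_eq_iff)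
    have x: "b' \<le> x" "x < b' + 1" unfolding x_def
      using of_int_floor_le[of "x0 - b'"] floor_correct[of "x0 - b'"] by linarith+
    have "x \<le> a' + 1"
    proof (rule ccontr)
      assume "\<not> x \<le> a' + 1"
      then have "a < x + of_int (- 1)" "x + of_int (- 1) < b" using x a' b' by auto
      then show False using p px arc_iff by blast
    qed
    then have "H b' \<le> H x" "H x \<le> H (a' + 1)" using x HP by (simp_all add: PL_le)
    then have "c < H x" "H x < d" using H1 lt c' d' unfolding H_def glue_def by auto
    moreover have "s p = to_circle (H x)"
      unfolding s_def px circ_to_circle[OF L] using periodize_eq[OF Hb] x by simp
    ultimately show ?thesis unfolding circle_arc_def by auto
  qed
  moreover have "s \<in> carrier T_tau" unfolding s_def using circ_in_T_tau L by blast
  ultimately show thesis using that by blast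
qed

definition fixing :: "real \<Rightarrow> real \<Rightarrow> (circle \<Rightarrow> circle) set" where
  "fixing a b = {f \<in> carrier T_tau. \<forall>p\<in>circle_arc a b. f p = p}"

definition local_commutators :: "(circle \<Rightarrow> circle) set" where
  "local_commutators = {comm T_tau f g | f g a b. a < b \<and> f \<in> fixing a b \<and> g \<in> fixing a b}"

lemma fixing_T_tau: "f \<in> fixing a b \<Longrightarrow> f \<in> carrier T_tau"
  unfolding fixing_def by blast

lemma fixing_mono: "a \<le> a' \<Longrightarrow> b' \<le> b \<Longrightarrow> fixing a b \<subseteq> fixing a' b'"
  unfolding fixing_def using arc_mono[of a a' b' b] by blast

lemma local_commutator_T_tau: "l \<in> local_commutators \<Longrightarrow> l \<in> carrier T_tau"
  unfolding local_commutators_def using fixing_T_tau by (auto simp del: T_tau_simps)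

lemma local_commutator_inv:
  assumes "l \<in> local_commutators"
  shows "inv\<^bsub>T_tau\<^esub> l \<in> local_commutators"
proof -
  obtain f g a b where *: "a < b" "f \<in> fixing a b" "g \<in> fixing a b" "l = comm T_tau f g"
    using assms unfolding local_commutators_def by blast
  have "inv\<^bsub>T_tau\<^esub> l = comm T_tau g f"
    unfolding *(4) using *(2,3)[THEN fixing_T_tau] by (simp add: TG.word_simps del: T_tau_simps)
  then show ?thesis unfolding local_commutators_def using * by blast
qed

lemma fixing_conj:
  assumes S: "S \<in> lifts" and f: "f \<in> fixing a b"
  shows "circ S \<otimes>\<^bsub>T_tau\<^esub> f \<otimes>\<^bsub>T_tau\<^esub> inv\<^bsub>T_tau\<^esub> (circ S) \<in> fixing (S a) (S b)"
proof -
  have "circ S (f (circ (finv S) p)) = p" if p: "p \<in> circle_arc (S a) (S b)" for p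
  proof -
    obtain x where x: "S a < x" "x < S b" "p = to_circle x" using p unfolding circle_arc_def by auto
    define y where "y = finv S x"
    have y: "x = S y" unfolding y_def using S lifts_PL by simp
    have "a < y" "y < b" using x S lifts_PL unfolding y by (auto simp: PL_less)
    then have "f (to_circle y) = to_circle y" using f unfolding fixing_def circle_arc_def by auto
    then show ?thesis using x(3) y circ_to_circle[OF S] circ_to_circle[OF lifts_inv[OF S]] S lifts_PL by simp
  qed
  moreover have "circ S \<otimes>\<^bsub>T_tau\<^esub> f \<otimes>\<^bsub>T_tau\<^esub> inv\<^bsub>T_tau\<^esub> (circ S) \<in> carrier T_tau"
    using circ_in_T_tau[OF S] fixing_T_tau[OF f] by (simp del: T_tau_simps)
  ultimately show ?thesis unfolding fixing_def using T_tau_inv_circ[OF S] by simp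
qed

lemma local_commutator_conj:
  assumes l: "l \<in> local_commutators" and s: "s \<in> carrier T_tau"
  shows "s \<otimes>\<^bsub>T_tau\<^esub> l \<otimes>\<^bsub>T_tau\<^esub> inv\<^bsub>T_tau\<^esub> s \<in> local_commutators"
proof -
  obtain S where S: "S \<in> lifts" "s = circ S" using s by (rule T_tau_lift)
  obtain f g a b where *: "a < b" "f \<in> fixing a b" "g \<in> fixing a b" "l = comm T_tau f g"
    using l unfolding local_commutators_def by blast
  have "s \<otimes>\<^bsub>T_tau\<^esub> l \<otimes>\<^bsub>T_tau\<^esub> inv\<^bsub>T_tau\<^esub> s =
    comm T_tau (s \<otimes>\<^bsub>T_tau\<^esub> f \<otimes>\<^bsub>T_tau\<^esub> inv\<^bsub>T_tau\<^esub> s) (s \<otimes>\<^bsub>T_tau\<^esub> g \<otimes>\<^bsub>T_tau\<^esub> inv\<^bsub>T_tau\<^esub> s)"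
    unfolding *(4) using *(2,3)[THEN fixing_T_tau] s by (simp add: TG.word_simps del: T_tau_simps)
  moreover have "S a < S b" using *(1) S lifts_PL by (simp add: PL_less)
  ultimately show ?thesis unfolding local_commutators_def
    using fixing_conj[OF S(1) *(2)] fixing_conj[OF S(1) *(3)] unfolding S(2) by blast
qed

text \<open>A local commutator \<open>l\<close> is constructed that agrees with \<open>f\<close> near \<open>0\<close>.  Cut \<open>f\<close> off to \<open>p\<close>, supported in an interval
\<open>[\<alpha>, \<beta>]\<close> that contains \<open>0\<close> and \<open>f 0\<close>, and let \<open>q\<close> push \<open>[\<alpha>, \<beta>]\<close> to the right, away from \<open>0\<close>.  Near \<open>0\<close> the conjugate
\<open>q p\<^sup>-\<^sup>1 q\<^sup>-\<^sup>1\<close> is the identity, so that \<open>[p, q] = p = f\<close> there.\<close>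

lemma local_commutator_approximation:
  assumes f: "f \<in> carrier T_tau"
  obtains l e where "l \<in> local_commutators" "0 < e" "inv\<^bsub>T_tau\<^esub> l \<otimes>\<^bsub>T_tau\<^esub> f \<in> fixing (- e) e"
proof -
  obtain F0 where F0: "F0 \<in> lifts" "f = circ F0" using f by (rule T_tau_lift)
  define F where "F = (\<lambda>x. x + of_int (- \<lfloor>F0 0\<rfloor>)) \<circ> F0"
  have F: "F \<in> lifts" unfolding F_def by (intro lifts_comp lifts_translation F0 Z_tau_of_int)
  have fF: "f = circ F"
    by (rule circ_eqI[OF F]) (simp add: F0 circ_to_circle F_def to_circle_eq_iff)
  have FP: "F \<in> PL" using F lifts_PL by blast
  have F00: "0 \<le> F 0" "F 0 < 1" unfolding F_def by (simp_all, linarith)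
  \<comment> \<open>the room of length \<open>5 r\<close> left in \<open>[F 0, 1]\<close> is shared by \<open>\<beta>, \<gamma>, \<beta>0\<close> and by \<open>\<alpha>0 + 1, \<alpha> + 1\<close>\<close>
  define r where "r = (1 - F 0) / 5"
  have r: "0 < r" "F 0 + 5 * r = 1" using F00 unfolding r_def by (simp_all add: field_simps)
  have "isCont F 0" using PL_continuous[OF FP] by (simp add: continuous_on_eq_continuous_at)
  then obtain e0 where e0: "0 < e0" "\<And>x. \<bar>x\<bar> < e0 \<Longrightarrow> \<bar>F x - F 0\<bar> < r"
    using r(1) unfolding continuous_at_eps_delta by (auto simp: dist_real_def)
  have "0 < min e0 r" using e0 r by simp
  then obtain e where e: "e \<in> Z_tau" "0 < e" "e < min e0 r" by (rule Z_tau_dense)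
  have Fe: "F 0 - r < F (- e)" "F e < F 0 + r" using e0(2)[of e] e0(2)[of "-e"] e by (auto simp: abs_less_iff)
  obtain \<alpha> where \<alpha>: "\<alpha> \<in> Z_tau" "- 2 * r < \<alpha>" "\<alpha> < - r" using Z_tau_dense[of "- 2 * r" "- r"] r by auto
  obtain \<beta> where \<beta>: "\<beta> \<in> Z_tau" "F 0 + r < \<beta>" "\<beta> < F 0 + 2 * r" using Z_tau_dense[of "F 0 + r" "F 0 + 2 * r"] r by auto
  obtain \<gamma> where \<gamma>: "\<gamma> \<in> Z_tau" "\<beta> < \<gamma>" "\<gamma> < F 0 + 2 * r" using \<beta>(3) by (rule Z_tau_dense)
  obtain \<alpha>0 where \<alpha>0: "\<alpha>0 \<in> Z_tau" "- 3 * r < \<alpha>0" "\<alpha>0 < - 2 * r" using Z_tau_dense[of "- 3 * r" "- 2 * r"] r by auto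
  have "F 0 + 2 * r < \<alpha>0 + 1" using \<alpha>0 r by simp
  then obtain \<beta>0 where \<beta>0: "\<beta>0 \<in> Z_tau" "F 0 + 2 * r < \<beta>0" "\<beta>0 < \<alpha>0 + 1" by (rule Z_tau_dense)
  have eZ: "- e \<in> Z_tau" using e by simp
  have lt1: "- e \<le> e" "\<alpha> < - e" "\<alpha> < F (- e)" "e < \<beta>" "F e < \<beta>"
    using \<alpha> \<beta> e Fe F00 r by auto
  obtain H1 where H1: "H1 \<in> PL" "\<And>x. - e \<le> x \<Longrightarrow> x \<le> e \<Longrightarrow> H1 x = F x"
    "\<And>x. x \<le> \<alpha> \<Longrightarrow> H1 x = x" "\<And>x. \<beta> \<le> x \<Longrightarrow> H1 x = x"
    using PL_localize[OF FP eZ e(1) \<alpha>(1) \<beta>(1) lt1] by blast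
  have tr: "(\<lambda>x. x + (\<gamma> - \<alpha>)) \<in> PL" using \<alpha> \<gamma> by (intro PL_translation Z_tau_diff)
  have lt2: "\<alpha> \<le> \<alpha>" "\<alpha>0 < \<alpha>" "\<alpha>0 < \<alpha> + (\<gamma> - \<alpha>)" "\<alpha> < \<beta>0" "\<alpha> + (\<gamma> - \<alpha>) < \<beta>0"
    using \<alpha> \<alpha>0 \<beta> \<beta>0 \<gamma> r F00 by auto
  obtain H2 where H2: "H2 \<in> PL" "\<And>x. \<alpha> \<le> x \<Longrightarrow> x \<le> \<alpha> \<Longrightarrow> H2 x = x + (\<gamma> - \<alpha>)"
    "\<And>x. x \<le> \<alpha>0 \<Longrightarrow> H2 x = x" "\<And>x. \<beta>0 \<le> x \<Longrightarrow> H2 x = x"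
    using PL_localize[OF tr \<alpha>(1) \<alpha>(1) \<alpha>0(1) \<beta>0(1) lt2] by blast
  have H1p: "H1 (\<alpha>0 + 1) = H1 \<alpha>0 + 1" using H1(3)[of \<alpha>0] H1(4)[of "\<alpha>0 + 1"] lt2 \<gamma> \<beta>0 by simp
  have H2p: "H2 (\<alpha>0 + 1) = H2 \<alpha>0 + 1" using H2(3)[of \<alpha>0] H2(4)[of "\<alpha>0 + 1"] \<beta>0 by simp
  define P1 where "P1 = periodize \<alpha>0 H1"
  define P2 where "P2 = periodize \<alpha>0 H2"
  have P1: "P1 \<in> lifts" unfolding P1_def using periodize_lifts[OF H1(1) \<alpha>0(1) H1p] .
  have P2: "P2 \<in> lifts" unfolding P2_def using periodize_lifts[OF H2(1) \<alpha>0(1) H2p] .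
  have P1e: "P1 x = H1 x" if "\<alpha>0 \<le> x" "x \<le> \<alpha>0 + 1" for x unfolding P1_def using periodize_eq[OF H1p that] .
  have P2e: "P2 x = H2 x" if "\<alpha>0 \<le> x" "x \<le> \<alpha>0 + 1" for x unfolding P2_def using periodize_eq[OF H2p that] .
  have "circ P1 \<in> fixing \<beta>0 (\<alpha>0 + 1)" "circ P2 \<in> fixing \<beta>0 (\<alpha>0 + 1)"
    unfolding fixing_def circle_arc_def using P1 P2 circ_in_T_tau circ_to_circle P1e P2e H1(4) H2(4) lt2 \<gamma> \<beta>0 by auto
  then have l: "comm T_tau (circ P1) (circ P2) \<in> local_commutators"
    unfolding local_commutators_def using \<beta>0(3) by blast
  define l where "l = comm T_tau (circ P1) (circ P2)"
  have lf: "l (to_circle x) = f (to_circle x)" if x: "- e < x" "x < e" for x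
  proof -
    define y where "y = finv H2 x"
    have Hy: "H2 y = x" unfolding y_def using H2 by simp
    have "H2 y < H2 \<alpha>" using H2(2)[of \<alpha>] Hy x lt1 \<gamma> by simp
    then have "y < \<alpha>" using H2(1) by (simp add: PL_less)
    have "H2 \<alpha>0 < H2 y" using H2(3)[of \<alpha>0] Hy x lt1 lt2 by simp
    then have "\<alpha>0 < y" using H2(1) by (simp add: PL_less)
    have 1: "P2 y = x" using P2e[of y] Hy \<open>y < \<alpha>\<close> \<open>\<alpha>0 < y\<close> lt2 \<beta>0 by simp
    have 2: "P1 y = y" using P1e[of y] H1(3)[of y] \<open>y < \<alpha>\<close> \<open>\<alpha>0 < y\<close> lt2 \<beta>0 by simp
    have 3: "P1 x = F x" using P1e[of x] H1(2)[of x] x lt1 lt2 \<beta>0 \<gamma> by simp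
    have inv1: "(inv\<^bsub>T_tau\<^esub> circ P2) (to_circle x) = to_circle y"
      using circ_to_circle[OF P2, of y] 1 T_tau_inv_apply(1)[OF circ_in_T_tau[OF P2], of "to_circle y"] by simp
    have inv2: "(inv\<^bsub>T_tau\<^esub> circ P1) (to_circle y) = to_circle y"
      using circ_to_circle[OF P1, of y] 2 T_tau_inv_apply(1)[OF circ_in_T_tau[OF P1], of "to_circle y"] by simp
    show ?thesis unfolding l_def fF using 1 3 inv1 inv2 P1 P2 F by (simp add: circ_to_circle)
  qed
  have lT: "l \<in> carrier T_tau" unfolding l_def using l local_commutator_T_tau by blast
  have "inv\<^bsub>T_tau\<^esub> l \<otimes>\<^bsub>T_tau\<^esub> f \<in> fixing (- e) e"
    unfolding fixing_def circle_arc_def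
  proof safe
    show "inv\<^bsub>T_tau\<^esub> l \<otimes>\<^bsub>T_tau\<^esub> f \<in> carrier T_tau" using lT f by (simp del: T_tau_simps)
    fix x assume "x \<in> {- e<..<e}"
    then show "(inv\<^bsub>T_tau\<^esub> l \<otimes>\<^bsub>T_tau\<^esub> f) (to_circle x) = to_circle x"
      using T_tau_inv_apply(1)[OF lT, of "to_circle x"] lf[of x] by simp
  qed
  then show thesis using that l e(2) unfolding l_def by blast
qed

section \<open>Bounded products of conjugates\<close>

definition products :: "('a, 'b) monoid_scheme \<Rightarrow> 'a set \<Rightarrow> nat \<Rightarrow> 'a set" where
  "products G S n = {foldr (\<otimes>\<^bsub>G\<^esub>) cs \<one>\<^bsub>G\<^esub> | cs. length cs \<le> n \<and> set cs \<subseteq> S}"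

context group
begin

lemma foldr_closed: "set cs \<subseteq> carrier G \<Longrightarrow> foldr (\<otimes>) cs \<one> \<in> carrier G"
  by (induction cs) auto

lemma foldr_append_mult:
  "set cs \<subseteq> carrier G \<Longrightarrow> set ds \<subseteq> carrier G \<Longrightarrow>
    foldr (\<otimes>) (cs @ ds) \<one> = foldr (\<otimes>) cs \<one> \<otimes> foldr (\<otimes>) ds \<one>"
  by (induction cs) (simp_all add: foldr_closed m_assoc)

lemma products_mult:
  assumes "S \<subseteq> carrier G" "x \<in> products G S m" "y \<in> products G S n"
  shows "x \<otimes> y \<in> products G S (m + n)"
proof -
  obtain cs ds where c: "length cs \<le> m" "set cs \<subseteq> S" "x = foldr (\<otimes>) cs \<one>"
    and d: "length ds \<le> n" "set ds \<subseteq> S" "y = foldr (\<otimes>) ds \<one>"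
    using assms(2,3) unfolding products_def by blast
  have "x \<otimes> y = foldr (\<otimes>) (cs @ ds) \<one>"
    unfolding c(3) d(3) by (rule foldr_append_mult[symmetric]) (use c(2) d(2) assms(1) in auto)
  then show ?thesis unfolding products_def using c d by (intro CollectI exI[of _ "cs @ ds"]) auto
qed

lemma products_single: "x \<in> S \<Longrightarrow> S \<subseteq> carrier G \<Longrightarrow> x \<in> products G S 1"
  unfolding products_def by (intro CollectI exI[of _ "[x]"]) auto

lemma products_one: "\<one> \<in> products G S n"
  unfolding products_def by (intro CollectI exI[of _ "[]"]) auto

lemma products_mono: "m \<le> n \<Longrightarrow> products G S m \<subseteq> products G S n"
  unfolding products_def by fastforce

lemma products_subst:
  assumes C: "C \<subseteq> carrier G" and S: "S \<subseteq> products G C m"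
  shows "products G S n \<subseteq> products G C (n * m)"
proof
  fix x assume "x \<in> products G S n"
  then obtain cs where cs: "length cs \<le> n" "set cs \<subseteq> S" "x = foldr (\<otimes>) cs \<one>"
    unfolding products_def by blast
  have "foldr (\<otimes>) cs \<one> \<in> products G C (length cs * m)"
    using cs(2)
  proof (induction cs)
    case Nil
    then show ?case using products_one by simp
  next
    case (Cons c cs)
    then have "c \<otimes> foldr (\<otimes>) cs \<one> \<in> products G C (m + length cs * m)"
      using S by (intro products_mult[OF C]) auto
    then show ?case by simp
  qed
  then show "x \<in> products G C (n * m)"
    using products_mono[of "length cs * m" "n * m"] cs(1,3) by auto
qed

lemma generate_products:
  assumes S: "S \<subseteq> carrier G" and inv: "\<And>x. x \<in> S \<Longrightarrow> inv x \<in> S" and x: "x \<in> generate G S"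
  shows "\<exists>n. x \<in> products G S n"
  using x
proof (induction rule: generate.induct)
  case one
  then show ?case using products_one by blast
next
  case (incl h)
  then show ?case using products_single S by blast
next
  case (inv h)
  then show ?case using products_single S assms(2) by blast
next
  case (eng h1 h2)
  then show ?case using products_mult[OF S] by blast
qed

end

definition supported :: "('a \<Rightarrow> 'a) \<Rightarrow> 'a set \<Rightarrow> bool" where
  "supported f U \<longleftrightarrow> (\<forall>p. p \<notin> U \<longrightarrow> f p = p)"

lemma T_tau_inj: "f \<in> carrier T_tau \<Longrightarrow> inj f"
  using T_tau_inv_apply(1) by (metis injI)

lemma supported_commute:
  assumes "f \<in> carrier T_tau" "g \<in> carrier T_tau" "supported f U" "supported g V" "U \<inter> V = {}"
  shows "f \<otimes>\<^bsub>T_tau\<^esub> g = g \<otimes>\<^bsub>T_tau\<^esub> f"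
proof -
  have "f \<circ> g = g \<circ> f"
    using assms T_tau_inj unfolding supported_def
    by (intro commute_of_disjoint_support) blast+
  then show ?thesis by simp
qed

lemma supported_inv:
  assumes "f \<in> carrier T_tau" "supported f U"
  shows "supported (inv\<^bsub>T_tau\<^esub> f) U"
  unfolding supported_def
proof (intro allI impI)
  fix p assume "p \<notin> U"
  then have "f p = p" using assms(2) unfolding supported_def by blast
  then show "(inv\<^bsub>T_tau\<^esub> f) p = p" using T_tau_inv_apply(1)[OF assms(1), of p] by simp
qed

lemma supported_conj:
  assumes h: "h \<in> carrier T_tau" and f: "supported f U" and hU: "\<And>p. p \<in> U \<Longrightarrow> h p \<in> V"
  shows "supported (h \<otimes>\<^bsub>T_tau\<^esub> f \<otimes>\<^bsub>T_tau\<^esub> inv\<^bsub>T_tau\<^esub> h) V"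
  unfolding supported_def
proof (intro allI impI)
  fix p assume "p \<notin> V"
  then have "(inv\<^bsub>T_tau\<^esub> h) p \<notin> U" using hU[of "(inv\<^bsub>T_tau\<^esub> h) p"] T_tau_inv_apply(2)[OF h, of p] by auto
  then show "(h \<otimes>\<^bsub>T_tau\<^esub> f \<otimes>\<^bsub>T_tau\<^esub> inv\<^bsub>T_tau\<^esub> h) p = p"
    using f T_tau_inv_apply(2)[OF h, of p] unfolding supported_def by simp
qed

lemma supported_mult:
  "supported f U \<Longrightarrow> supported g V \<Longrightarrow> supported (f \<otimes>\<^bsub>T_tau\<^esub> g) (U \<union> V)"
  unfolding supported_def by auto

lemma supported_mono: "supported f U \<Longrightarrow> U \<subseteq> V \<Longrightarrow> supported f V"
  unfolding supported_def by blast

text \<open>For a lift \<open>F\<close> and a point \<open>x\<close> with \<open>x < F x < x + 1\<close> choose \<open>d\<close> such that \<open>d \<le> F x\<close> and \<open>F d \<le> x + 1\<close>; then the image of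
\<open>(x, d)\<close> lies in \<open>(F x, x + 1)\<close>, which is disjoint from \<open>(x, d)\<close> modulo the integers.\<close>

lemma displaced_arc:
  assumes g: "g \<in> carrier T_tau" "g \<noteq> id"
  obtains c d where "c < d" "d < c + 1" "\<And>p. p \<in> circle_arc c d \<Longrightarrow> g p \<notin> circle_arc c d"
proof -
  obtain G where G: "G \<in> lifts" "g = circ G" using g(1) by (rule T_tau_lift)
  obtain p where "g p \<noteq> p" using g(2) by (auto simp: fun_eq_iff)
  moreover obtain x where x: "p = to_circle x" by (rule circle_cases)
  ultimately have nz: "G x - x \<notin> \<int>" using circ_to_circle[OF G(1)] G(2) to_circle_eq_iff by auto
  define n where "n = \<lfloor>G x - x\<rfloor>"
  define F where "F = (\<lambda>x. x + of_int (- n)) \<circ> G"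
  have F: "F \<in> lifts" unfolding F_def by (intro lifts_comp lifts_translation G Z_tau_of_int)
  have gF: "g = circ F"
    by (rule circ_eqI[OF F]) (simp add: G circ_to_circle F_def to_circle_eq_iff)
  have "of_int n \<noteq> G x - x" using nz Ints_of_int by metis
  then have "of_int n < G x - x" "G x - x < of_int n + 1"
    using of_int_floor_le[of "G x - x"] floor_correct[of "G x - x"] unfolding n_def by linarith+
  then have Fx: "x < F x" "F x < x + 1" unfolding F_def by simp_all
  have FP: "F \<in> PL" using F lifts_PL by blast
  define d where "d = min (F x) (finv F (x + 1))"
  have "F x < F (finv F (x + 1))" using Fx FP by simp
  then have "x < finv F (x + 1)" using PL_less[OF FP] by blast
  then have d: "x < d" "d \<le> F x" "d \<le> finv F (x + 1)" using Fx unfolding d_def by auto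
  have "g p \<notin> circle_arc x d" if "p \<in> circle_arc x d" for p
  proof -
    obtain y where y: "x < y" "y < d" "p = to_circle y" using \<open>p \<in> circle_arc x d\<close> unfolding circle_arc_def by auto
    have "F x < F y" using y FP by (simp add: PL_less)
    moreover have "y < finv F (x + 1)" using y(2) d(3) by linarith
    then have "F y < F (finv F (x + 1))" by (simp only: PL_less[OF FP])
    ultimately have "to_circle (F y) \<in> circle_arc (F x) (x + 1)" using FP unfolding circle_arc_def by auto
    then have "g p \<in> circle_arc (F x) (x + 1)" unfolding y(3) gF circ_to_circle[OF F] .
    then show ?thesis using arc_disjoint[of d "F x" "x + 1" x] d by auto
  qed
  moreover have "d < x + 1" using d Fx by simp
  ultimately show thesis using that d(1) by blast
qed

abbreviation T_tau' :: "(circle \<Rightarrow> circle) set" where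
  "T_tau' \<equiv> derived T_tau (carrier T_tau)"

lemma T_tau'_subgroup: "subgroup T_tau' T_tau"
  by (rule TG.derived_is_subgroup) simp

lemma T_tau'_carrier: "f \<in> T_tau' \<Longrightarrow> f \<in> carrier T_tau"
  using subgroup.mem_carrier[OF T_tau'_subgroup] .

lemma comm_in_T_tau': "f \<in> carrier T_tau \<Longrightarrow> g \<in> carrier T_tau \<Longrightarrow> comm T_tau f g \<in> T_tau'"
  unfolding derived_def by (rule generate.incl) blast

lemma T_tau'_mult: "f \<in> T_tau' \<Longrightarrow> g \<in> T_tau' \<Longrightarrow> f \<otimes>\<^bsub>T_tau\<^esub> g \<in> T_tau'"
  and T_tau'_inv: "f \<in> T_tau' \<Longrightarrow> inv\<^bsub>T_tau\<^esub> f \<in> T_tau'"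
  using subgroup.m_closed[OF T_tau'_subgroup] subgroup.m_inv_closed[OF T_tau'_subgroup] by auto

lemma local_commutators_T_tau': "local_commutators \<subseteq> T_tau'"
  unfolding local_commutators_def using comm_in_T_tau' fixing_T_tau by blast

text \<open>Modulo \<open>T'\<close> an element \<open>s\<close> of \<open>T\<close> equals one that is the identity near \<open>0\<close> and hence also a conjugate of it supported in
the arc \<open>(a, b)\<close>.  Dividing by the latter changes \<open>s\<close> only inside that arc and moves it into \<open>T'\<close>.\<close>

lemma T_tau'_compress_into_arc:
  assumes "a < b" "c < d"
  obtains h where "h \<in> T_tau'" "\<And>p. p \<notin> circle_arc a b \<Longrightarrow> h p \<in> circle_arc c d"
proof -
  obtain s where s: "s \<in> carrier T_tau" "\<And>p. p \<notin> circle_arc a b \<Longrightarrow> s p \<in> circle_arc c d"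
    using compress_into_arc[OF assms] by blast
  obtain l e where l: "l \<in> local_commutators" "0 < e" "inv\<^bsub>T_tau\<^esub> l \<otimes>\<^bsub>T_tau\<^esub> s \<in> fixing (- e) e"
    using local_commutator_approximation[OF s(1)] .
  define t where "t = inv\<^bsub>T_tau\<^esub> l \<otimes>\<^bsub>T_tau\<^esub> s"
  have t: "t \<in> carrier T_tau" "supported t (- circle_arc (- e) e)"
    using l(3) unfolding t_def fixing_def supported_def by blast+
  have "- e < e" using l(2) by simp
  then obtain r where r: "r \<in> carrier T_tau" "\<And>p. p \<notin> circle_arc (- e) e \<Longrightarrow> r p \<in> circle_arc a b"
    using compress_into_arc[of "- e" e a b] assms(1) by blast
  define m where "m = r \<otimes>\<^bsub>T_tau\<^esub> inv\<^bsub>T_tau\<^esub> t \<otimes>\<^bsub>T_tau\<^esub> inv\<^bsub>T_tau\<^esub> r"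
  have m: "supported m (circle_arc a b)"
    unfolding m_def by (rule supported_conj[OF r(1) supported_inv[OF t]]) (use r(2) in blast)
  have lT: "l \<in> carrier T_tau" using l(1) local_commutator_T_tau by blast
  have "s \<otimes>\<^bsub>T_tau\<^esub> m = l \<otimes>\<^bsub>T_tau\<^esub> comm T_tau t r"
    unfolding m_def t_def using lT s(1) r(1) by (simp add: TG.word_simps del: T_tau_simps)
  moreover have "l \<otimes>\<^bsub>T_tau\<^esub> comm T_tau t r \<in> T_tau'"
    using T_tau'_mult local_commutators_T_tau' l(1) comm_in_T_tau' t(1) r(1) by blast
  ultimately have "s \<otimes>\<^bsub>T_tau\<^esub> m \<in> T_tau'" by simp
  moreover have "(s \<otimes>\<^bsub>T_tau\<^esub> m) p \<in> circle_arc c d" if "p \<notin> circle_arc a b" for p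
    using m s(2) that unfolding supported_def by simp
  ultimately show thesis using that by blast
qed

abbreviation T_tau'_conjugates :: "(circle \<Rightarrow> circle) \<Rightarrow> (circle \<Rightarrow> circle) set" where
  "T_tau'_conjugates g \<equiv> {h \<otimes>\<^bsub>T_tau\<^esub> k \<otimes>\<^bsub>T_tau\<^esub> inv\<^bsub>T_tau\<^esub> h | h k. h \<in> T_tau' \<and> k \<in> {g, inv\<^bsub>T_tau\<^esub> g}}"

text \<open>After conjugation by \<open>h \<in> T'\<close> the two maps become \<open>A\<close> and \<open>B\<close>, supported in the first of three adjacent arcs of
an arc that \<open>g\<close> displaces.  They need not be in \<open>T'\<close>, but the commutators \<open>A' = [A, u]\<close> and \<open>B' = [B, v]\<close> are, where
\<open>u\<close> and \<open>v\<close> carry the first arc into the second and the third one.  These differ from \<open>A\<close> and \<open>B\<close> by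
factors on the other two arcs, so \<open>[A', B'] = [A, B]\<close>.  Finally \<open>[A', B'] = [[A', g], B']\<close>, which expands into
conjugates of \<open>g\<close> and \<open>g\<^sup>-\<^sup>1\<close> by \<open>A'\<close>, \<open>1\<close>, \<open>B'\<close> and \<open>B' A'\<close>.\<close>

lemma local_commutator_four_conjugates:
  assumes g: "g \<in> carrier T_tau" "g \<noteq> id" and l: "l \<in> local_commutators"
  shows "l \<in> products T_tau (T_tau'_conjugates g) 4"
proof -
  let ?m = "mult T_tau" and ?i = "m_inv T_tau"
  obtain f1 f2 a b where f: "a < b" "f1 \<in> fixing a b" "f2 \<in> fixing a b" "l = comm T_tau f1 f2"
    using l unfolding local_commutators_def by blast
  obtain c d where cd: "c < d" "d < c + 1" "\<And>p. p \<in> circle_arc c d \<Longrightarrow> g p \<notin> circle_arc c d"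
    using displaced_arc[OF g] by blast
  obtain c1 where c1: "c < c1" "c1 < d" using dense[OF cd(1)] by blast
  obtain c2 where c2: "c1 < c2" "c2 < d" using dense[OF c1(2)] by blast
  obtain h where h: "h \<in> T_tau'" "\<And>p. p \<notin> circle_arc a b \<Longrightarrow> h p \<in> circle_arc c c1"
    using T_tau'_compress_into_arc[OF f(1) c1(1)] by blast
  obtain u where u: "u \<in> carrier T_tau" "\<And>p. p \<notin> circle_arc c1 d \<Longrightarrow> u p \<in> circle_arc c1 c2"
    using compress_into_arc[OF c1(2) c2(1)] by blast
  obtain v where v: "v \<in> carrier T_tau" "\<And>p. p \<notin> circle_arc c1 d \<Longrightarrow> v p \<in> circle_arc c2 d"
    using compress_into_arc[OF c1(2) c2(2)] by blast
  have hT: "h \<in> carrier T_tau" using h(1) T_tau'_carrier by blast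
  define A where "A = ?m (?m h f1) (?i h)"
  define B where "B = ?m (?m h f2) (?i h)"
  define A2 where "A2 = ?m (?m u (?i A)) (?i u)"
  define B3 where "B3 = ?m (?m v (?i B)) (?i v)"
  have fT: "f1 \<in> carrier T_tau" "f2 \<in> carrier T_tau" using f fixing_T_tau by auto
  have T: "A \<in> carrier T_tau" "B \<in> carrier T_tau" "A2 \<in> carrier T_tau" "B3 \<in> carrier T_tau"
    unfolding A_def B_def A2_def B3_def using hT fT u(1) v(1) by (simp_all del: T_tau_simps)
  have sf: "supported f1 (- circle_arc a b)" "supported f2 (- circle_arc a b)"
    using f(2,3) unfolding fixing_def supported_def by auto
  have sAB: "supported A (circle_arc c c1)" "supported B (circle_arc c c1)"
    unfolding A_def B_def
    by (rule supported_conj[OF hT sf(1)], use h(2) in blast) (rule supported_conj[OF hT sf(2)], use h(2) in blast)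
  have dis: "circle_arc c c1 \<inter> circle_arc c1 d = {}" "circle_arc c c1 \<inter> circle_arc c1 c2 = {}" "circle_arc c c1 \<inter> circle_arc c2 d = {}"
    "circle_arc c1 c2 \<inter> circle_arc c2 d = {}" "circle_arc c1 c2 \<inter> circle_arc c c1 = {}" "circle_arc c2 d \<inter> circle_arc c c1 = {}"
    using arc_disjoint[of c1 c1 d c] arc_disjoint[of c1 c1 c2 c] arc_disjoint[of c1 c2 d c]
      arc_disjoint[of c2 c2 d c1] c1 c2 cd by auto
  have sA2: "supported A2 (circle_arc c1 c2)"
    unfolding A2_def by (rule supported_conj[OF u(1) supported_inv[OF T(1) sAB(1)]]) (use u(2) dis(1) in blast)
  have sB3: "supported B3 (circle_arc c2 d)"
    unfolding B3_def by (rule supported_conj[OF v(1) supported_inv[OF T(2) sAB(2)]]) (use v(2) dis(1) in blast)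
  define A' where "A' = ?m A A2"
  define B' where "B' = ?m B B3"
  have A': "A' = comm T_tau A u" unfolding A'_def A2_def using T u(1) by (simp add: TG.word_simps del: T_tau_simps)
  have B': "B' = comm T_tau B v" unfolding B'_def B3_def using T v(1) by (simp add: TG.word_simps del: T_tau_simps)
  have D: "A' \<in> T_tau'" "B' \<in> T_tau'" unfolding A' B' using comm_in_T_tau' T u(1) v(1) by auto
  have T': "A' \<in> carrier T_tau" "B' \<in> carrier T_tau" using D T_tau'_carrier by auto
  have c23: "?m A2 B3 = ?m B3 A2" by (rule supported_commute[OF T(3,4) sA2 sB3 dis(4)])
  have "comm T_tau A' B' = ?m (comm T_tau A B) (comm T_tau A2 B3)"
    unfolding A'_def B'_def
    by (rule TG.comm_mult_commuting)
      (use T supported_commute[OF T(3) T(1) sA2 sAB(1) dis(5)] supported_commute[OF T(3) T(2) sA2 sAB(2) dis(5)]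
        supported_commute[OF T(4) T(1) sB3 sAB(1) dis(6)] supported_commute[OF T(4) T(2) sB3 sAB(2) dis(6)] in auto)
  also have "comm T_tau A2 B3 = \<one>\<^bsub>T_tau\<^esub>"
    unfolding c23 using T by (simp add: TG.word_simps del: T_tau_simps)
  finally have AB: "comm T_tau A' B' = comm T_tau A B" using T by (simp del: T_tau_simps)
  have sub: "circle_arc c c1 \<union> circle_arc c1 c2 \<subseteq> circle_arc c d" "circle_arc c c1 \<union> circle_arc c2 d \<subseteq> circle_arc c d"
    using arc_mono[of c c c1 d] arc_mono[of c c1 c2 d] arc_mono[of c c2 d d] c1 c2 by auto
  have sA': "supported A' (circle_arc c d)" "supported B' (circle_arc c d)"
    unfolding A'_def B'_def
    using supported_mono[OF supported_mult[OF sAB(1) sA2] sub(1)] supported_mono[OF supported_mult[OF sAB(2) sB3] sub(2)]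
    by blast+
  define X where "X = ?m (?m g (?i A')) (?i g)"
  have XT: "X \<in> carrier T_tau" unfolding X_def using g(1) T' by (simp del: T_tau_simps)
  have sX: "supported X (- circle_arc c d)"
    unfolding X_def by (rule supported_conj[OF g(1) supported_inv[OF T'(1) sA'(1)]]) (use cd(3) in blast)
  have XB: "?m X B' = ?m B' X" by (rule supported_commute[OF XT T'(2) sX sA'(2)]) auto
  have key: "comm T_tau (?m A' X) B' = comm T_tau A' B'"
  proof -
    have "comm T_tau (?m A' X) B' = ?m A' (?m (?m X B') (?m (?i X) (?m (?i A') (?i B'))))"
      using T' XT by (simp add: TG.word_simps del: T_tau_simps)
    also have "\<dots> = comm T_tau A' B'" unfolding XB using T' XT by (simp add: TG.word_simps del: T_tau_simps)
    finally show ?thesis .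
  qed
  have AX: "?m A' X = comm T_tau A' g"
    unfolding X_def using T' g(1) by (simp add: TG.word_simps del: T_tau_simps)
  define h' where "h' = ?i h"
  have h': "h' \<in> T_tau'" "h' \<in> carrier T_tau" unfolding h'_def using h(1) T_tau'_inv T_tau'_carrier by auto
  define q where "q y k = ?m (?m y k) (?i y)" for y k
  have qC: "q y k \<in> T_tau'_conjugates g" if "y \<in> T_tau'" "k \<in> {g, ?i g}" for y k
    using that unfolding q_def by blast
  define cs where "cs = [q (?m h' A') g, q h' (?i g), q (?m h' B') g, q (?m (?m h' B') A') (?i g)]"
  have "l = ?m (?m h' (comm T_tau A B)) (?i h')"
    unfolding f(4) A_def B_def h'_def using hT fT by (simp add: TG.word_simps del: T_tau_simps)
  also have "\<dots> = ?m (?m h' (comm T_tau (comm T_tau A' g) B')) (?i h')"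
    using AB key AX by simp
  also have "\<dots> = foldr ?m cs \<one>\<^bsub>T_tau\<^esub>"
    unfolding q_def cs_def using T' g(1) h'(2) by (simp add: TG.word_simps del: T_tau_simps)
  finally have "l = foldr ?m cs \<one>\<^bsub>T_tau\<^esub>" .
  moreover have "length cs \<le> 4" unfolding cs_def by simp
  moreover have "set cs \<subseteq> T_tau'_conjugates g"
    using qC[of "?m h' A'" g] qC[of h' "?i g"] qC[of "?m h' B'" g] qC[of "?m (?m h' B') A'" "?i g"]
      D h'(1) T_tau'_mult unfolding cs_def by (simp del: T_tau_simps)
  ultimately show ?thesis unfolding products_def by blast
qed

section \<open>Uniform simplicity\<close>

lemma unit_PL_endpoints:
  assumes "f \<in> unit_PL"
  shows "f 0 = 0" "f 1 = 1" "f (0 + 1) = f 0 + 1"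
proof -
  obtain e where e: "0 < e" "\<And>x. x \<le> e \<or> 1 - e \<le> x \<Longrightarrow> f x = x"
    using assms unfolding unit_PL_def by blast
  show "f 0 = 0" "f 1 = 1" using e(2)[of 0] e(2)[of 1] e(1) by auto
  then show "f (0 + 1) = f 0 + 1" by simp
qed

lemma unit_PL_comp:
  assumes "f \<in> unit_PL" "g \<in> unit_PL"
  shows "f \<circ> g \<in> unit_PL"
proof -
  obtain d where d: "0 < d" "\<And>x. x \<le> d \<or> 1 - d \<le> x \<Longrightarrow> f x = x"
    using assms(1) unfolding unit_PL_def by blast
  obtain e where e: "0 < e" "\<And>x. x \<le> e \<or> 1 - e \<le> x \<Longrightarrow> g x = x"
    using assms(2) unfolding unit_PL_def by blast
  have "(f \<circ> g) x = x" if "x \<le> min d e \<or> 1 - min d e \<le> x" for x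
  proof -
    have "x \<le> d \<or> 1 - d \<le> x" "x \<le> e \<or> 1 - e \<le> x" using that by auto
    then show ?thesis using d(2) e(2) by simp
  qed
  then show ?thesis unfolding unit_PL_def using d(1) e(1) PL_comp unit_PL_PL[OF assms(1)] unit_PL_PL[OF assms(2)]
    by (intro CollectI conjI exI[of _ "min d e"]) auto
qed

lemma unit_PL_inv:
  assumes "f \<in> unit_PL"
  shows "finv f \<in> unit_PL"
proof -
  have f: "f \<in> PL" using assms by (rule unit_PL_PL)
  obtain e where e: "0 < e" "\<And>x. x \<le> e \<or> 1 - e \<le> x \<Longrightarrow> f x = x"
    using assms unfolding unit_PL_def by blast
  then have "\<forall>x. x \<le> e \<or> 1 - e \<le> x \<longrightarrow> finv f x = x" using f by (simp add: PL_inv_eq_iff)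
  then show ?thesis unfolding unit_PL_def using e(1) PL_inv[OF f] by blast
qed

text \<open>Maps supported in the open unit interval act on the circle as the elements of \<open>T\<close> that are the identity near \<open>0\<close>.\<close>

definition unit_circ :: "(real \<Rightarrow> real) \<Rightarrow> circle \<Rightarrow> circle" where
  "unit_circ f = circ (periodize 0 f)"

lemma unit_periodize_lifts:
  assumes "f \<in> unit_PL"
  shows "periodize 0 f \<in> lifts"
  using periodize_lifts[OF unit_PL_PL[OF assms] Z_tau_0 unit_PL_endpoints(3)[OF assms]] .

lemma unit_circ_T_tau: "f \<in> unit_PL \<Longrightarrow> unit_circ f \<in> carrier T_tau"
  unfolding unit_circ_def using circ_in_T_tau unit_periodize_lifts by blast

lemma unit_circ_comp:
  assumes f: "f \<in> unit_PL" and g: "g \<in> unit_PL"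
  shows "unit_circ (f \<circ> g) = unit_circ f \<otimes>\<^bsub>T_tau\<^esub> unit_circ g"
proof -
  have "periodize 0 (f \<circ> g) x = periodize 0 f (periodize 0 g x)" for x
  proof -
    define n where "n = \<lfloor>x\<rfloor>"
    have x: "0 + of_int n \<le> x" "x \<le> 0 + of_int n + 1"
      using of_int_floor_le[of x] floor_correct[of x] unfolding n_def by linarith+
    define y where "y = g (x - of_int n)"
    have "g 0 \<le> y" "y \<le> g 1" unfolding y_def using x unit_PL_PL[OF g] by (simp_all add: PL_le)
    then have y: "0 + of_int n \<le> y + of_int n" "y + of_int n \<le> 0 + of_int n + 1"
      using unit_PL_endpoints[OF g] by auto
    have "periodize 0 g x = y + of_int n"
      unfolding y_def using periodize_shift[OF unit_PL_endpoints(3)[OF g] x] .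
    moreover have "periodize 0 f (y + of_int n) = f y + of_int n"
      using periodize_shift[OF unit_PL_endpoints(3)[OF f] y] by simp
    moreover have "periodize 0 (f \<circ> g) x = f y + of_int n"
      unfolding y_def using periodize_shift[OF unit_PL_endpoints(3)[OF unit_PL_comp[OF f g]] x] by (simp add: comp_def)
    ultimately show ?thesis by simp
  qed
  then have "periodize 0 (f \<circ> g) = periodize 0 f \<circ> periodize 0 g" by auto
  then show ?thesis
    unfolding unit_circ_def using circ_comp unit_periodize_lifts f g by simp
qed

lemma unit_circ_inv:
  assumes f: "f \<in> unit_PL"
  shows "unit_circ (finv f) = inv\<^bsub>T_tau\<^esub> (unit_circ f)"
proof -
  have "id \<in> unit_PL" unfolding unit_PL_def by (auto intro: exI[of _ 1])
  moreover have "periodize 0 id = id" by (auto simp: periodize_def)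
  ultimately have "unit_circ id = \<one>\<^bsub>T_tau\<^esub>" by (simp add: unit_circ_def circ_id)
  then have "unit_circ (finv f) \<otimes>\<^bsub>T_tau\<^esub> unit_circ f = \<one>\<^bsub>T_tau\<^esub>"
    using unit_circ_comp[OF unit_PL_inv[OF f] f] unit_PL_PL[OF f] by simp
  from TG.inv_equality[OF this unit_circ_T_tau[OF f] unit_circ_T_tau[OF unit_PL_inv[OF f]]]
  show ?thesis by simp
qed

lemma unit_circ_fixing:
  assumes f: "f \<in> unit_PL"
  obtains e where "0 < e" "unit_circ f \<in> fixing (- e) e"
proof -
  obtain d where d: "0 < d" "\<And>x. x \<le> d \<or> 1 - d \<le> x \<Longrightarrow> f x = x"
    using f unfolding unit_PL_def by blast
  define e where "e = min d (1 / 2)"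
  have e: "0 < e" "e \<le> d" "e < 1" using d(1) unfolding e_def by auto
  have "periodize 0 f x = x" if x: "- e < x" "x < e" for x
  proof (cases "0 \<le> x")
    case True
    then show ?thesis using periodize_eq[OF unit_PL_endpoints(3)[OF f], of x] d(2)[of x] x e by simp
  next
    case False
    then show ?thesis
      using periodize_shift[OF unit_PL_endpoints(3)[OF f], of "-1" x] d(2)[of "x + 1"] x e by simp
  qed
  then have "unit_circ f \<in> fixing (- e) e"
    unfolding fixing_def circle_arc_def using unit_circ_T_tau[OF f] circ_to_circle[OF unit_periodize_lifts[OF f]]
    by (auto simp: unit_circ_def)
  then show thesis using that e(1) by blast
qed

lemma unit_circ_pcomm:
  assumes f: "f \<in> unit_PL" and g: "g \<in> unit_PL"
  shows "unit_circ (pcomm f g) \<in> local_commutators"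
proof -
  obtain d where d: "0 < d" "unit_circ f \<in> fixing (- d) d" using unit_circ_fixing[OF f] .
  obtain e where e: "0 < e" "unit_circ g \<in> fixing (- e) e" using unit_circ_fixing[OF g] .
  define c where "c = min d e"
  have c: "0 < c" "c \<le> d" "c \<le> e" using d e unfolding c_def by auto
  have 1: "- c < c" using c by simp
  have 2: "unit_circ f \<in> fixing (- c) c" using d(2) fixing_mono[of "-d" "-c" c d] c by auto
  have 3: "unit_circ g \<in> fixing (- c) c" using e(2) fixing_mono[of "-e" "-c" c e] c by auto
  have "unit_circ (pcomm f g) = comm T_tau (unit_circ f) (unit_circ g)"
    unfolding pcomm_def using f g unit_PL_inv
    by (simp add: unit_circ_comp unit_circ_inv unit_PL_comp del: T_tau_simps)
  then show ?thesis unfolding local_commutators_def using 1 2 3 by blast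
qed

text \<open>Near \<open>0\<close> a lift of \<open>f\<close> is an integer translation; after removing it, the lift can be cut at \<open>0\<close> and \<open>1\<close>.\<close>

lemma fixing_unit_circ:
  assumes f: "f \<in> fixing (- e) e" and e: "0 < e"
  obtains k where "k \<in> unit_PL" "f = unit_circ k"
proof -
  obtain F0 where F0: "F0 \<in> lifts" "f = circ F0" using fixing_T_tau[OF f] by (rule T_tau_lift)
  have F0P: "F0 \<in> PL" using F0 lifts_PL by blast
  have int: "F0 x - x \<in> \<int>" if "x \<in> {- e<..<e}" for x
  proof -
    have "f (to_circle x) = to_circle x" using f that unfolding fixing_def circle_arc_def by blast
    then show ?thesis using F0 circ_to_circle by (simp add: to_circle_eq_iff)
  qed
  have const: "F0 x - x = F0 0 - 0" if "x \<in> {- e<..<e}" for x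
  proof (rule int_valued_constant[where S = "{- e<..<e}" and f = "\<lambda>x. F0 x - x"])
    show "continuous_on {- e<..<e} (\<lambda>x. F0 x - x)"
      using continuous_on_subset[OF PL_continuous[OF F0P]] by (intro continuous_intros) auto
  qed (use int that e in auto)
  have "0 \<in> {- e<..<e}" using e by simp
  from int[OF this] obtain m where m: "F0 0 = of_int m" by (auto elim: Ints_cases)
  define F where "F = (\<lambda>x. x + of_int (- m)) \<circ> F0"
  have F: "F \<in> lifts" unfolding F_def by (intro lifts_comp lifts_translation F0 Z_tau_of_int)
  have fF: "f = circ F"
    by (rule circ_eqI[OF F]) (simp add: F0 circ_to_circle F_def to_circle_eq_iff)
  have Fe: "F x = x" if "- e < x" "x < e" for x
    using const[of x] that m unfolding F_def by auto
  have F1: "F (x + 1) = F x + 1" for x using F unfolding lifts_def by blast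
  have F01: "F 0 = 0" "F 1 = 1" using Fe[of 0] F1[of 0] e by auto
  define k where "k = glue 1 (glue 0 id F) id"
  have 1: "glue 0 id F \<in> PL" using F lifts_PL F01 by (intro PL_glue PL_id) auto
  have kP: "k \<in> PL" unfolding k_def by (rule PL_glue[OF 1]) (use F01 in \<open>auto simp: glue_def\<close>)
  have kF: "k x = F x" if "0 \<le> x" "x \<le> 1" for x
    using that F01 by (cases "x = 0") (auto simp: k_def glue_def)
  have kout: "k x = x" if "x \<le> 0 \<or> 1 \<le> x" for x
    using that F01 by (cases "x = 1") (auto simp: k_def glue_def)
  define d where "d = min (e / 2) (1 / 2)"
  have d: "0 < d" "d < e" "d < 1" using e unfolding d_def by auto
  have "k x = x" if x: "x \<le> d \<or> 1 - d \<le> x" for x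
  proof (cases "x \<le> 0 \<or> 1 \<le> x")
    case False
    then have kx: "k x = F x" using kF by simp
    show ?thesis
    proof (cases "x \<le> d")
      case True
      then show ?thesis using kx Fe[of x] False d by simp
    next
      case False
      then have "F (x - 1) = x - 1" using Fe[of "x - 1"] x d \<open>\<not> (x \<le> 0 \<or> 1 \<le> x)\<close> by simp
      then show ?thesis using kx F1[of "x - 1"] by simp
    qed
  qed (rule kout)
  then have kU: "k \<in> unit_PL" unfolding unit_PL_def using kP d(1) by blast
  have "periodize 0 k x = F x" for x
  proof -
    define n where "n = \<lfloor>x\<rfloor>"
    have x: "0 + of_int n \<le> x" "x \<le> 0 + of_int n + 1"
      using of_int_floor_le[of x] floor_correct[of x] unfolding n_def by linarith+
    have "periodize 0 k x = k (x - of_int n) + of_int n"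
      using periodize_shift[OF unit_PL_endpoints(3)[OF kU] x] .
    also have "\<dots> = F x" using kF[of "x - of_int n"] x lift_add_int[OF F, of "x - of_int n" n] by simp
    finally show ?thesis .
  qed
  then have "periodize 0 k = F" by blast
  then have "f = unit_circ k" unfolding fF unit_circ_def by simp
  then show thesis using that kU by blast
qed

lemma local_commutators_carrier: "local_commutators \<subseteq> carrier T_tau"
  using local_commutator_T_tau by blast

text \<open>Modulo the normal closure of the local commutators every element of \<open>T\<close> is represented by one that is the identity near
\<open>0\<close>, and the commutator of two such elements is local.\<close>

lemma T_tau'_generated: "T_tau' \<subseteq> generate T_tau local_commutators"
proof -
  define X where "X = generate T_tau local_commutators"
  have X: "X \<lhd> T_tau"
    unfolding X_def by (rule TG.normal_generateI[OF local_commutators_carrier local_commutator_conj])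
  obtain Q :: "(circle \<Rightarrow> circle) set monoid" and \<kappa> where h: "group_hom T_tau Q \<kappa>"
    and eq: "\<And>x y. x \<in> carrier T_tau \<Longrightarrow> y \<in> carrier T_tau \<Longrightarrow> \<kappa> x = \<kappa> y \<longleftrightarrow> x \<otimes>\<^bsub>T_tau\<^esub> inv\<^bsub>T_tau\<^esub> y \<in> X"
  proof (rule TG.quotient_hom[OF X])
    fix Q :: "(circle \<Rightarrow> circle) set monoid" and \<kappa>
    assume "group_hom T_tau Q \<kappa>"
      "\<And>x y. x \<in> carrier T_tau \<Longrightarrow> y \<in> carrier T_tau \<Longrightarrow> \<kappa> x = \<kappa> y \<longleftrightarrow> x \<otimes>\<^bsub>T_tau\<^esub> inv\<^bsub>T_tau\<^esub> y \<in> X"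
    then show thesis by (rule that)
  qed
  interpret h: group_hom T_tau Q \<kappa> by fact
  have trivial: "\<kappa> l = \<one>\<^bsub>Q\<^esub>" if "l \<in> X" for l
  proof -
    have "l \<in> carrier T_tau" using subgroup.mem_carrier[OF normal_imp_subgroup[OF X] that] .
    then show ?thesis using eq[of l "\<one>\<^bsub>T_tau\<^esub>"] that h.hom_one by (simp del: T_tau_simps)
  qed
  have loc: "l \<in> X" if "l \<in> local_commutators" for l unfolding X_def using that by (rule generate.incl)
  have approx: "\<exists>f' e. 0 < e \<and> f' \<in> fixing (- e) e \<and> \<kappa> f' = \<kappa> f" if f: "f \<in> carrier T_tau" for f
  proof -
    obtain l e where l: "l \<in> local_commutators" "0 < e" "inv\<^bsub>T_tau\<^esub> l \<otimes>\<^bsub>T_tau\<^esub> f \<in> fixing (- e) e"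
      using local_commutator_approximation[OF f] .
    have lT: "l \<in> carrier T_tau" using l(1) local_commutator_T_tau by blast
    have "\<kappa> (inv\<^bsub>T_tau\<^esub> l \<otimes>\<^bsub>T_tau\<^esub> f) = inv\<^bsub>Q\<^esub> (\<kappa> l) \<otimes>\<^bsub>Q\<^esub> \<kappa> f" using lT f by (simp del: T_tau_simps)
    also have "\<dots> = \<kappa> f" using trivial[OF loc[OF l(1)]] f by simp
    finally show ?thesis using l by blast
  qed
  have "comm T_tau f g \<in> X" if f: "f \<in> carrier T_tau" and g: "g \<in> carrier T_tau" for f g
  proof -
    obtain f' d where f': "0 < d" "f' \<in> fixing (- d) d" "\<kappa> f' = \<kappa> f" using approx[OF f] by blast
    obtain g' e where g': "0 < e" "g' \<in> fixing (- e) e" "\<kappa> g' = \<kappa> g" using approx[OF g] by blast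
    have T: "f' \<in> carrier T_tau" "g' \<in> carrier T_tau" using f' g' fixing_T_tau by auto
    define c where "c = min d e"
    have c: "0 < c" "c \<le> d" "c \<le> e" using f' g' unfolding c_def by auto
    have 1: "- c < c" using c by simp
    have 2: "f' \<in> fixing (- c) c" using f'(2) fixing_mono[of "-d" "-c" c d] c by auto
    have 3: "g' \<in> fixing (- c) c" using g'(2) fixing_mono[of "-e" "-c" c e] c by auto
    have "comm T_tau f' g' \<in> X" using loc 1 2 3 unfolding local_commutators_def by blast
    then have "\<kappa> (comm T_tau f' g') = \<one>\<^bsub>Q\<^esub>" by (rule trivial)
    moreover have "\<kappa> (comm T_tau f g) = \<kappa> (comm T_tau f' g')"
      using f g T f'(3) g'(3) by (simp del: T_tau_simps)
    ultimately have "\<kappa> (comm T_tau f g) = \<kappa> \<one>\<^bsub>T_tau\<^esub>" using h.hom_one by simp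
    then show ?thesis using eq[of "comm T_tau f g" "\<one>\<^bsub>T_tau\<^esub>"] f g by (simp del: T_tau_simps)
  qed
  moreover have "subgroup X T_tau" using X by (rule normal_imp_subgroup)
  ultimately show ?thesis
    unfolding derived_def X_def[symmetric] by (intro TG.generate_subgroup_incl) auto
qed

text \<open>One local commutator reduces \<open>f \<in> T'\<close> to a map \<open>k\<close> supported in the unit interval, whose image in \<open>T\<close> is in \<open>T'\<close>.  If \<open>k \<in> [F, F]\<close>,
two more suffice.  Otherwise \<open>k = d x\<close> with \<open>d \<in> [F, F]\<close> and a fixed \<open>x\<close> of this kind; the number of local commutators
that \<open>x\<close> requires is finite and independent of \<open>f\<close>.\<close>

lemma bounded_local_commutator_width:
  obtains N where "T_tau' \<subseteq> products T_tau local_commutators N"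
proof -
  let ?D = "derived end_group compact_PL"
  note L = local_commutators_carrier
  have two: "unit_circ k \<in> products T_tau local_commutators 2" if k: "k \<in> unit_PL" "k \<in> ?D" for k
  proof -
    obtain a b c d where abcd: "a \<in> unit_PL" "b \<in> unit_PL" "c \<in> unit_PL" "d \<in> unit_PL"
      "k = pcomm a b \<circ> pcomm c d"
      using unit_PL_two_commutators[OF k] .
    have p: "pcomm f g \<in> unit_PL" if "f \<in> unit_PL" "g \<in> unit_PL" for f g
      unfolding pcomm_def using that unit_PL_comp unit_PL_inv by blast
    have "unit_circ k = unit_circ (pcomm a b) \<otimes>\<^bsub>T_tau\<^esub> unit_circ (pcomm c d)"
      unfolding abcd(5) using p abcd by (intro unit_circ_comp) auto
    moreover have "unit_circ (pcomm a b) \<otimes>\<^bsub>T_tau\<^esub> unit_circ (pcomm c d) \<in> products T_tau local_commutators (1 + 1)"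
      using abcd by (intro TG.products_mult[OF L] TG.products_single[OF _ L] unit_circ_pcomm)
    ultimately show ?thesis by (simp add: numeral_2_eq_2)
  qed
  have "\<exists>n. \<forall>k\<in>unit_PL. unit_circ k \<in> T_tau' \<longrightarrow> unit_circ k \<in> products T_tau local_commutators n"
  proof (cases "\<exists>x\<in>unit_PL. x \<notin> ?D \<and> unit_circ x \<in> T_tau'")
    case True
    then obtain x where x: "x \<in> unit_PL" "x \<notin> ?D" "unit_circ x \<in> T_tau'" by blast
    obtain m where m: "unit_circ x \<in> products T_tau local_commutators m"
      using TG.generate_products[OF L local_commutator_inv] T_tau'_generated x(3) by blast
    have "unit_circ k \<in> products T_tau local_commutators (2 + m)" if k: "k \<in> unit_PL" for k
    proof (cases "k \<in> ?D")
      case True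
      then show ?thesis using two[OF k] TG.products_mono[of 2 "2 + m" local_commutators] by auto
    next
      case False
      have kx: "k \<circ> finv x \<in> unit_PL" using k x(1) unit_PL_comp unit_PL_inv by blast
      have "k \<circ> finv x \<in> ?D"
        using compact_PL_index_le_two[OF _ False _ x(2)] k x(1) unit_PL_compact by blast
      then have "unit_circ (k \<circ> finv x) \<in> products T_tau local_commutators 2" using two kx by blast
      then have "unit_circ (k \<circ> finv x) \<otimes>\<^bsub>T_tau\<^esub> unit_circ x \<in> products T_tau local_commutators (2 + m)"
        using m by (rule TG.products_mult[OF L])
      moreover have "k \<circ> finv x \<circ> x = k" using unit_PL_PL[OF x(1)] by (simp add: comp_assoc)
      ultimately show ?thesis using unit_circ_comp[OF kx x(1)] by simp
    qed
    then show ?thesis by blast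
  next
    case False
    then show ?thesis using two by blast
  qed
  then obtain n where n: "\<And>k. k \<in> unit_PL \<Longrightarrow> unit_circ k \<in> T_tau' \<Longrightarrow>
      unit_circ k \<in> products T_tau local_commutators n" by blast
  have "f \<in> products T_tau local_commutators (1 + n)" if f: "f \<in> T_tau'" for f
  proof -
    have fT: "f \<in> carrier T_tau" using f T_tau'_carrier by blast
    obtain l e where l: "l \<in> local_commutators" "0 < e" "inv\<^bsub>T_tau\<^esub> l \<otimes>\<^bsub>T_tau\<^esub> f \<in> fixing (- e) e"
      using local_commutator_approximation[OF fT] .
    obtain k where k: "k \<in> unit_PL" "inv\<^bsub>T_tau\<^esub> l \<otimes>\<^bsub>T_tau\<^esub> f = unit_circ k"
      using fixing_unit_circ[OF l(3,2)] .
    have "unit_circ k \<in> T_tau'"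
      unfolding k(2)[symmetric] using T_tau'_mult T_tau'_inv local_commutators_T_tau' l(1) f by blast
    then have "l \<otimes>\<^bsub>T_tau\<^esub> unit_circ k \<in> products T_tau local_commutators (1 + n)"
      by (intro TG.products_mult[OF L] TG.products_single[OF _ L] n k(1) l(1))
    moreover have "l \<otimes>\<^bsub>T_tau\<^esub> unit_circ k = f"
      unfolding k(2)[symmetric] using l(1) local_commutator_T_tau fT by (simp add: TG.word_simps del: T_tau_simps)
    ultimately show ?thesis by simp
  qed
  then show thesis using that by blast
qed

theorem proposition3p12:
  shows "uniformly_simple (commutator_subgroup T_tau)"
proof -
  let ?G = "commutator_subgroup T_tau"
  obtain N where N: "T_tau' \<subseteq> products T_tau local_commutators N"
    using bounded_local_commutator_width .
  have G: "carrier ?G = T_tau'" "mult ?G = mult T_tau" "\<one>\<^bsub>?G\<^esub> = \<one>\<^bsub>T_tau\<^esub>"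
    unfolding commutator_subgroup_def by simp_all
  have inv: "inv\<^bsub>?G\<^esub> h = inv\<^bsub>T_tau\<^esub> h" if "h \<in> T_tau'" for h
    unfolding commutator_subgroup_def using TG.m_inv_consistent[OF T_tau'_subgroup that] .
  have "group ?G"
    unfolding commutator_subgroup_def using TG.subgroup_imp_group[OF T_tau'_subgroup] .
  moreover have "\<exists>cs. length cs \<le> N * 4 \<and>
        set cs \<subseteq> conjugates ?G g \<union> conjugates ?G (inv\<^bsub>?G\<^esub> g) \<and>
        f = foldr (\<otimes>\<^bsub>?G\<^esub>) cs \<one>\<^bsub>?G\<^esub>"
    if f: "f \<in> carrier ?G - {\<one>\<^bsub>?G\<^esub>}" and g: "g \<in> carrier ?G - {\<one>\<^bsub>?G\<^esub>}" for f g
  proof -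
    have gT: "g \<in> carrier T_tau" "g \<noteq> id" "g \<in> T_tau'" using g T_tau'_carrier unfolding G by auto
    have "T_tau'_conjugates g \<subseteq> carrier T_tau"
      using gT T_tau'_carrier by (auto simp del: T_tau_simps)
    moreover have "local_commutators \<subseteq> products T_tau (T_tau'_conjugates g) 4"
      using local_commutator_four_conjugates[OF gT(1,2)] by blast
    ultimately have "products T_tau local_commutators N \<subseteq> products T_tau (T_tau'_conjugates g) (N * 4)"
      by (rule TG.products_subst)
    then have "f \<in> products T_tau (T_tau'_conjugates g) (N * 4)" using N f unfolding G by blast
    then obtain cs where cs: "length cs \<le> N * 4" "set cs \<subseteq> T_tau'_conjugates g"
      "f = foldr (\<otimes>\<^bsub>T_tau\<^esub>) cs \<one>\<^bsub>T_tau\<^esub>"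
      unfolding products_def by blast
    have "T_tau'_conjugates g \<subseteq> conjugates ?G g \<union> conjugates ?G (inv\<^bsub>?G\<^esub> g)"
    proof
      fix c assume "c \<in> T_tau'_conjugates g"
      then obtain h k where c: "c = h \<otimes>\<^bsub>T_tau\<^esub> k \<otimes>\<^bsub>T_tau\<^esub> inv\<^bsub>T_tau\<^esub> h" "h \<in> T_tau'"
        "k = g \<or> k = inv\<^bsub>T_tau\<^esub> g" by blast
      then have "c = h \<otimes>\<^bsub>T_tau\<^esub> k \<otimes>\<^bsub>T_tau\<^esub> inv\<^bsub>?G\<^esub> h" using inv[OF c(2)] by simp
      then have "c \<in> conjugates ?G k" unfolding conjugates_def G using c(2) by blast
      then show "c \<in> conjugates ?G g \<union> conjugates ?G (inv\<^bsub>?G\<^esub> g)" using c(3) inv[OF gT(3)] by auto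
    qed
    then show ?thesis unfolding G using cs by blast
  qed
  ultimately show ?thesis unfolding uniformly_simple_def n_uniformly_simple_def by blast
qed

end
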